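(* Let $|q|<1$. Then \begin{align*} \sum_{i,j\geq 0}\frac{q^{2i^2+ij+\frac{1}{2}j^2+\frac{1}{2}j}}{(q;q)_i(q;q)_j}&=\frac{(q^4,q^6,q^{10};q^{10})_\infty}{(q;q)_\infty},\\ \sum_{i,j\geq 0}\frac{q^{2i^2+ij+\frac{1}{2}j^2+2i+\frac{1}{2}j}}{(q;q)_i(q;q)_j}&=\frac{(q^2,q^8,q^{10};q^{10})_\infty}{(q;q)_\infty}. \end{align*} As a consequence, with $A=\begin{pmatrix}4&1\\1&1\end{pmatrix}$ and $(B,C)\in\{((0,1/2)^{\mathrm T},1/120),\ ((2,1/2)^{\mathrm T},49/120)\}$, the function $\tau\mapsto f_{A,B,C}(q^{120})$ (with $q=e^{2\pi i\tau}$) is a modular function on $\Gamma_1(28800)$.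
   Context: Notation: $(a;q)_n=\prod_{k=0}^{n-1}(1-aq^k)$, $(a;q)_\infty=\prod_{k\ge0}(1-aq^k)$, $(a_1,\dots,a_m;q)_n=(a_1;q)_n\cdots(a_m;q)_n$. Fractional powers $q^{x}$ mean $e^{2\pi i x\tau}$ where $q=e^{2\pi i\tau}$, $\tau$ in the upper half-plane. For a positive definite symmetric rational $2\times2$ matrix $A$, a rational vector $B$ and rational scalar $C$, the Nahm sum is $f_{A,B,C}(q)=\sum_{n=(n_1,n_2)^{\mathrm T}\in\mathbb{Z}_{\ge0}^2}\frac{q^{\frac12 n^{\mathrm T}An+n^{\mathrm T}B+C}}{(q;q)_{n_1}(q;q)_{n_2}}$. $\Gamma_1(N)=\{\gamma\in\mathrm{SL}_2(\mathbb Z):\gamma\equiv\begin{pmatrix}1&*\\0&1\end{pmatrix}\pmod N\}$. *)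

theory Defs
  imports "HOL-Complex_Analysis.Complex_Analysis" "HOL-Number_Theory.Cong"
begin

definition qpoch :: "complex \<Rightarrow> complex \<Rightarrow> nat \<Rightarrow> complex" where
  "qpoch a q n = (\<Prod>k<n. 1 - a * q ^ k)"

definition qpoch_inf :: "complex \<Rightarrow> complex \<Rightarrow> complex" where
  "qpoch_inf a q = (\<Prod>k. 1 - a * q ^ k)"

(* (a_1, ..., a_m; q)_\<infinity> *)
definition qpochs_inf :: "complex list \<Rightarrow> complex \<Rightarrow> complex" where
  "qpochs_inf as q = (\<Prod>a\<leftarrow>as. qpoch_inf a q)"

(* The fractional power q^x for q = exp (2 pi i tau).  It depends on tau and not only on q,
   so functions involving such powers are functions of tau; replacing q by q^m means
   replacing tau by m * tau. *)
definition qpow :: "complex \<Rightarrow> rat \<Rightarrow> complex" where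
  "qpow \<tau> x = exp (2 * of_real pi * \<i> * of_rat x * \<tau>)"

definition nahm_exponent :: "rat^2^2 \<Rightarrow> rat^2 \<Rightarrow> rat \<Rightarrow> rat^2 \<Rightarrow> rat" where
  "nahm_exponent A B C n =
     1/2 * (\<Sum>i\<in>UNIV. n $ i * (A *v n) $ i) + (\<Sum>i\<in>UNIV. n $ i * B $ i) + C"

definition nahm_sum :: "rat^2^2 \<Rightarrow> rat^2 \<Rightarrow> rat \<Rightarrow> complex \<Rightarrow> complex" where
  "nahm_sum A B C \<tau> =
     (\<Sum>\<^sub>\<infinity>(n1, n2)\<in>(UNIV :: (nat \<times> nat) set).
        qpow \<tau> (nahm_exponent A B C (vector [of_nat n1, of_nat n2]))
          / (qpoch (qpow \<tau> 1) (qpow \<tau> 1) n1 * qpoch (qpow \<tau> 1) (qpow \<tau> 1) n2))"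

definition SL2Z :: "(int^2^2) set" where
  "SL2Z = {\<gamma>. det \<gamma> = 1}"

definition Gamma1 :: "nat \<Rightarrow> (int^2^2) set" where
  "Gamma1 N = {\<gamma> \<in> SL2Z. [\<gamma> $ 1 $ 1 = 1] (mod int N) \<and> [\<gamma> $ 2 $ 1 = 0] (mod int N)
                          \<and> [\<gamma> $ 2 $ 2 = 1] (mod int N)}"

definition upper_half_plane :: "complex set" where
  "upper_half_plane = {\<tau>. Im \<tau> > 0}"

definition moebius_act :: "int^2^2 \<Rightarrow> complex \<Rightarrow> complex" where
  "moebius_act \<gamma> \<tau> =
     (of_int (\<gamma> $ 1 $ 1) * \<tau> + of_int (\<gamma> $ 1 $ 2)) / (of_int (\<gamma> $ 2 $ 1) * \<tau> + of_int (\<gamma> $ 2 $ 2))"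

(* Near i\<infinity>, f is a Laurent series with finite principal part in the local
   parameter exp (2 pi i tau / h), for some width h. *)
definition meromorphic_at_ii_inf :: "(complex \<Rightarrow> complex) \<Rightarrow> bool" where
  "meromorphic_at_ii_inf f \<longleftrightarrow>
     (\<exists>h::nat. h > 0 \<and> (\<exists>g y. g meromorphic_on {0} \<and>
        (\<forall>\<tau>. Im \<tau> > y \<longrightarrow> f \<tau> = g (exp (2 * of_real pi * \<i> * \<tau> / of_nat h)))))"

(* The cusps of a finite-index subgroup are the images of i\<infinity> under SL2Z, so the last
   condition is meromorphy at all cusps.  The predicate nicely_meromorphic_on excludes
   arbitrary values at removable singularities and fixes the value 0 at poles, so that the
   invariance may be required pointwise. *)
definition modular_function :: "(int^2^2) set \<Rightarrow> (complex \<Rightarrow> complex) \<Rightarrow> bool" where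
  "modular_function \<Gamma> f \<longleftrightarrow>
     f nicely_meromorphic_on upper_half_plane \<and>
     (\<forall>\<gamma>\<in>\<Gamma>. \<forall>\<tau>\<in>upper_half_plane. f (moebius_act \<gamma> \<tau>) = f \<tau>) \<and>
     (\<forall>\<gamma>\<in>SL2Z. meromorphic_at_ii_inf (\<lambda>\<tau>. f (moebius_act \<gamma> \<tau>)))"

end

(* Summing over j with Euler's identity turns the double sums into (-q;q)_inf times the
   Rogers-Ramanujan sums in base q^2, and these are evaluated by the q-difference equations of
   Hardy and Wright together with the Jacobi triple product.

   For the modularity, the resulting products are written with the Weber function f_2 and with
   Klein forms k_(u,v), as f_2(t) f_2(5t)^2 k_(1/2,0)(10t) / k_(s/5,0)(10t), s = 1, 2.  The sigma
   product behind the Klein forms satisfies its inversion formula by Liouville's theorem: both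
   sides have the same zeros and the same quasi-periods.  The sixth powers of the Weber functions
   are Klein quotients, so f_2(-1/t) is a constant times f_1(t); hence f_2 is multiplied by the
   same 24th root of unity under (1,1;0,1) and (1,0;2,1), which together with -1 generate
   Gamma_0(2).  This gives explicit multipliers, trivial on the group required.

   At the cusps no expansion is computed: |f(t)| <= exp(1 / Im t) makes every f(gamma t) of at most
   exponential growth in Im t, that is, polynomially bounded in 1/|w| for the local parameter w,
   so it has at worst a pole there. *)
theory Submission
  imports Defs
begin

text \<open>The factor f_2(5t)^2 k_(1/2,0)(10t) equals -1 / \<eta>(10t)^2. In this shape the whole
  quotient visibly has weight 0: the automorphy factors cancel between the two Klein forms, and
  every root of unity comes either from f_2 or from an even shift of a Klein index. The level is
  decided by f_2(5 * 120 t). This function sees the lower left entry c / 600, the exponent of its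
  multiplier contains half of that entry, and 28800 = 600 * 48 makes the half a multiple of 24. The
  two faces of the function share the work: invariance is read off the Klein quotient, holomorphy
  and growth off the product side.\<close>

section \<open>q-Pochhammer symbols\<close>

lemma qpoch_0 [simp]: "qpoch a q 0 = 1"
  by (simp add: qpoch_def)

lemma qpoch_zero [simp]: "qpoch 0 q n = 1"
  by (simp add: qpoch_def)

lemma qpoch_inf_zero [simp]: "qpoch_inf 0 q = 1"
  by (simp add: qpoch_inf_def)

lemma qpoch_Suc: "qpoch a q (Suc n) = qpoch a q n * (1 - a * q ^ n)"
  by (simp add: qpoch_def)

lemma qpoch_Suc_shift: "qpoch a q (Suc n) = (1 - a) * qpoch (a * q) q n"
  unfolding qpoch_def by (subst prod.lessThan_Suc_shift) (simp add: mult.assoc)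

lemma qpoch_add: "qpoch a q (m + n) = qpoch a q m * qpoch (a * q ^ m) q n"
  by (induction n) (simp_all add: qpoch_Suc power_add mult.assoc)

context
  fixes q :: complex
  assumes q: "norm q < 1"
begin

lemma summable_qpoch: "summable (\<lambda>k. norm (1 - a * q ^ k - 1))"
  using summable_mult[OF summable_geometric[of "norm q"], of "norm a"] q
  by (simp add: norm_mult norm_power)

lemma convergent_prod_qpoch: "convergent_prod (\<lambda>k. 1 - a * q ^ k)"
  by (rule abs_convergent_prod_imp_convergent_prod)
     (simp only: abs_convergent_prod_conv_summable summable_qpoch)

lemma qpoch_tendsto: "(\<lambda>n. qpoch a q n) \<longlonglongrightarrow> qpoch_inf a q"
proof -
  have "(\<lambda>n. \<Prod>k\<le>n. 1 - a * q ^ k) \<longlonglongrightarrow> qpoch_inf a q"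
    unfolding qpoch_inf_def by (rule convergent_prod_LIMSEQ[OF convergent_prod_qpoch])
  thus ?thesis unfolding qpoch_def using LIMSEQ_lessThan_iff_atMost by blast
qed

text \<open>Any subsequence of the partial products determines the infinite product; the index maps
  n + 1, n + m and n * m occur below.\<close>

lemma qpoch_inf_eqI:
  assumes "(\<lambda>n. qpoch a q (f n)) \<longlonglongrightarrow> L" "filterlim f at_top sequentially"
  shows "qpoch_inf a q = L"
  using LIMSEQ_unique[OF filterlim_compose[OF qpoch_tendsto assms(2)] assms(1)] .

lemma qpoch_inf_unfold: "qpoch_inf a q = (1 - a) * qpoch_inf (a * q) q"
  by (rule qpoch_inf_eqI[OF _ filterlim_Suc])
     (unfold qpoch_Suc_shift, intro tendsto_intros qpoch_tendsto)

lemma qpoch_inf_split: "qpoch_inf a q = qpoch a q n * qpoch_inf (a * q ^ n) q"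
  by (rule qpoch_inf_eqI[OF _ filterlim_add_const_nat_at_top[of n]])
     (unfold add.commute[of _ n] qpoch_add, intro tendsto_intros qpoch_tendsto)

lemma qpoch_inf_eq_0_iff: "qpoch_inf a q = 0 \<longleftrightarrow> (\<exists>k. a * q ^ k = 1)"
  using has_prod_eq_0_iff[OF convergent_prod_has_prod[OF convergent_prod_qpoch[of a]]]
  by (auto simp: qpoch_inf_def)

lemma qpoch_inf_nonzero: "norm a < 1 \<Longrightarrow> qpoch_inf a q \<noteq> 0"
proof
  assume a: "norm a < 1" and "qpoch_inf a q = 0"
  then obtain k where "a * q ^ k = 1" by (auto simp: qpoch_inf_eq_0_iff)
  hence "norm a * norm q ^ k = 1" by (metis norm_mult norm_one norm_power)
  moreover have "norm a * norm q ^ k \<le> norm a * 1"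
    using q by (intro mult_left_mono power_le_one) auto
  ultimately show False using a by simp
qed

lemma qpoch_nonzero: "norm a < 1 \<Longrightarrow> qpoch a q n \<noteq> 0"
  using qpoch_inf_split[of a n] qpoch_inf_nonzero[of a] by auto

text \<open>From 1 + x \<le> exp x and the geometric series. The bound does not involve n, so it
  passes to the infinite product and supplies constants for dominated limits.\<close>

lemma norm_qpoch_le: "norm (qpoch a q n) \<le> exp (norm a / (1 - norm q))"
proof -
  have "norm (qpoch a q n) \<le> (\<Prod>k<n. exp (norm a * norm q ^ k))"
    unfolding qpoch_def prod_norm[symmetric]
  proof (intro prod_mono conjI)
    fix k
    have "norm (1 - a * q ^ k) \<le> 1 + norm a * norm q ^ k"
      using norm_triangle_ineq4[of 1 "a * q ^ k"] by (simp add: norm_mult norm_power)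
    also have "\<dots> \<le> exp (norm a * norm q ^ k)" by (rule exp_ge_add_one_self)
    finally show "norm (1 - a * q ^ k) \<le> exp (norm a * norm q ^ k)" .
  qed auto
  also have "\<dots> = exp (norm a * (\<Sum>k<n. norm q ^ k))"
    by (simp add: exp_sum sum_distrib_left)
  also have "(\<Sum>k<n. norm q ^ k) \<le> (\<Sum>k. norm q ^ k)"
    using q by (intro sum_le_suminf summable_geometric) auto
  also have "(\<Sum>k. norm q ^ k) = 1 / (1 - norm q)"
    using q by (intro suminf_geometric) auto
  finally show ?thesis by (simp add: mult_left_mono)
qed

lemma norm_qpoch_inf_le: "norm (qpoch_inf a q) \<le> exp (norm a / (1 - norm q))"
  by (rule LIMSEQ_le_const2[OF tendsto_norm[OF qpoch_tendsto]]) (use norm_qpoch_le in blast)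

end

text \<open>The factors are sorted by the residue of their index modulo m.\<close>

lemma qpoch_inf_dissect:
  assumes q: "norm q < 1" and m: "m > 0"
  shows "qpoch_inf a q = (\<Prod>r<m. qpoch_inf (a * q ^ r) (q ^ m))"
proof (rule qpoch_inf_eqI[OF q])
  have qm: "norm (q ^ m) < 1" using q m by (simp add: norm_power power_less_one_iff)
  have eq: "qpoch a q (n * m) = (\<Prod>r<m. qpoch (a * q ^ r) (q ^ m) n)" for n
  proof (induction n)
    case (Suc n)
    have "qpoch (a * q ^ (n * m)) q m = (\<Prod>r<m. 1 - a * q ^ r * (q ^ m) ^ n)"
      unfolding qpoch_def by (intro prod.cong refl) (simp add: power_mult[symmetric] mult_ac)
    with Suc show ?case
      using qpoch_add[of a q "n * m" m] by (simp add: add.commute qpoch_Suc prod.distrib)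
  qed simp
  show "(\<lambda>n. qpoch a q (n * m)) \<longlonglongrightarrow> (\<Prod>r<m. qpoch_inf (a * q ^ r) (q ^ m))"
    unfolding eq by (intro tendsto_prod qpoch_tendsto qm)
  show "filterlim (\<lambda>n. n * m) at_top sequentially"
    using m by (intro filterlim_at_top_mono[OF filterlim_ident]) auto
qed

text \<open>Factor by factor (1 - x)(1 + x) = 1 - x^2. With a = q this is the link between the bases
  q and q^2.\<close>

lemma qpoch_inf_mult_uminus:
  assumes q: "norm q < 1"
  shows "qpoch_inf a q * qpoch_inf (- a) q = qpoch_inf (a\<^sup>2) (q\<^sup>2)"
proof -
  have q2: "norm (q\<^sup>2) < 1" using q by (simp add: norm_power power_less_one_iff)
  have "qpoch a q n * qpoch (- a) q n = qpoch (a\<^sup>2) (q\<^sup>2) n" for n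
    unfolding qpoch_def prod.distrib[symmetric]
    by (intro prod.cong refl) (simp add: algebra_simps power2_eq_square power_mult_distrib)
  hence "(\<lambda>n. qpoch (a\<^sup>2) (q\<^sup>2) n) \<longlonglongrightarrow> qpoch_inf a q * qpoch_inf (- a) q"
    using tendsto_mult[OF qpoch_tendsto[OF q, of a] qpoch_tendsto[OF q, of "- a"]] by simp
  thus ?thesis using LIMSEQ_unique[OF qpoch_tendsto[OF q2]] by metis
qed

lemma holomorphic_on_qpoch_inf [holomorphic_intros]:
  assumes f: "f holomorphic_on A" and g: "g holomorphic_on A" and A: "open A"
    and g1: "\<And>z. z \<in> A \<Longrightarrow> norm (g z) < 1"
  shows "(\<lambda>z. qpoch_inf (f z) (g z)) holomorphic_on A"
proof (rule holomorphic_uniform_sequence[OF A])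
  show "(\<lambda>z. qpoch (f z) (g z) n) holomorphic_on A" for n
    unfolding qpoch_def by (intro holomorphic_intros f g)
  fix x assume x: "x \<in> A"
  then obtain d where d: "d > 0" "cball x d \<subseteq> A"
    using A open_contains_cball by blast
  let ?C = "cball x d"
  have cf: "continuous_on ?C f" and cg: "continuous_on ?C g"
    using holomorphic_on_subset[OF f d(2)] holomorphic_on_subset[OF g d(2)]
    by (auto intro: holomorphic_on_imp_continuous_on)
  have "compact (f ` ?C)" "compact (g ` ?C)"
    using cf cg by (auto intro: compact_continuous_image)
  then obtain B where B: "\<And>z. z \<in> ?C \<Longrightarrow> norm (f z) \<le> B"
    by (metis bounded_iff compact_imp_bounded imageI)
  \<comment> \<open>On a compact disc the maximum of \<open>norm (g z)\<close> is attained, hence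
    still below 1; its powers give the Weierstrass majorant.\<close>
  obtain w where w: "w \<in> ?C" "\<And>z. z \<in> ?C \<Longrightarrow> norm (g z) \<le> norm (g w)"
    using continuous_attains_sup[of ?C "\<lambda>z. norm (g z)"] continuous_on_norm[OF cg] d(1)
    by (metis cball_eq_empty compact_cball not_less_iff_gr_or_eq)
  have r: "norm (g w) < 1" using w d g1 by blast
  have "uniformly_convergent_on ?C (\<lambda>N z. \<Prod>n<N. 1 - f z * g z ^ n)"
  proof (rule uniformly_convergent_on_prod')
    show "uniformly_convergent_on ?C (\<lambda>N z. \<Sum>n<N. norm (1 - f z * g z ^ n - 1))"
    proof (rule Weierstrass_m_test'_ev[OF always_eventually])
      show "summable (\<lambda>n. B * norm (g w) ^ n)"
        using r by (intro summable_mult summable_geometric) auto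
      show "\<forall>n. \<forall>z\<in>?C. norm (norm (1 - f z * g z ^ n - 1)) \<le> B * norm (g w) ^ n"
        using B w(2) norm_ge_zero
        by (auto simp: norm_mult norm_power intro!: mult_mono power_mono)
           (metis B norm_ge_zero order_trans)
    qed
  qed (auto intro!: continuous_intros cf cg)
  then obtain l where l: "uniform_limit ?C (\<lambda>N z. \<Prod>n<N. 1 - f z * g z ^ n) l sequentially"
    unfolding uniformly_convergent_on_def by blast
  have "l z = qpoch_inf (f z) (g z)" if "z \<in> ?C" for z
    using LIMSEQ_unique[OF tendsto_uniform_limitI[OF l that]] qpoch_tendsto[of "g z" "f z"] g1[of z] that d
    by (auto simp: qpoch_def)
  with l have "uniform_limit ?C (\<lambda>N z. qpoch (f z) (g z) N) (\<lambda>z. qpoch_inf (f z) (g z)) sequentially"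
    unfolding qpoch_def by (subst (asm) uniform_limit_cong') auto
  with d show "\<exists>d>0. cball x d \<subseteq> A \<and>
      uniform_limit (cball x d) (\<lambda>N z. qpoch (f z) (g z) N) (\<lambda>z. qpoch_inf (f z) (g z)) sequentially"
    by blast
qed

section \<open>Gaussian binomials and Euler sums\<close>

lemma zero_choose_two [simp]: "0 choose 2 = 0"
  by (simp add: numeral_2_eq_2)

lemma choose_two_Suc: "Suc k choose 2 = (k choose 2) + k"
  by (simp add: numeral_2_eq_2)

text \<open>Consecutive terms have the ratio r ^ k * y, which tends to 0 for every y. This is the
  common majorant of the theta-like series below.\<close>

lemma summable_power_choose_two:
  fixes r y :: real
  assumes r: "0 \<le> r" "r < 1"
  shows "summable (\<lambda>k. r ^ (k choose 2) * y ^ k)"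
proof -
  have "(\<lambda>k. r ^ k * \<bar>y\<bar>) \<longlonglongrightarrow> 0 * \<bar>y\<bar>"
    using r by (intro tendsto_intros LIMSEQ_realpow_zero)
  hence "eventually (\<lambda>k. r ^ k * \<bar>y\<bar> < 1/2) sequentially"
    by (rule order_tendstoD) simp
  then obtain N where N: "\<And>k. k \<ge> N \<Longrightarrow> r ^ k * \<bar>y\<bar> < 1/2"
    by (auto simp: eventually_sequentially)
  show ?thesis
  proof (rule summable_ratio_test[of "1/2" N])
    fix n assume "n \<ge> N"
    hence "r ^ n * \<bar>y\<bar> * (r ^ (n choose 2) * \<bar>y\<bar> ^ n) \<le> 1/2 * (r ^ (n choose 2) * \<bar>y\<bar> ^ n)"
      using N[of n] r by (intro mult_right_mono) auto
    thus "norm (r ^ (Suc n choose 2) * y ^ Suc n) \<le> 1/2 * norm (r ^ (n choose 2) * y ^ n)"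
      using r by (simp add: choose_two_Suc abs_mult power_abs power_add mult_ac)
  qed simp
qed

text \<open>The value 0 for k > n replaces the truncated subtraction n - k, and it lets finite sums
  be read as infinite series, the form in which Tannery's theorem takes them.\<close>

definition qbin :: "complex \<Rightarrow> nat \<Rightarrow> nat \<Rightarrow> complex" where
  "qbin q n k = (if k \<le> n then qpoch q q n / (qpoch q q k * qpoch q q (n - k)) else 0)"

context
  fixes q :: complex
  assumes q: "norm q < 1"
begin

lemma qpoch_self_nonzero [simp]: "qpoch q q n \<noteq> 0"
  by (rule qpoch_nonzero[OF q q])

lemma qbin_symmetric: "k \<le> n \<Longrightarrow> qbin q n (n - k) = qbin q n k"
  by (simp add: qbin_def)

lemma qbin_0 [simp]: "qbin q n 0 = 1"
  by (simp add: qbin_def)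

text \<open>The q-Pascal rule in the variant whose power q ^ (n - k) combines with the q ^ k from
  the binomial exponent to q ^ n, the last factor of \<open>qpoch x q (Suc n)\<close>.\<close>

lemma qbin_Suc_Suc:
  assumes "k \<le> n"
  shows "qbin q (Suc n) (Suc k) = qbin q n (Suc k) + q ^ (n - k) * qbin q n k"
proof (cases "k = n")
  case False
  then obtain m where n: "n = Suc (k + m)"
    using assms less_imp_Suc_add[of k n] by auto
  have nz: "1 - q * q ^ i \<noteq> 0" for i
    using qpoch_self_nonzero[of "Suc i"] by (auto simp: qpoch_Suc)
  have "qbin q (Suc n) (Suc k) = qpoch q q n * (1 - q * q ^ n) / (qpoch q q (Suc k) * (qpoch q q m * (1 - q * q ^ m)))"
    by (simp add: qbin_def n qpoch_Suc Suc_diff_le)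
  moreover have "qbin q n (Suc k) = qpoch q q n / (qpoch q q (Suc k) * qpoch q q m)"
    by (simp add: qbin_def n)
  moreover have "qbin q n k = qpoch q q n * (1 - q * q ^ k) / (qpoch q q (Suc k) * (qpoch q q m * (1 - q * q ^ m)))"
    using nz[of k] by (simp add: qbin_def n qpoch_Suc Suc_diff_le)
  moreover have "q ^ (n - k) = q * q ^ m" "q * q ^ n = (q * q ^ m) * (q * q ^ k)"
    by (simp_all add: n Suc_diff_le power_add)
  \<comment> \<open>With u = q ^ (m + 1) and v = q ^ (k + 1) this is 1 - uv = (1 - u) + u (1 - v)
    over a common denominator.\<close>
  moreover have "A * (1 - u * v) / (S * (M * (1 - u))) = A / (S * M) + u * (A * (1 - v) / (S * (M * (1 - u))))"
    if "S \<noteq> 0" "M \<noteq> 0" "1 - u \<noteq> 0" for A S M u v :: complex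
    using that by (simp add: field_simps)
  ultimately show ?thesis
    using nz[of m] by (metis qpoch_self_nonzero)
qed (simp add: qbin_def)

text \<open>Rothe's identity. Its limit in n is Euler's sum, and with 2n factors and a shifted x it
  becomes the finite triple product.\<close>

theorem qbinomial:
  "qpoch x q n = (\<Sum>k\<le>n. (- 1) ^ k * q ^ (k choose 2) * qbin q n k * x ^ k)"
proof (induction n)
  case (Suc n)
  define t where "t = (\<lambda>n k. (- 1) ^ k * q ^ (k choose 2) * qbin q n k)"
  have rec: "t (Suc n) (Suc k) = t n (Suc k) - q ^ n * t n k" if "k \<le> n" for k
  proof -
    have "q ^ n = q ^ k * q ^ (n - k)" using that by (simp flip: power_add)
    thus ?thesis using qbin_Suc_Suc[OF that]
      by (simp add: t_def choose_two_Suc power_add algebra_simps)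
  qed
  have t0: "t m 0 = 1" for m by (simp add: t_def numeral_2_eq_2)
  have "(\<Sum>k\<le>Suc n. t (Suc n) k * x ^ k) = 1 + (\<Sum>k\<le>n. t (Suc n) (Suc k) * x ^ Suc k)"
    by (subst sum.atMost_Suc_shift) (simp add: t0)
  also have "(\<Sum>k\<le>n. t (Suc n) (Suc k) * x ^ Suc k)
      = (\<Sum>k\<le>n. t n (Suc k) * x ^ Suc k) - q ^ n * x * (\<Sum>k\<le>n. t n k * x ^ k)"
    unfolding sum_distrib_left sum_subtractf[symmetric]
    by (intro sum.cong refl) (simp add: rec algebra_simps)
  also have "1 + ((\<Sum>k\<le>n. t n (Suc k) * x ^ Suc k) - q ^ n * x * (\<Sum>k\<le>n. t n k * x ^ k))
      = (\<Sum>k\<le>Suc n. t n k * x ^ k) - q ^ n * x * (\<Sum>k\<le>n. t n k * x ^ k)"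
    using sum.atMost_Suc_shift[of "\<lambda>k. t n k * x ^ k" n] by (simp add: t0)
  also have "(\<Sum>k\<le>Suc n. t n k * x ^ k) = (\<Sum>k\<le>n. t n k * x ^ k)"
    by (simp add: t_def qbin_def)
  finally show ?case
    using Suc by (simp add: t_def qpoch_Suc algebra_simps)
qed simp

lemma inverse_qpoch_bounded:
  obtains B where "B > 0" "\<And>n. norm (inverse (qpoch q q n)) \<le> B"
proof -
  have "(\<lambda>n. inverse (qpoch q q n)) \<longlonglongrightarrow> inverse (qpoch_inf q q)"
    by (intro tendsto_inverse qpoch_tendsto q qpoch_inf_nonzero)
  hence "Bseq (\<lambda>n. inverse (qpoch q q n))"
    using convergentI convergent_imp_Bseq by blast
  thus ?thesis using that by (auto elim: BseqE)
qed

text \<open>Uniform in both indices, as the domination in Tannery's theorem requires.\<close>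

lemma qbin_bounded:
  obtains B where "B > 0" "\<And>n k. norm (qbin q n k) \<le> B"
proof -
  obtain B where B: "B > 0" "\<And>n. norm (inverse (qpoch q q n)) \<le> B"
    by (rule inverse_qpoch_bounded) blast
  define C where "C = exp (norm q / (1 - norm q))"
  have "norm (qbin q n k) \<le> C * (B * B)" for n k
  proof (cases "k \<le> n")
    case True
    have "norm (qbin q n k) = norm (qpoch q q n) *
        (norm (inverse (qpoch q q k)) * norm (inverse (qpoch q q (n - k))))"
      using True by (simp add: qbin_def norm_divide norm_mult norm_inverse field_simps)
    also have "\<dots> \<le> C * (B * B)"
      unfolding C_def using B by (intro mult_mono norm_qpoch_le q) auto
    finally show ?thesis .
  qed (use B in \<open>simp add: qbin_def C_def\<close>)
  thus ?thesis using B by (intro that[of "C * (B * B)"]) (auto simp: C_def)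
qed

lemma qbin_tendsto:
  assumes "filterlim f at_top sequentially" "filterlim (\<lambda>n. g n - f n) at_top sequentially"
    "\<And>n. f n \<le> g n"
  shows "(\<lambda>n. qbin q (g n) (f n)) \<longlonglongrightarrow> inverse (qpoch_inf q q)"
proof -
  have g: "filterlim g at_top sequentially"
    using assms(1,3) by (auto intro: filterlim_at_top_mono)
  have nz: "qpoch_inf q q \<noteq> 0" by (rule qpoch_inf_nonzero[OF q q])
  have "(\<lambda>n. qpoch q q (g n) / (qpoch q q (f n) * qpoch q q (g n - f n)))
      \<longlonglongrightarrow> qpoch_inf q q / (qpoch_inf q q * qpoch_inf q q)"
    by (intro tendsto_divide tendsto_mult filterlim_compose[OF qpoch_tendsto[OF q]] assms g)
       (simp add: nz)
  thus ?thesis using nz assms(3) by (simp add: qbin_def field_simps)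
qed

lemma qbin_tendsto': "(\<lambda>n. qbin q n k) \<longlonglongrightarrow> inverse (qpoch q q k)"
proof -
  have nz: "qpoch_inf q q \<noteq> 0" by (rule qpoch_inf_nonzero[OF q q])
  have "(\<lambda>n. qpoch q q n / (qpoch q q k * qpoch q q (n - k)))
      \<longlonglongrightarrow> qpoch_inf q q / (qpoch q q k * qpoch_inf q q)"
    by (intro tendsto_divide tendsto_mult tendsto_const qpoch_tendsto q
          filterlim_compose[OF qpoch_tendsto[OF q] filterlim_minus_const_nat_at_top]) (simp add: nz)
  hence "(\<lambda>n. qpoch q q n / (qpoch q q k * qpoch q q (n - k))) \<longlonglongrightarrow> inverse (qpoch q q k)"
    using nz by (simp add: field_simps)
  thus ?thesis
    by (rule Lim_transform_eventually)
       (auto simp: qbin_def intro: eventually_mono[OF eventually_ge_at_top[of k]])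
qed

text \<open>Limit of \<open>qbinomial\<close> by Tannery's theorem. Absolute convergence is recorded
  because the sum over j is later taken as an unordered \<open>has_sum\<close>.\<close>

theorem euler_sums:
  "(\<lambda>k. (- 1) ^ k * q ^ (k choose 2) * x ^ k / qpoch q q k) sums qpoch_inf x q"
  "summable (\<lambda>k. norm ((- 1) ^ k * q ^ (k choose 2) * x ^ k / qpoch q q k))"
proof -
  obtain B where B: "B > 0" "\<And>n k. norm (qbin q n k) \<le> B" by (rule qbin_bounded) blast
  define a where "a = (\<lambda>k n. (- 1) ^ k * q ^ (k choose 2) * qbin q n k * x ^ k)"
  define b where "b = (\<lambda>k. (- 1) ^ k * q ^ (k choose 2) * x ^ k / qpoch q q k)"
  have T: "eventually (\<lambda>n. summable (\<lambda>k. norm (a k n))) sequentially \<and>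
           summable (\<lambda>n. norm (b n)) \<and> ((\<lambda>n. suminf (\<lambda>k. a k n)) \<longlonglongrightarrow> suminf b)"
  proof (rule tannerys_theorem)
    show "(\<lambda>n. a k n) \<longlonglongrightarrow> b k" for k
      unfolding a_def b_def
      by (rule tendsto_eq_intros qbin_tendsto' refl)+ (simp add: field_simps)
    show "summable (\<lambda>k. B * (norm q ^ (k choose 2) * norm x ^ k))"
      using q by (intro summable_mult summable_power_choose_two) auto
    have "norm (a k n) \<le> B * (norm q ^ (k choose 2) * norm x ^ k)" for k n
      using mult_right_mono[OF B(2)[of n k], of "norm q ^ (k choose 2) * norm x ^ k"]
      by (simp add: a_def norm_mult norm_power mult_ac)
    thus "eventually (\<lambda>(k, n). norm (a k n) \<le> B * (norm q ^ (k choose 2) * norm x ^ k))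
        (at_top \<times>\<^sub>F sequentially)"
      by (intro always_eventually) auto
  qed auto
  have "suminf (\<lambda>k. a k n) = qpoch x q n" for n
    unfolding qbinomial a_def by (rule suminf_finite) (auto simp: qbin_def)
  hence "suminf b = qpoch_inf x q"
    using T LIMSEQ_unique[OF qpoch_tendsto[OF q, of x]] by auto
  with T show "b sums qpoch_inf x q" "summable (\<lambda>k. norm (b k))"
    using summable_norm_cancel summable_sums by (metis, blast)
qed

end

section \<open>The Jacobi triple product\<close>

lemma choose_two_add: "(m + n choose 2) = (m choose 2) + m * n + (n choose 2)"
  by (induction n) (simp_all add: choose_two_Suc numeral_2_eq_2)

context
  fixes q :: complex
  assumes q: "norm q < 1"
begin

text \<open>Cauchy's method: in \<open>qbinomial\<close> for 2n factors at z / q ^ n the first n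
  factors, taken backwards, are those of (q / z; q)_n up to a monomial. The terms k = n + j and k =
  n - 1 - j are paired, so that the bilateral sum is indexed by natural numbers.\<close>

lemma finite_jacobi_triple:
  assumes q0: "q \<noteq> 0" and z: "z \<noteq> 0"
  shows "qpoch z q n * qpoch (q / z) q n =
    (\<Sum>j\<le>n. (- 1) ^ j * (z ^ j * q ^ (j choose 2) * qbin q (2 * n) (n + j)
       - inverse z ^ Suc j * q ^ (j + 2 choose 2) * qbin q (2 * n) (Suc (n + j))))"
proof -
  \<comment> \<open>\<open>K\<close> is the inverse of the monomial obtained by pulling - z / q ^ (i
    + 1) out of each of the n reversed factors.\<close>
  define K where "K = q ^ (Suc n choose 2) / (- z) ^ n"
  define f where "f = (\<lambda>k. (- 1) ^ k * q ^ (k choose 2) * qbin q (2 * n) k * (z / q ^ n) ^ k)"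
  have rev: "K * qpoch (z / q ^ n) q n = qpoch (q / z) q n"
  proof -
    have "qpoch (z / q ^ n) q n = (\<Prod>i<n. 1 - z / q ^ Suc i)"
      unfolding qpoch_def
    proof (rule prod.reindex_bij_witness[of _ "\<lambda>i. n - Suc i" "\<lambda>i. n - Suc i"])
      fix k assume "k \<in> {..<n}"
      hence "q ^ n = q ^ Suc (n - Suc k) * q ^ k" by (simp flip: power_add power_Suc)
      thus "1 - z / q ^ Suc (n - Suc k) = 1 - z / q ^ n * q ^ k" using q0 by simp
    qed auto
    also have "\<dots> = (\<Prod>i<n. (- z / q ^ Suc i) * (1 - q / z * q ^ i))"
      using q0 z by (intro prod.cong refl) (simp add: field_simps)
    also have "\<dots> = (- z) ^ n / (\<Prod>i<n. q ^ Suc i) * qpoch (q / z) q n"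
      by (simp only: qpoch_def prod.distrib prod_dividef prod_constant card_lessThan)
    also have "(\<Prod>i<n. q ^ Suc i) = q ^ (Suc n choose 2)" for n
      by (induction n) (simp_all add: choose_two_Suc power_add numeral_2_eq_2)
    finally show ?thesis using q0 z by (simp add: K_def field_simps)
  qed
  have "qpoch z q n * qpoch (q / z) q n = K * qpoch (z / q ^ n) q (n + n)"
    unfolding rev[symmetric] qpoch_add using q0 by simp
  also have "\<dots> = K * (\<Sum>k\<le>n + n. f k)"
    by (subst qbinomial[OF q]) (simp add: f_def mult_2)
  also have "(\<Sum>k\<le>n + n. f k) = (\<Sum>j\<le>n. f (n + j)) + (\<Sum>j<n. f (n - Suc j))"
  proof -
    have "(\<Sum>k\<le>n + n. f k) = (\<Sum>k\<in>{n..n + n}. f k) + (\<Sum>k<n. f k)"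
      by (subst sum.union_disjoint[symmetric]) (auto intro!: sum.cong)
    also have "(\<Sum>k\<in>{n..n + n}. f k) = (\<Sum>j\<le>n. f (n + j))"
      by (rule sum.reindex_bij_witness[of _ "\<lambda>j. n + j" "\<lambda>k. k - n"]) auto
    also have "(\<Sum>k<n. f k) = (\<Sum>j<n. f (n - Suc j))"
      by (rule sum.reindex_bij_witness[of _ "\<lambda>j. n - Suc j" "\<lambda>k. n - Suc k"]) auto
    finally show ?thesis .
  qed
  also have "K * ((\<Sum>j\<le>n. f (n + j)) + (\<Sum>j<n. f (n - Suc j))) =
     (\<Sum>j\<le>n. (- 1) ^ j * (z ^ j * q ^ (j choose 2) * qbin q (2 * n) (n + j)))
     + (\<Sum>j<n. - ((- 1) ^ j * (inverse z ^ Suc j * q ^ (j + 2 choose 2) * qbin q (2 * n) (Suc (n + j)))))"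
    unfolding distrib_left sum_distrib_left
  proof (intro arg_cong2[of _ _ _ _ "(+)"] sum.cong refl)
    fix j
    have "q ^ (n + j choose 2) * q ^ (Suc n choose 2) = q ^ (n * (n + j)) * q ^ (j choose 2)"
    proof -
      have "(n choose 2) + (Suc n choose 2) = n * n"
        using choose_two_add[of n n] by (simp add: choose_two_Suc) (induction n, simp_all add: choose_two_Suc numeral_2_eq_2)
      thus ?thesis unfolding power_add[symmetric] choose_two_add by (simp add: algebra_simps)
    qed
    moreover have "(q ^ j) ^ n = (q ^ n) ^ j" by (simp only: power_mult[symmetric] mult.commute)
    ultimately show "K * f (n + j) = (- 1) ^ j * (z ^ j * q ^ (j choose 2) * qbin q (2 * n) (n + j))"
      using q0 z
      by (simp add: K_def f_def power_add power_divide power_mult power_minus[of z] field_simps)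
  next
    fix j assume "j \<in> {..<n}"
    then obtain k where n: "n = Suc (k + j)"
      using less_imp_Suc_add[of j n] by (auto simp: add.commute)
    have "qbin q (2 * n) k = qbin q (2 * n) (Suc (n + j))"
      using qbin_symmetric[OF q, of "Suc (n + j)" "2 * n"] by (simp add: n)
    moreover have "q ^ (k choose 2) * q ^ (Suc n choose 2) = q ^ (n * k) * q ^ (j + 2 choose 2)"
    proof -
      have "(k choose 2) + (Suc (Suc (k + j)) choose 2) = Suc (k + j) * k + (Suc (Suc j) choose 2)"
        by (induction k) (simp_all add: choose_two_Suc)
      thus ?thesis unfolding power_add[symmetric] n by simp
    qed
    moreover have "n - Suc j = k" by (simp add: n)
    moreover have "(q ^ k) ^ n = (q ^ n) ^ k" by (simp only: power_mult[symmetric] mult.commute)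
    moreover have "z ^ n = z ^ k * z ^ Suc j" "(-1::complex) ^ n = - ((-1) ^ k * (-1) ^ j)"
      by (simp_all add: n power_add)
    ultimately show "K * f (n - Suc j) =
      - ((- 1) ^ j * (inverse z ^ Suc j * q ^ (j + 2 choose 2) * qbin q (2 * n) (Suc (n + j))))"
      using q0 z
      by (simp add: K_def f_def power_divide power_mult power_minus[of z] field_simps)
  qed
  \<comment> \<open>The added term j = n contains \<open>qbin q (2 * n) (2 * n + 1)\<close>, which
    is 0.\<close>
  also have "(\<Sum>j<n. - ((- 1) ^ j * (inverse z ^ Suc j * q ^ (j + 2 choose 2) * qbin q (2 * n) (Suc (n + j)))))
     = (\<Sum>j\<le>n. - ((- 1) ^ j * (inverse z ^ Suc j * q ^ (j + 2 choose 2) * qbin q (2 * n) (Suc (n + j)))))"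
    by (simp add: lessThan_Suc_atMost[symmetric] qbin_def)
  finally show ?thesis
    by (simp add: sum.distrib[symmetric] algebra_simps sum_negf sum_subtractf)
qed

text \<open>The bilateral theta series folded at 0: the index -(j + 1) contributes the second
  summand, with the exponent (j + 1)(j + 2) / 2.\<close>

theorem jacobi_triple_sums:
  assumes q0: "q \<noteq> 0" and z: "z \<noteq> 0"
  shows "(\<lambda>j. (- 1) ^ j * (z ^ j * q ^ (j choose 2) - inverse z ^ Suc j * q ^ (j + 2 choose 2)))
    sums (qpoch_inf z q * qpoch_inf (q / z) q * qpoch_inf q q)"
proof -
  obtain B where B: "B > 0" "\<And>n k. norm (qbin q n k) \<le> B" by (rule qbin_bounded[OF q]) blast
  define L where "L = inverse (qpoch_inf q q)"
  define a where "a = (\<lambda>j n. (- 1) ^ j * (z ^ j * q ^ (j choose 2) * qbin q (2 * n) (n + j)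
       - inverse z ^ Suc j * q ^ (j + 2 choose 2) * qbin q (2 * n) (Suc (n + j))))"
  define b where "b = (\<lambda>j. (- 1) ^ j * (z ^ j * q ^ (j choose 2) * L - inverse z ^ Suc j * q ^ (j + 2 choose 2) * L))"
  define M where "M = (\<lambda>j. B * (norm q ^ (j choose 2) * norm z ^ j) +
     B * norm (inverse z) * (norm q ^ (j choose 2) * norm (inverse z) ^ j))"
  have T: "eventually (\<lambda>n. summable (\<lambda>k. norm (a k n))) sequentially \<and>
           summable (\<lambda>n. norm (b n)) \<and> ((\<lambda>n. suminf (\<lambda>k. a k n)) \<longlonglongrightarrow> suminf b)"
  proof (rule tannerys_theorem)
    have lim: "(\<lambda>n. qbin q (2 * n) (n + j)) \<longlonglongrightarrow> L" for j
    proof -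
      \<comment> \<open>\<open>qbin_tendsto\<close> wants the lower index at most the upper one for
        all n, and n + j \<le> 2 * n fails for small n; hence the shift of n by j.\<close>
      have "(\<lambda>n. qbin q (2 * (n + j)) (n + 2 * j)) \<longlonglongrightarrow> L" unfolding L_def
      proof (rule qbin_tendsto[OF q])
        show "filterlim (\<lambda>n. n + 2 * j) at_top sequentially" by (rule filterlim_add_const_nat_at_top)
        show "filterlim (\<lambda>n. 2 * (n + j) - (n + 2 * j)) at_top sequentially"
          by (rule filterlim_at_top_mono[OF filterlim_ident]) auto
      qed auto
      thus ?thesis
        using LIMSEQ_offset[of "\<lambda>n. qbin q (2 * n) (n + j)" j L] by (simp add: add.assoc mult_2)
    qed
    show "(\<lambda>n. a j n) \<longlonglongrightarrow> b j" for j
      unfolding a_def b_def add_Suc_right[symmetric] by (intro tendsto_intros lim)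
    show "summable M" unfolding M_def
      using q by (intro summable_add summable_mult summable_power_choose_two) auto
    have "norm (a j n) \<le> M j" for j n
    proof -
      have dec: "norm q ^ (j + 2 choose 2) \<le> norm q ^ (j choose 2)"
        using q by (intro power_decreasing) (auto simp: choose_two_Suc)
      have "norm (a j n) \<le> norm (z ^ j * q ^ (j choose 2) * qbin q (2 * n) (n + j)) +
          norm (inverse z ^ Suc j * q ^ (j + 2 choose 2) * qbin q (2 * n) (Suc (n + j)))"
        unfolding a_def norm_mult[of "(-1) ^ j"] by (simp add: norm_power norm_triangle_ineq4)
      also have "\<dots> = norm z ^ j * norm q ^ (j choose 2) * norm (qbin q (2 * n) (n + j)) +
          norm (inverse z) ^ Suc j * norm q ^ (j + 2 choose 2) * norm (qbin q (2 * n) (Suc (n + j)))"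
        by (simp only: norm_mult norm_power)
      also have "\<dots> \<le> norm z ^ j * norm q ^ (j choose 2) * B +
          norm (inverse z) ^ Suc j * norm q ^ (j choose 2) * B"
        using B by (intro add_mono mult_mono dec order_refl) auto
      finally show ?thesis by (simp add: M_def mult_ac)
    qed
    thus "eventually (\<lambda>(k, n). norm (a k n) \<le> M k) (at_top \<times>\<^sub>F sequentially)"
      by (intro always_eventually) auto
  qed auto
  have "suminf (\<lambda>k. a k n) = qpoch z q n * qpoch (q / z) q n" for n
    unfolding finite_jacobi_triple[OF q0 z] a_def
    by (rule suminf_finite) (auto simp: qbin_def)
  hence "suminf b = qpoch_inf z q * qpoch_inf (q / z) q"
    using T LIMSEQ_unique[OF tendsto_mult[OF qpoch_tendsto[OF q] qpoch_tendsto[OF q]], of z "q / z"]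
    by auto
  hence "b sums (qpoch_inf z q * qpoch_inf (q / z) q)"
    using T summable_norm_cancel summable_sums by metis
  moreover have "b j * qpoch_inf q q = (- 1) ^ j * (z ^ j * q ^ (j choose 2) - inverse z ^ Suc j * q ^ (j + 2 choose 2))" for j
  proof -
    have "L * qpoch_inf q q = 1" using qpoch_inf_nonzero[OF q q] by (simp add: L_def)
    thus ?thesis by (simp only: b_def left_diff_distrib mult.assoc mult_1_right)
  qed
  ultimately show ?thesis using sums_mult2[of b _ "qpoch_inf q q"] by simp
qed

end

section \<open>The Rogers--Ramanujan identities\<close>

text \<open>Moves \<open>u\<close> by one index, so that its term r + 1 can be merged with the term
  r of \<open>v\<close>. Both q-difference equations for \<open>rr1\<close> and \<open>rr2\<close>
  arise in this way.\<close>

lemma suminf_telescope: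
  fixes u v :: "nat \<Rightarrow> complex"
  assumes "summable u" "summable v" "u 0 = 0"
  shows "(\<Sum>r. u r + v r) = (\<Sum>r. u (Suc r) + v r)"
proof -
  have "(\<Sum>r. u (Suc r)) = suminf u" using suminf_split_head[OF assms(1)] assms(3) by simp
  moreover have "summable (\<lambda>r. u (Suc r))" using summable_Suc_iff[of u] assms(1) by blast
  ultimately show ?thesis using suminf_add[OF assms(1,2)] suminf_add[OF _ assms(2)] by metis
qed

definition rr_coeff :: "complex \<Rightarrow> complex \<Rightarrow> nat \<Rightarrow> complex" where
  "rr_coeff q a r = qpoch a q r / qpoch q q r"

text \<open>
  Hardy and Wright use the exponent $r(5r+1)/2 - mr$; it is written as $5 {r \choose 2} + lr$ with
  $l = 3 - m$ so that it stays in the natural numbers.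
\<close>

definition rr_term :: "complex \<Rightarrow> nat \<Rightarrow> nat \<Rightarrow> complex \<Rightarrow> nat \<Rightarrow> complex" where
  "rr_term q m l a r = (- 1) ^ r * a ^ (2 * r) * q ^ (5 * (r choose 2) + l * r) * (1 - a ^ m * q ^ (2 * m * r)) * rr_coeff q a r"

definition rr1 :: "complex \<Rightarrow> complex \<Rightarrow> complex" where
  "rr1 q a = suminf (rr_term q 1 2 a)"

definition rr2 :: "complex \<Rightarrow> complex \<Rightarrow> complex" where
  "rr2 q a = suminf (rr_term q 2 1 a)"

text \<open>Normalised so that a = q and a = q^2 give the two Rogers-Ramanujan sums.\<close>

definition rr_sum :: "complex \<Rightarrow> complex \<Rightarrow> complex" where
  "rr_sum q a = (\<Sum>n. a ^ n * q ^ (n * (n - 1)) / qpoch q q n)"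

context
  fixes q :: complex
  assumes q: "norm q < 1"
begin

text \<open>This and \<open>rr_coeff_shift\<close> have the same right-hand side. It is the quantity
  in which the shifted series, the unshifted one and the series at a * q are compared below.\<close>

lemma rr_coeff_Suc:
  "(1 - q * q ^ r) * rr_coeff q a (Suc r) = (1 - a * q ^ r) * rr_coeff q a r"
  using qpoch_nonzero[OF q q, of "Suc r"] by (simp add: rr_coeff_def qpoch_Suc)

lemma rr_coeff_shift: "(1 - a) * rr_coeff q (a * q) r = (1 - a * q ^ r) * rr_coeff q a r"
  using qpoch_Suc_shift[of a q r] by (simp add: rr_coeff_def qpoch_Suc mult.commute)

lemma rr_coeff_bounded:
  obtains B where "B > 0" "\<And>a r. norm a \<le> R \<Longrightarrow> norm (rr_coeff q a r) \<le> B"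
proof -
  obtain B where B: "B > 0" "\<And>n. norm (inverse (qpoch q q n)) \<le> B"
    by (rule inverse_qpoch_bounded[OF q]) blast
  have "norm (rr_coeff q a r) \<le> exp (R / (1 - norm q)) * B" if "norm a \<le> R" for a r
  proof -
    have "norm (qpoch a q r) \<le> exp (R / (1 - norm q))"
      using norm_qpoch_le[OF q, of a r] that q
      by (smt (verit) divide_right_mono exp_le_cancel_iff)
    thus ?thesis unfolding rr_coeff_def divide_inverse norm_mult
      using B by (intro mult_mono) auto
  qed
  thus ?thesis using B by (intro that[of "exp (R / (1 - norm q)) * B"]) auto
qed

lemma rr_summable:
  assumes "\<And>r. norm (f r) \<le> B"
  shows "summable (\<lambda>r. (- 1) ^ r * a ^ (2 * r) * q ^ (5 * (r choose 2) + l * r) * f r)"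
proof (rule summable_comparison_test'[of _ 0])
  show "summable (\<lambda>r. B * ((norm q ^ 5) ^ (r choose 2) * (norm a ^ 2) ^ r))"
    using q by (intro summable_mult summable_power_choose_two) (auto simp: power_less_one_iff)
  fix r
  have "norm ((- 1) ^ r * a ^ (2 * r) * q ^ (5 * (r choose 2) + l * r) * f r)
     = (norm a ^ 2) ^ r * norm q ^ (5 * (r choose 2) + l * r) * norm (f r)"
    by (simp add: norm_mult norm_power power_mult)
  also have "\<dots> \<le> (norm a ^ 2) ^ r * norm q ^ (5 * (r choose 2)) * B"
    using assms[of r] q by (intro mult_mono order_refl power_decreasing) auto
  finally show "norm ((- 1) ^ r * a ^ (2 * r) * q ^ (5 * (r choose 2) + l * r) * f r)
     \<le> B * ((norm q ^ 5) ^ (r choose 2) * (norm a ^ 2) ^ r)"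
    by (simp add: power_mult mult_ac)
qed

lemma rr_summable':
  "summable (\<lambda>r. (- 1) ^ r * a ^ (2 * r) * q ^ (5 * (r choose 2) + l * r) * (1 - c * q ^ (k * r)) * rr_coeff q a r)"
proof -
  obtain B where B: "B > 0" "\<And>b r. norm b \<le> norm a \<Longrightarrow> norm (rr_coeff q b r) \<le> B"
    by (rule rr_coeff_bounded[of "norm a"]) blast
  have "norm ((1 - c * q ^ (k * r)) * rr_coeff q a r) \<le> (1 + norm c * 1) * B" for r
  proof -
    have "norm (1 - c * q ^ (k * r)) \<le> 1 + norm c * norm q ^ (k * r)"
      using norm_triangle_ineq4[of 1 "c * q ^ (k * r)"] by (simp add: norm_mult norm_power)
    also have "\<dots> \<le> 1 + norm c * 1"
      using q by (intro add_left_mono mult_left_mono power_le_one) auto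
    finally show ?thesis unfolding norm_mult using B by (intro mult_mono) auto
  qed
  from rr_summable[OF this] show ?thesis by (simp add: mult.assoc)
qed

lemma summable_rr_term: "summable (rr_term q m l a)"
  using rr_summable'[of a l "a ^ m" "2 * m"] unfolding rr_term_def[abs_def] .

lemma choose_two_exp:
  "q ^ (5 * (Suc r choose 2) + l * Suc r) = q ^ (5 * (r choose 2)) * q ^ (5 * r) * q ^ (l * r) * q ^ l"
  by (simp add: choose_two_Suc power_add algebra_simps)

text \<open>Split 1 - a q^(2r) = (1 - q^r) + q^r (1 - a q^r). The first part vanishes at r = 0 and
  may be shifted by one index; then the terms recombine to those of \<open>rr2\<close> at a *
  q.\<close>

lemma rr1_eq: "rr1 q a = (1 - a) * rr2 q (a * q)"
proof -
  define u where "u = (\<lambda>r. (- 1) ^ r * a ^ (2 * r) * q ^ (5 * (r choose 2) + 2 * r) * (1 - q ^ r) * rr_coeff q a r)"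
  define v where "v = (\<lambda>r. (- 1) ^ r * a ^ (2 * r) * q ^ (5 * (r choose 2) + 3 * r) * (1 - a * q ^ r) * rr_coeff q a r)"
  have su: "summable u" using rr_summable'[of a 2 1 1] by (simp add: u_def)
  have sv: "summable v" using rr_summable'[of a 3 a 1] by (simp add: v_def)
  have "rr_term q 1 2 a r = u r + v r" for r
    unfolding rr_term_def u_def v_def power_add power_mult power2_eq_square power3_eq_cube
    by (simp add: power_mult_distrib algebra_simps)
  hence "rr_term q 1 2 a = (\<lambda>r. u r + v r)" by (rule ext)
  moreover have "u 0 = 0" by (simp add: u_def)
  ultimately have "rr1 q a = (\<Sum>r. u (Suc r) + v r)"
    unfolding rr1_def using suminf_telescope[OF su sv] by simp
  also have "(\<lambda>r. u (Suc r) + v r) = (\<lambda>r. (1 - a) * rr_term q 2 1 (a * q) r)"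
  proof
    fix r
    have "u (Suc r) = - ((- 1) ^ r * a ^ (2 * r) * a\<^sup>2 * (q ^ (5 * (r choose 2)) * q ^ (5 * r) * q ^ (2 * r) * q ^ 2) * ((1 - q * q ^ r) * rr_coeff q a (Suc r)))"
      unfolding u_def choose_two_exp by (simp add: power2_eq_square)
    moreover have "(1 - a) * rr_term q 2 1 (a * q) r = (- 1) ^ r * (a * q) ^ (2 * r) * (q ^ (5 * (r choose 2)) * q ^ r) * (1 - (a * q)\<^sup>2 * q ^ (4 * r)) * ((1 - a) * rr_coeff q (a * q) r)"
      by (simp add: rr_term_def power_add mult_ac)
    moreover have "v r = (- 1) ^ r * a ^ (2 * r) * (q ^ (5 * (r choose 2)) * q ^ (3 * r)) * ((1 - a * q ^ r) * rr_coeff q a r)"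
      by (simp add: v_def power_add)
    moreover have "q ^ (5 * r) = (q ^ r) ^ 5" "q ^ (2 * r) = (q ^ r) ^ 2" "q ^ (3 * r) = (q ^ r) ^ 3" "q ^ (4 * r) = (q ^ r) ^ 4"
      by (simp_all only: power_mult[symmetric] mult.commute)
    moreover have "(a * q) ^ (2 * r) = a ^ (2 * r) * (q ^ r) ^ 2"
      by (simp only: power_mult_distrib power_mult[symmetric] mult.commute)
    ultimately show "u (Suc r) + v r = (1 - a) * rr_term q 2 1 (a * q) r" unfolding rr_coeff_Suc rr_coeff_shift
      by (simp only:) (simp add: eval_nat_numeral algebra_simps)
  qed
  finally show ?thesis
    unfolding rr2_def by (simp add: suminf_mult[OF summable_rr_term])
qed

text \<open>The same device, for the difference of the two series: q^r (1 - a^2 q^(4r)) - q^(2r) (1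
  - a q^(2r)) = q^r (1 - q^r) + a q^(4r) (1 - a q^r).\<close>

lemma rr2_eq: "rr2 q a = rr1 q a + a * (1 - a) * rr1 q (a * q)"
proof -
  define u where "u = (\<lambda>r. (- 1) ^ r * a ^ (2 * r) * q ^ (5 * (r choose 2) + 1 * r) * (1 - q ^ r) * rr_coeff q a r)"
  define v where "v = (\<lambda>r. a * ((- 1) ^ r * a ^ (2 * r) * q ^ (5 * (r choose 2) + 4 * r) * (1 - a * q ^ r) * rr_coeff q a r))"
  have su: "summable u" using rr_summable'[of a 1 1 1] by (simp add: u_def)
  have sv: "summable v" unfolding v_def
    using summable_mult[OF rr_summable'[of a 4 a 1], of a] by simp
  have "rr_term q 2 1 a r - rr_term q 1 2 a r = u r + v r" for r
    unfolding rr_term_def u_def v_def power_add power_mult power2_eq_square power3_eq_cube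
    by (simp add: power_mult_distrib algebra_simps eval_nat_numeral)
  hence "(\<lambda>r. rr_term q 2 1 a r - rr_term q 1 2 a r) = (\<lambda>r. u r + v r)" by (rule ext)
  moreover have "u 0 = 0" by (simp add: u_def)
  ultimately have "rr2 q a - rr1 q a = (\<Sum>r. u (Suc r) + v r)"
    unfolding rr1_def rr2_def
    using suminf_telescope[OF su sv] suminf_diff[OF summable_rr_term summable_rr_term, of 2 1 a 1 2 a] by simp
  also have "(\<lambda>r. u (Suc r) + v r) = (\<lambda>r. a * (1 - a) * rr_term q 1 2 (a * q) r)"
  proof
    fix r
    have "u (Suc r) = - ((- 1) ^ r * a ^ (2 * r) * a\<^sup>2 * (q ^ (5 * (r choose 2)) * q ^ (5 * r) * q ^ (1 * r) * q ^ 1) * ((1 - q * q ^ r) * rr_coeff q a (Suc r)))"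
      unfolding u_def choose_two_exp by (simp add: power2_eq_square)
    moreover have "a * (1 - a) * rr_term q 1 2 (a * q) r = a * ((- 1) ^ r * (a * q) ^ (2 * r) * (q ^ (5 * (r choose 2)) * q ^ (2 * r)) * (1 - (a * q) * q ^ (2 * r)) * ((1 - a) * rr_coeff q (a * q) r))"
      by (simp add: rr_term_def power_add mult_ac)
    moreover have "v r = a * ((- 1) ^ r * a ^ (2 * r) * (q ^ (5 * (r choose 2)) * q ^ (4 * r)) * ((1 - a * q ^ r) * rr_coeff q a r))"
      by (simp add: v_def power_add)
    moreover have "q ^ (5 * r) = (q ^ r) ^ 5" "q ^ (2 * r) = (q ^ r) ^ 2" "q ^ (1 * r) = q ^ r" "q ^ (4 * r) = (q ^ r) ^ 4"
      by (simp_all only: power_mult[symmetric] mult.commute mult_1_right mult_1)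
    moreover have "(a * q) ^ (2 * r) = a ^ (2 * r) * (q ^ r) ^ 2"
      by (simp only: power_mult_distrib power_mult[symmetric] mult.commute)
    ultimately show "u (Suc r) + v r = a * (1 - a) * rr_term q 1 2 (a * q) r" unfolding rr_coeff_Suc rr_coeff_shift
      by (simp only:) (simp add: eval_nat_numeral algebra_simps)
  qed
  finally have "rr2 q a - rr1 q a = a * (1 - a) * rr1 q (a * q)"
    using suminf_mult[OF summable_rr_term] by (simp only: rr1_def)
  thus ?thesis by (simp add: diff_eq_eq add.commute)
qed

lemma summable_rr_sum: "summable (\<lambda>n. norm (a ^ n * q ^ (n * (n - 1)) / qpoch q q n))"
proof -
  obtain B where B: "B > 0" "\<And>n. norm (inverse (qpoch q q n)) \<le> B"
    by (rule inverse_qpoch_bounded[OF q]) blast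
  show ?thesis
  proof (rule summable_comparison_test'[of _ 0])
    show "summable (\<lambda>n. B * ((norm q ^ 2) ^ (n choose 2) * norm a ^ n))"
      using q by (intro summable_mult summable_power_choose_two) (auto simp: power_less_one_iff)
    fix n
    have "n * (n - 1) = 2 * (n choose 2)" by (cases n) (simp_all add: choose_two)
    thus "norm (norm (a ^ n * q ^ (n * (n - 1)) / qpoch q q n)) \<le> B * ((norm q ^ 2) ^ (n choose 2) * norm a ^ n)"
      using mult_right_mono[OF B(2)[of n], of "(norm q ^ 2) ^ (n choose 2) * norm a ^ n"]
      by (simp add: norm_mult norm_divide norm_power norm_inverse power_mult divide_inverse mult_ac)
  qed
qed

text \<open>Replacing a by a * q inserts q^n, and the resulting factor 1 - q^n cancels the last
  factor of (q; q)_n; what is left is the same series at a * q^2, one index lower.\<close>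

lemma rr_sum_eq: "rr_sum q a = rr_sum q (a * q) + a * rr_sum q (a * q\<^sup>2)"
proof -
  define t where "t = (\<lambda>a n. a ^ n * q ^ (n * (n - 1)) / qpoch q q n)"
  have s: "summable (t a)" for a
    unfolding t_def using summable_norm_cancel[OF summable_rr_sum] .
  have "rr_sum q a - rr_sum q (a * q) = (\<Sum>n. t a n - t (a * q) n)"
    unfolding rr_sum_def using suminf_diff[OF s s, of a "a * q"] by (simp add: t_def)
  also have "\<dots> = (\<Sum>n. t a (Suc n) - t (a * q) (Suc n))"
    using suminf_split_head[OF summable_diff[OF s s], of a "a * q"] by (simp add: t_def)
  also have "(\<lambda>n. t a (Suc n) - t (a * q) (Suc n)) = (\<lambda>n. a * t (a * q\<^sup>2) n)"
  proof
    fix n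
    have "1 - q * q ^ n \<noteq> 0" "qpoch q q n \<noteq> 0" using qpoch_nonzero[OF q q, of "Suc n"] by (auto simp: qpoch_Suc)
    moreover have "q ^ (Suc n * (Suc n - 1)) = q ^ (n * (n - 1)) * (q\<^sup>2) ^ n"
    proof -
      have "Suc n * (Suc n - 1) = n * (n - 1) + 2 * n" by (cases n) simp_all
      thus ?thesis by (simp only: power_add power_mult)
    qed
    ultimately show "t a (Suc n) - t (a * q) (Suc n) = a * t (a * q\<^sup>2) n"
      by (simp add: t_def qpoch_Suc power_mult_distrib divide_simps) (simp add: algebra_simps)
  qed
  finally show ?thesis
    using suminf_mult[OF s, of a "a * q\<^sup>2"] by (simp add: rr_sum_def t_def algebra_simps)
qed

section \<open>Behaviour along a * q ^ n and uniqueness\<close>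

lemma power_shift_tendsto_0: "(\<lambda>n. a * q ^ n) \<longlonglongrightarrow> 0"
  using tendsto_mult[OF tendsto_const LIMSEQ_power_zero[OF q], of a] by simp

lemma norm_shift_le: "norm (a * q ^ n) \<le> norm a"
  using q by (simp add: norm_mult norm_power mult_left_le power_le_one)

lemma rr2_tendsto: "(\<lambda>n. rr2 q (a * q ^ n)) \<longlonglongrightarrow> 1"
proof -
  obtain B where B: "B > 0" "\<And>b r. norm b \<le> norm a \<Longrightarrow> norm (rr_coeff q b r) \<le> B"
    by (rule rr_coeff_bounded[of "norm a"]) blast
  define M where "M = (\<lambda>r. (1 + norm a ^ 2) * B * ((norm q ^ 5) ^ (r choose 2) * (norm a ^ 2) ^ r))"
  have "((\<lambda>n. suminf (\<lambda>r. rr_term q 2 1 (a * q ^ n) r)) \<longlonglongrightarrow> (\<Sum>r. rr_term q 2 1 0 r))"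
  proof (rule tannerys_theorem[THEN conjunct2, THEN conjunct2])
    show "(\<lambda>n. rr_term q 2 1 (a * q ^ n) r) \<longlonglongrightarrow> rr_term q 2 1 0 r" for r
      unfolding rr_term_def rr_coeff_def qpoch_def
      by (intro tendsto_intros power_shift_tendsto_0) (use qpoch_nonzero[OF q q, of r] in \<open>simp add: qpoch_def\<close>)
    show "summable M" unfolding M_def
      using q by (intro summable_mult summable_power_choose_two) (auto simp: power_less_one_iff)
    have "norm (rr_term q 2 1 b r) \<le> M r" if b: "norm b \<le> norm a" for b r
    proof -
      have "norm (1 - b\<^sup>2 * q ^ (2 * 2 * r)) \<le> 1 + norm b ^ 2 * norm q ^ (2 * 2 * r)"
        using norm_triangle_ineq4[of 1 "b\<^sup>2 * q ^ (2 * 2 * r)"] by (simp add: norm_mult norm_power)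
      also have "\<dots> \<le> 1 + norm a ^ 2 * 1"
        using q b by (intro add_left_mono mult_mono power_le_one power_mono) auto
      finally have 1: "norm (1 - b\<^sup>2 * q ^ (2 * 2 * r)) \<le> 1 + norm a ^ 2" by simp
      have "norm (rr_term q 2 1 b r) = (norm b ^ 2) ^ r * norm q ^ (5 * (r choose 2) + r) * norm (1 - b\<^sup>2 * q ^ (2 * 2 * r)) * norm (rr_coeff q b r)"
        by (simp add: rr_term_def norm_mult norm_power power_mult)
      also have "\<dots> \<le> (norm a ^ 2) ^ r * norm q ^ (5 * (r choose 2)) * (1 + norm a ^ 2) * B"
        using q b B 1 by (intro mult_mono power_decreasing power_mono) auto
      finally show ?thesis by (simp add: M_def power_mult mult_ac)
    qed
    thus "eventually (\<lambda>(r, n). norm (rr_term q 2 1 (a * q ^ n) r) \<le> M r) (at_top \<times>\<^sub>F sequentially)"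
      by (intro always_eventually) (auto simp: norm_shift_le)
  qed auto
  moreover have "(\<Sum>r. rr_term q 2 1 0 r) = 1"
    by (subst suminf_finite[of "{0}"]) (auto simp: rr_term_def rr_coeff_def)
  ultimately show ?thesis by (simp add: rr2_def)
qed

lemma rr_sum_tendsto: "(\<lambda>n. rr_sum q (a * q ^ n)) \<longlonglongrightarrow> 1"
proof -
  have "((\<lambda>n. suminf (\<lambda>k. (a * q ^ n) ^ k * q ^ (k * (k - 1)) / qpoch q q k))
      \<longlonglongrightarrow> (\<Sum>k. 0 ^ k * q ^ (k * (k - 1)) / qpoch q q k))"
  proof (rule tannerys_theorem[THEN conjunct2, THEN conjunct2])
    show "(\<lambda>n. (a * q ^ n) ^ k * q ^ (k * (k - 1)) / qpoch q q k)
        \<longlonglongrightarrow> 0 ^ k * q ^ (k * (k - 1)) / qpoch q q k" for k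
      by (intro tendsto_intros power_shift_tendsto_0 qpoch_nonzero[OF q q])
    show "summable (\<lambda>k. norm (a ^ k * q ^ (k * (k - 1)) / qpoch q q k))"
      by (rule summable_rr_sum)
    have "norm ((a * q ^ n) ^ k * q ^ (k * (k - 1)) / qpoch q q k) \<le> norm (a ^ k * q ^ (k * (k - 1)) / qpoch q q k)" for k n
      using power_mono[OF norm_shift_le[of a n], of k]
      by (simp add: norm_mult norm_divide norm_power divide_right_mono mult_right_mono)
    thus "eventually (\<lambda>(k, n). norm ((a * q ^ n) ^ k * q ^ (k * (k - 1)) / qpoch q q k)
        \<le> norm (a ^ k * q ^ (k * (k - 1)) / qpoch q q k)) (at_top \<times>\<^sub>F sequentially)"
      by (intro always_eventually) auto
  qed auto
  moreover have "(\<Sum>k. 0 ^ k * q ^ (k * (k - 1)) / qpoch q q k) = 1"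
    by (subst suminf_finite[of "{0}"]) auto
  ultimately show ?thesis by (simp add: rr_sum_def)
qed

lemma qpoch_inf_shift_tendsto: "(\<lambda>n. qpoch_inf (a * q ^ n) q) \<longlonglongrightarrow> 1"
proof -
  have "(\<lambda>x. qpoch_inf x q) holomorphic_on UNIV"
    using q by (intro holomorphic_intros) auto
  hence "isCont (\<lambda>x. qpoch_inf x q) 0"
    using holomorphic_on_imp_continuous_on continuous_on_eq_continuous_at by blast
  thus ?thesis using isCont_tendsto_compose[OF _ power_shift_tendsto_0] by fastforce
qed

text \<open>
  Uniqueness for second-order $q$-difference equations with coefficients tending geometrically
  to those of $d_n = d_{n+1}$.
\<close>

lemma decay_recursion_zero:
  fixes d :: "nat \<Rightarrow> complex"
  assumes d: "d \<longlonglongrightarrow> 0" and rec: "\<And>n. d n = \<alpha> n * d (Suc n) + \<beta> n * d (Suc (Suc n))"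
    and le: "\<And>n. norm (\<alpha> n) + norm (\<beta> n) \<le> 1 + K * norm q ^ n" and K: "K \<ge> 0"
  shows "d 0 = 0"
proof -
  \<comment> \<open>The recursion has order two, so two consecutive values are controlled together.
    One step costs the factor exp (K |q|^n); the product of these stays bounded while
    \<open>e\<close> tends to 0.\<close>
  define e where "e = (\<lambda>n. max (norm (d n)) (norm (d (Suc n))))"
  have e: "e \<longlonglongrightarrow> 0"
    unfolding e_def using tendsto_max[OF tendsto_norm[OF d] tendsto_norm[OF LIMSEQ_Suc[OF d]]] by simp
  have step: "e n \<le> exp (K * norm q ^ n) * e (Suc n)" for n
  proof -
    have e0: "e (Suc n) \<ge> 0" by (simp add: e_def le_max_iff_disj)
    have "norm (d n) \<le> norm (\<alpha> n) * norm (d (Suc n)) + norm (\<beta> n) * norm (d (Suc (Suc n)))"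
      by (subst rec) (metis norm_mult norm_triangle_ineq)
    also have "\<dots> \<le> norm (\<alpha> n) * e (Suc n) + norm (\<beta> n) * e (Suc n)"
      by (intro add_mono mult_left_mono) (auto simp: e_def)
    also have "\<dots> \<le> (1 + K * norm q ^ n) * e (Suc n)"
      using mult_right_mono[OF le e0, of n] by (simp add: algebra_simps)
    finally have 1: "norm (d n) \<le> (1 + K * norm q ^ n) * e (Suc n)" .
    have "norm (d (Suc n)) \<le> 1 * e (Suc n)" by (simp add: e_def)
    also have "\<dots> \<le> (1 + K * norm q ^ n) * e (Suc n)"
      using K e0 by (intro mult_right_mono) auto
    finally have "e n \<le> (1 + K * norm q ^ n) * e (Suc n)" using 1 by (simp add: e_def)
    also have "\<dots> \<le> exp (K * norm q ^ n) * e (Suc n)"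
      using e0 by (intro mult_right_mono exp_ge_add_one_self)
    finally show ?thesis .
  qed
  have "e 0 \<le> exp (K * (\<Sum>k<n. norm q ^ k)) * e n" for n
  proof (induction n)
    case (Suc n)
    have "exp (K * (\<Sum>k<n. norm q ^ k)) * e n \<le> exp (K * (\<Sum>k<n. norm q ^ k)) * (exp (K * norm q ^ n) * e (Suc n))"
      by (intro mult_left_mono step) auto
    also have "\<dots> = exp (K * (\<Sum>k<Suc n. norm q ^ k)) * e (Suc n)"
      by (simp add: exp_add distrib_left)
    finally show ?case using Suc by simp
  qed simp
  moreover have "(\<lambda>n. exp (K * (\<Sum>k<n. norm q ^ k)) * e n) \<longlonglongrightarrow> exp (K * (1 / (1 - norm q))) * 0"
    using q by (intro tendsto_intros e geometric_sums[unfolded sums_def]) auto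
  ultimately have "e 0 \<le> 0"
    using LIMSEQ_le_const[of _ "exp (K * (1 / (1 - norm q))) * 0" "e 0"] by auto
  thus ?thesis by (simp add: e_def)
qed

text \<open>Both sides solve F(a) = (1 - a) F(aq) + a (1 - a)(1 - aq) F(aq^2) and tend to 1 along a
  * q ^ n, so their difference falls under \<open>decay_recursion_zero\<close>.\<close>

theorem rr2_eq_rr_sum: "rr2 q a = qpoch_inf a q * rr_sum q a"
proof -
  define D where "D = (\<lambda>a. rr2 q a - qpoch_inf a q * rr_sum q a)"
  define d where "d = (\<lambda>n. D (a * q ^ n))"
  have D: "D b = (1 - b) * D (b * q) + b * (1 - b) * (1 - b * q) * D (b * q\<^sup>2)" for b
  proof -
    have "rr2 q b = (1 - b) * rr2 q (b * q) + b * (1 - b) * (1 - b * q) * rr2 q (b * q\<^sup>2)"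
      by (subst rr2_eq) (simp add: rr1_eq power2_eq_square mult.assoc)
    moreover have "qpoch_inf b q = (1 - b) * qpoch_inf (b * q) q"
      "qpoch_inf (b * q) q = (1 - b * q) * qpoch_inf (b * q\<^sup>2) q"
      using qpoch_inf_unfold[OF q, of b] qpoch_inf_unfold[OF q, of "b * q"]
      by (simp_all add: power2_eq_square mult.assoc)
    moreover note rr_sum_eq[of b]
    ultimately show ?thesis unfolding D_def
      by (simp only:) (simp add: algebra_simps)
  qed
  define K where "K = norm a + norm a * (1 + norm a) * (1 + norm a)"
  have "d 0 = 0"
  proof (rule decay_recursion_zero)
    show "d \<longlonglongrightarrow> 0"
      unfolding d_def D_def
      using tendsto_diff[OF rr2_tendsto tendsto_mult[OF qpoch_inf_shift_tendsto rr_sum_tendsto], of a a a] by simp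
    show "d n = (1 - a * q ^ n) * d (Suc n) + (a * q ^ n) * (1 - a * q ^ n) * (1 - a * q ^ Suc n) * d (Suc (Suc n))" for n
      unfolding d_def by (subst D) (simp add: mult_ac power2_eq_square)
    have 1: "norm (1 - a * q ^ n) \<le> 1 + norm a * norm q ^ n" for n
      using norm_triangle_ineq4[of 1 "a * q ^ n"] by (simp add: norm_mult norm_power)
    have 2: "norm (1 - a * q ^ n) \<le> 1 + norm a" for n
      using norm_triangle_ineq4[of 1 "a * q ^ n"] norm_shift_le[of a n] by simp
    fix n
    have "norm (a * q ^ n * (1 - a * q ^ n) * (1 - a * q ^ Suc n)) \<le> (norm a * norm q ^ n) * (1 + norm a) * (1 + norm a)"
      unfolding norm_mult using 2[of n] 2[of "Suc n"]
      by (intro mult_mono) (auto simp: norm_power norm_mult)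
    with 1[of n] show "norm (1 - a * q ^ n) + norm (a * q ^ n * (1 - a * q ^ n) * (1 - a * q ^ Suc n)) \<le> 1 + K * norm q ^ n"
      by (simp add: K_def algebra_simps)
  qed (simp add: K_def)
  thus ?thesis by (simp add: d_def D_def)
qed

end

text \<open>At a = q all the coefficients \<open>rr_coeff\<close> are 1, and \<open>rr2\<close>,
  \<open>rr1\<close> become theta series: the triple product in base q^5 at z = q^3 and z = q^4. For
  the second identity \<open>rr1_eq\<close> supplies the factor 1 - q that completes (q^2;
  q)_\<infinity> to (q; q)_\<infinity>.\<close>

theorem rogers_ramanujan_sums:
  fixes q :: complex
  assumes q: "norm q < 1" and q0: "q \<noteq> 0"
  shows "(\<lambda>n. q ^ (n\<^sup>2) / qpoch q q n) sums
           (qpoch_inf (q ^ 2) (q ^ 5) * qpoch_inf (q ^ 3) (q ^ 5) * qpoch_inf (q ^ 5) (q ^ 5) / qpoch_inf q q)"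
    and "(\<lambda>n. q ^ (n\<^sup>2 + n) / qpoch q q n) sums
           (qpoch_inf q (q ^ 5) * qpoch_inf (q ^ 4) (q ^ 5) * qpoch_inf (q ^ 5) (q ^ 5) / qpoch_inf q q)"
proof -
  have q5: "norm (q ^ 5) < 1" using q by (simp add: norm_power power_less_one_iff)
  have nz: "qpoch_inf q q \<noteq> 0" by (rule qpoch_inf_nonzero[OF q q])
  have sq: "n * (n - 1) + n = n\<^sup>2" for n :: nat by (cases n) (simp_all add: power2_eq_square)
  have coeff: "rr_coeff q q r = 1" for r
    using qpoch_nonzero[OF q q] by (simp add: rr_coeff_def)
  have ch: "(j + 2 choose 2) = (j choose 2) + 2 * j + 1" for j by (simp add: choose_two_Suc)
  have "rr_term q 2 1 q = (\<lambda>j. (- 1) ^ j * ((q ^ 3) ^ j * (q ^ 5) ^ (j choose 2) - inverse (q ^ 3) ^ Suc j * (q ^ 5) ^ (j + 2 choose 2)))"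
  proof
    fix j
    have inv: "inverse (q ^ 3) ^ Suc j * (q ^ 3) ^ Suc j = 1"
      using q0 by (simp add: power_mult_distrib[symmetric] del: power_Suc)
    have "(q ^ 5) ^ (j + 2 choose 2) = (q ^ 3) ^ Suc j * (q ^ (5 * (j choose 2)) * q ^ (7 * j + 2))"
      unfolding power_mult[symmetric] power_add[symmetric] ch by (simp add: algebra_simps)
    hence "inverse (q ^ 3) ^ Suc j * (q ^ 5) ^ (j + 2 choose 2) = q ^ (5 * (j choose 2)) * q ^ (7 * j + 2)"
      by (simp only: mult.assoc[symmetric] inv mult_1_left)
    moreover have "q ^ (2 * j) * q ^ (5 * (j choose 2) + 1 * j) = (q ^ 3) ^ j * (q ^ 5) ^ (j choose 2)"
      "q ^ (2 * j) * q ^ (5 * (j choose 2) + 1 * j) * (q\<^sup>2 * q ^ (2 * 2 * j)) = q ^ (5 * (j choose 2)) * q ^ (7 * j + 2)"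
      unfolding power_mult[symmetric] power_add[symmetric] by (simp_all add: algebra_simps)
    ultimately show "rr_term q 2 1 q j = (- 1) ^ j * ((q ^ 3) ^ j * (q ^ 5) ^ (j choose 2) - inverse (q ^ 3) ^ Suc j * (q ^ 5) ^ (j + 2 choose 2))"
      unfolding rr_term_def coeff by (simp only: right_diff_distrib mult_1_right mult.assoc)
  qed
  hence "rr2 q q = qpoch_inf (q ^ 3) (q ^ 5) * qpoch_inf (q ^ 5 / q ^ 3) (q ^ 5) * qpoch_inf (q ^ 5) (q ^ 5)"
    using jacobi_triple_sums[OF q5, of "q ^ 3"] q0 by (simp add: rr2_def sums_iff)
  moreover have "q ^ 5 / q ^ 3 = q ^ 2" using q0 by (simp add: field_simps eval_nat_numeral)
  moreover have "rr_sum q q = (\<Sum>n. q ^ (n\<^sup>2) / qpoch q q n)" "summable (\<lambda>n. q ^ (n\<^sup>2) / qpoch q q n)"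
    using summable_norm_cancel[OF summable_rr_sum[OF q, of q]]
    by (simp_all only: rr_sum_def power_add[symmetric] sq[symmetric] add.commute)
  ultimately show "(\<lambda>n. q ^ (n\<^sup>2) / qpoch q q n) sums
           (qpoch_inf (q ^ 2) (q ^ 5) * qpoch_inf (q ^ 3) (q ^ 5) * qpoch_inf (q ^ 5) (q ^ 5) / qpoch_inf q q)"
    using rr2_eq_rr_sum[OF q, of q] nz by (simp add: sums_iff field_simps)
  have "rr_term q 1 2 q = (\<lambda>j. (- 1) ^ j * ((q ^ 4) ^ j * (q ^ 5) ^ (j choose 2) - inverse (q ^ 4) ^ Suc j * (q ^ 5) ^ (j + 2 choose 2)))"
  proof
    fix j
    have inv: "inverse (q ^ 4) ^ Suc j * (q ^ 4) ^ Suc j = 1"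
      using q0 by (simp add: power_mult_distrib[symmetric] del: power_Suc)
    have "(q ^ 5) ^ (j + 2 choose 2) = (q ^ 4) ^ Suc j * (q ^ (5 * (j choose 2)) * q ^ (6 * j + 1))"
      unfolding power_mult[symmetric] power_add[symmetric] ch by (simp add: algebra_simps)
    hence "inverse (q ^ 4) ^ Suc j * (q ^ 5) ^ (j + 2 choose 2) = q ^ (5 * (j choose 2)) * q ^ (6 * j + 1)"
      by (simp only: mult.assoc[symmetric] inv mult_1_left)
    moreover have "q ^ (2 * j) * q ^ (5 * (j choose 2) + 2 * j) = (q ^ 4) ^ j * (q ^ 5) ^ (j choose 2)"
      "q ^ (2 * j) * q ^ (5 * (j choose 2) + 2 * j) * (q ^ 1 * q ^ (2 * 1 * j)) = q ^ (5 * (j choose 2)) * q ^ (6 * j + 1)"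
      unfolding power_mult[symmetric] power_add[symmetric] by (simp_all add: algebra_simps)
    ultimately show "rr_term q 1 2 q j = (- 1) ^ j * ((q ^ 4) ^ j * (q ^ 5) ^ (j choose 2) - inverse (q ^ 4) ^ Suc j * (q ^ 5) ^ (j + 2 choose 2))"
      unfolding rr_term_def coeff by (simp only: right_diff_distrib mult_1_right mult.assoc)
  qed
  hence "rr1 q q = qpoch_inf (q ^ 4) (q ^ 5) * qpoch_inf (q ^ 5 / q ^ 4) (q ^ 5) * qpoch_inf (q ^ 5) (q ^ 5)"
    using jacobi_triple_sums[OF q5, of "q ^ 4"] q0 by (simp add: rr1_def sums_iff)
  moreover have "q ^ 5 / q ^ 4 = q" using q0 by (simp add: field_simps eval_nat_numeral)
  moreover have "rr1 q q = qpoch_inf q q * rr_sum q (q * q)"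
    using rr1_eq[OF q, of q] rr2_eq_rr_sum[OF q, of "q * q"] qpoch_inf_unfold[OF q, of q] by simp
  moreover have "(q * q) ^ n * q ^ (n * (n - 1)) = q ^ (n\<^sup>2 + n)" for n
    unfolding sq[symmetric] power_add power_mult_distrib by simp
  hence "rr_sum q (q * q) = (\<Sum>n. q ^ (n\<^sup>2 + n) / qpoch q q n)" "summable (\<lambda>n. q ^ (n\<^sup>2 + n) / qpoch q q n)"
    using summable_norm_cancel[OF summable_rr_sum[OF q, of "q * q"]]
    by (simp_all only: rr_sum_def)
  ultimately show "(\<lambda>n. q ^ (n\<^sup>2 + n) / qpoch q q n) sums
           (qpoch_inf q (q ^ 5) * qpoch_inf (q ^ 4) (q ^ 5) * qpoch_inf (q ^ 5) (q ^ 5) / qpoch_inf q q)"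
    using nz by (simp add: sums_iff field_simps)
qed

section \<open>The double sums\<close>

text \<open>The exponent is at least i + j, so a product of two geometric series dominates.\<close>

lemma nahm_summable:
  fixes q :: complex
  assumes q: "norm q < 1"
  shows "(\<lambda>(i, j). q ^ (2 * i^2 + i * j + (j^2 + j) div 2 + l * i) / (qpoch q q i * qpoch q q j))
           summable_on (UNIV :: (nat \<times> nat) set)"
proof -
  obtain B where B: "B > 0" "\<And>n. norm (inverse (qpoch q q n)) \<le> B"
    by (rule inverse_qpoch_bounded[OF q]) blast
  have g: "((\<lambda>j. norm q ^ j) has_sum (1 / (1 - norm q))) UNIV"
    using q by (intro norm_summable_imp_has_sum geometric_sums) (auto simp: summable_geometric)
  have "(\<lambda>(i::nat, j::nat). B * B * (norm q ^ i * norm q ^ j)) summable_on UNIV \<times> UNIV"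
  proof (rule summable_on_SigmaI)
    show "((\<lambda>j. case (i, j) of (i, j) \<Rightarrow> B * B * (norm q ^ i * norm q ^ j)) has_sum
        (B * B * (norm q ^ i * (1 / (1 - norm q))))) UNIV" for i :: nat
      unfolding prod.case by (intro has_sum_cmult_right g)
    show "(\<lambda>i. B * B * (norm q ^ i * (1 / (1 - norm q)))) summable_on UNIV"
      using has_sum_imp_summable[OF g] by (intro summable_on_cmult_right summable_on_cmult_left)
  qed (use B in auto)
  hence "(\<lambda>(i::nat, j::nat). B * B * (norm q ^ i * norm q ^ j)) summable_on UNIV" by simp
  hence "(\<lambda>x. norm (case x of (i, j) \<Rightarrow> q ^ (2 * i^2 + i * j + (j^2 + j) div 2 + l * i) / (qpoch q q i * qpoch q q j))) summable_on UNIV"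
  proof (rule summable_on_comparison_test)
    fix x :: "nat \<times> nat"
    obtain i j where x: "x = (i, j)" by force
    have "i \<le> 2 * i\<^sup>2" by (cases i) (simp_all add: power2_eq_square)
    moreover have "j \<le> (j\<^sup>2 + j) div 2" by (cases j) (simp_all add: power2_eq_square)
    ultimately have "i + j \<le> 2 * i^2 + i * j + (j^2 + j) div 2 + l * i" by simp
    hence "norm q ^ (2 * i^2 + i * j + (j^2 + j) div 2 + l * i) \<le> norm q ^ (i + j)"
      using q by (intro power_decreasing) auto
    hence "norm (inverse (qpoch q q i)) * norm (inverse (qpoch q q j)) * norm q ^ (2 * i^2 + i * j + (j^2 + j) div 2 + l * i)
        \<le> B * B * norm q ^ (i + j)"
      using B by (intro mult_mono) auto
    thus "norm (case x of (i, j) \<Rightarrow> q ^ (2 * i^2 + i * j + (j^2 + j) div 2 + l * i) / (qpoch q q i * qpoch q q j))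
        \<le> (case x of (i, j) \<Rightarrow> B * B * (norm q ^ i * norm q ^ j))"
      by (simp add: x norm_divide norm_mult norm_power norm_inverse power_add divide_inverse mult_ac)
  qed auto
  thus ?thesis by (rule abs_summable_summable)
qed

text \<open>For fixed i the sum over j is (-q^(i+1); q)_\<infinity> = (-q; q)_\<infinity> / (-q;
  q)_i, and (q; q)_i (-q; q)_i = (q^2; q^2)_i turns the outer sum into one in base q^2.\<close>

lemma nahm_has_sum:
  fixes q :: complex
  assumes q: "norm q < 1"
    and S: "(\<lambda>i. q ^ (2 * i^2 + l * i) / qpoch (q\<^sup>2) (q\<^sup>2) i) sums S"
  shows "((\<lambda>(i, j). q ^ (2 * i^2 + i * j + (j^2 + j) div 2 + l * i) / (qpoch q q i * qpoch q q j))
           has_sum (qpoch_inf (- q) q * S)) (UNIV :: (nat \<times> nat) set)"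
proof -
  define f where "f = (\<lambda>(i, j). q ^ (2 * i^2 + i * j + (j^2 + j) div 2 + l * i) / (qpoch q q i * qpoch q q j))"
  have q2: "norm (q\<^sup>2) < 1" using q by (simp add: norm_power power_less_one_iff)
  have "(f has_sum (qpoch_inf (- q) q * S)) (UNIV \<times> UNIV)"
  proof (rule has_sum_SigmaI)
    fix i :: nat
    have "((\<lambda>k. (- 1) ^ k * q ^ (k choose 2) * (- (q * q ^ i)) ^ k / qpoch q q k)
        has_sum qpoch_inf (- (q * q ^ i)) q) UNIV"
      using euler_sums[OF q] by (intro norm_summable_imp_has_sum)
    from has_sum_cmult_right[OF this, of "q ^ (2 * i^2 + l * i) / qpoch q q i"]
    have "((\<lambda>j. f (i, j)) has_sum (q ^ (2 * i^2 + l * i) / qpoch q q i * qpoch_inf (- (q * q ^ i)) q)) UNIV"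
    proof (rule has_sum_cong[THEN iffD1, rotated])
      fix j
      have e: "(j\<^sup>2 + j) div 2 = (j choose 2) + j"
        using choose_two[of "Suc j"] by (simp add: choose_two_Suc power2_eq_square)
      have "(- 1) ^ j * (- (q * q ^ i)) ^ j = (q * q ^ i) ^ j"
        by (simp add: power_mult_distrib[symmetric])
      also have "\<dots> = q ^ (j + i * j)" by (simp add: power_mult_distrib power_add power_mult)
      finally have p: "(- 1) ^ j * (- (q * q ^ i)) ^ j = q ^ (j + i * j)" .
      have "q ^ (2 * i^2 + l * i) / qpoch q q i * ((- 1) ^ j * q ^ (j choose 2) * (- (q * q ^ i)) ^ j / qpoch q q j)
          = q ^ (2 * i^2 + l * i) * q ^ (j choose 2) * ((- 1) ^ j * (- (q * q ^ i)) ^ j) / (qpoch q q i * qpoch q q j)"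
        by simp
      also have "\<dots> = f (i, j)"
        unfolding p f_def prod.case e power_add[symmetric] by (simp add: algebra_simps)
      finally show "q ^ (2 * i^2 + l * i) / qpoch q q i * ((- 1) ^ j * q ^ (j choose 2) * (- (q * q ^ i)) ^ j / qpoch q q j) = f (i, j)" .
    qed
    thus "((\<lambda>j. f (i, j)) has_sum (q ^ (2 * i^2 + l * i) / qpoch q q i * qpoch_inf (- (q * q ^ i)) q)) UNIV" .
  next
    have eq: "q ^ (2 * i^2 + l * i) / qpoch q q i * qpoch_inf (- (q * q ^ i)) q
        = qpoch_inf (- q) q * (q ^ (2 * i^2 + l * i) / qpoch (q\<^sup>2) (q\<^sup>2) i)" for i
    proof -
      have "qpoch q q i * qpoch (- q) q i = qpoch (q\<^sup>2) (q\<^sup>2) i"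
        unfolding qpoch_def prod.distrib[symmetric]
        by (intro prod.cong refl) (simp add: algebra_simps power2_eq_square power_mult_distrib)
      hence "qpoch (q\<^sup>2) (q\<^sup>2) i = qpoch q q i * qpoch (- q) q i" ..
      moreover have "qpoch_inf (- q) q = qpoch (- q) q i * qpoch_inf (- (q * q ^ i)) q"
        using qpoch_inf_split[OF q, of "- q" i] by simp
      moreover have "qpoch q q i \<noteq> 0" "qpoch (- q) q i \<noteq> 0"
        using q by (simp_all add: qpoch_nonzero)
      ultimately show ?thesis by (simp add: field_simps)
    qed
    have "summable (\<lambda>i. norm (q ^ (2 * i^2 + l * i) / qpoch (q\<^sup>2) (q\<^sup>2) i))"
    proof -
      obtain B where B: "B > 0" "\<And>n. norm (inverse (qpoch (q\<^sup>2) (q\<^sup>2) n)) \<le> B"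
        by (rule inverse_qpoch_bounded[OF q2]) blast
      show ?thesis
      proof (rule summable_comparison_test'[of _ 0])
        show "summable (\<lambda>i. B * norm q ^ i)" using q by (intro summable_mult summable_geometric) auto
        fix i :: nat
        have "i \<le> 2 * i^2 + l * i" by (cases i) (simp_all add: power2_eq_square)
        hence "norm (inverse (qpoch (q\<^sup>2) (q\<^sup>2) i)) * norm q ^ (2 * i^2 + l * i) \<le> B * norm q ^ i"
          using q B by (intro mult_mono power_decreasing) auto
        thus "norm (norm (q ^ (2 * i^2 + l * i) / qpoch (q\<^sup>2) (q\<^sup>2) i)) \<le> B * norm q ^ i"
          by (simp add: norm_mult norm_power norm_inverse divide_inverse mult_ac)
      qed
    qed
    from has_sum_cmult_right[OF norm_summable_imp_has_sum[OF this S], of "qpoch_inf (- q) q"]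
    show "((\<lambda>i. q ^ (2 * i^2 + l * i) / qpoch q q i * qpoch_inf (- (q * q ^ i)) q)
        has_sum (qpoch_inf (- q) q * S)) UNIV"
      unfolding eq .
    show "f summable_on UNIV \<times> UNIV"
      using nahm_summable[OF q, of l] by (simp add: f_def)
  qed
  thus ?thesis by (simp add: f_def)
qed

lemma nahm_rogers_ramanujan:
  fixes q :: complex
  assumes q: "norm q < 1"
  shows "((\<lambda>(i, j). q ^ (2 * i^2 + i * j + (j^2 + j) div 2) / (qpoch q q i * qpoch q q j))
           has_sum (qpochs_inf [q^4, q^6, q^10] (q^10) / qpoch_inf q q)) (UNIV :: (nat \<times> nat) set)"
    and "((\<lambda>(i, j). q ^ (2 * i^2 + i * j + (j^2 + j) div 2 + 2 * i) / (qpoch q q i * qpoch q q j))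
           has_sum (qpochs_inf [q^2, q^8, q^10] (q^10) / qpoch_inf q q)) (UNIV :: (nat \<times> nat) set)"
proof -
  have q2: "norm (q\<^sup>2) < 1" using q by (simp add: norm_power power_less_one_iff)
  have nz: "qpoch_inf q q \<noteq> 0" "qpoch_inf (- q) q \<noteq> 0"
    using q by (simp_all add: qpoch_inf_nonzero)
  have prod: "qpoch_inf (q\<^sup>2) (q\<^sup>2) = qpoch_inf q q * qpoch_inf (- q) q"
    using qpoch_inf_mult_uminus[OF q] by simp
  have A: "(\<lambda>i. q ^ (2 * i^2 + 0 * i) / qpoch (q\<^sup>2) (q\<^sup>2) i) sums
      (qpochs_inf [q^4, q^6, q^10] (q^10) / qpoch_inf (q\<^sup>2) (q\<^sup>2))"
    and B: "(\<lambda>i. q ^ (2 * i^2 + 2 * i) / qpoch (q\<^sup>2) (q\<^sup>2) i) sums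
      (qpochs_inf [q^2, q^8, q^10] (q^10) / qpoch_inf (q\<^sup>2) (q\<^sup>2))"
  \<comment> \<open>The triple product divides by z, so q = 0 is treated apart; there each series
    reduces to its term i = 0.\<close>
  proof (atomize (full), cases "q = 0")
    case True
    have sums1: "(\<lambda>i::nat. 0 ^ (2 * i^2 + l * i) / qpoch 0 0 i) sums (1::complex)" for l
    proof -
      have "(\<lambda>i::nat. 0 ^ (2 * i^2 + l * i) / qpoch 0 0 i) = (\<lambda>i. if i \<in> {0} then 1 else 0 :: complex)"
        by (auto simp: fun_eq_iff)
      thus ?thesis using sums_If_finite_set[of "{0::nat}" "\<lambda>_. 1::complex"] by simp
    qed
    from sums1[of 0] sums1[of 2] show "(\<lambda>i. q ^ (2 * i^2 + 0 * i) / qpoch (q\<^sup>2) (q\<^sup>2) i) sums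
        (qpochs_inf [q^4, q^6, q^10] (q^10) / qpoch_inf (q\<^sup>2) (q\<^sup>2)) \<and>
      (\<lambda>i. q ^ (2 * i^2 + 2 * i) / qpoch (q\<^sup>2) (q\<^sup>2) i) sums
        (qpochs_inf [q^2, q^8, q^10] (q^10) / qpoch_inf (q\<^sup>2) (q\<^sup>2))"
      by (simp add: True qpochs_inf_def)
  next
    case False
    hence "q\<^sup>2 \<noteq> 0" by simp
    from rogers_ramanujan_sums[OF q2 this]
    show "(\<lambda>i. q ^ (2 * i^2 + 0 * i) / qpoch (q\<^sup>2) (q\<^sup>2) i) sums
        (qpochs_inf [q^4, q^6, q^10] (q^10) / qpoch_inf (q\<^sup>2) (q\<^sup>2)) \<and>
      (\<lambda>i. q ^ (2 * i^2 + 2 * i) / qpoch (q\<^sup>2) (q\<^sup>2) i) sums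
        (qpochs_inf [q^2, q^8, q^10] (q^10) / qpoch_inf (q\<^sup>2) (q\<^sup>2))"
      by (simp add: qpochs_inf_def power_mult[symmetric] mult.assoc distrib_left)
  qed
  have cancel: "qpoch_inf (- q) q * (x / qpoch_inf (q\<^sup>2) (q\<^sup>2)) = x / qpoch_inf q q" for x
    using nz by (simp add: prod)
  show "((\<lambda>(i, j). q ^ (2 * i^2 + i * j + (j^2 + j) div 2) / (qpoch q q i * qpoch q q j))
           has_sum (qpochs_inf [q^4, q^6, q^10] (q^10) / qpoch_inf q q)) (UNIV :: (nat \<times> nat) set)"
    using nahm_has_sum[OF q A] unfolding cancel by simp
  show "((\<lambda>(i, j). q ^ (2 * i^2 + i * j + (j^2 + j) div 2 + 2 * i) / (qpoch q q i * qpoch q q j))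
           has_sum (qpochs_inf [q^2, q^8, q^10] (q^10) / qpoch_inf q q)) (UNIV :: (nat \<times> nat) set)"
    using nahm_has_sum[OF q B] unfolding cancel .
qed

section \<open>The Weierstrass sigma product and its inversion formula\<close>

text \<open>Every fractional power of q is written as \<open>qexp\<close> of a multiple of \<tau>,
  so no branch of a root is ever chosen.\<close>

definition qexp :: "complex \<Rightarrow> complex" where
  "qexp z = exp (2 * of_real pi * \<i> * z)"

lemma qexp_add: "qexp (x + y) = qexp x * qexp y"
  by (simp add: qexp_def ring_distribs exp_add)

lemma qexp_minus: "qexp (- x) = inverse (qexp x)"
  by (simp add: qexp_def exp_minus)

lemma qexp_diff: "qexp (x - y) = qexp x / qexp y"
  by (simp add: qexp_def ring_distribs exp_diff)

lemma qexp_nonzero [simp]: "qexp x \<noteq> 0"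
  by (simp add: qexp_def)

lemma qexp_0 [simp]: "qexp 0 = 1"
  by (simp add: qexp_def)

lemma qexp_power: "qexp x ^ n = qexp (of_nat n * x)"
  by (simp add: qexp_def exp_of_nat_mult[symmetric] mult_ac)

lemma qexp_eq_1_iff: "qexp x = 1 \<longleftrightarrow> (\<exists>n. x = of_int n)"
proof -
  have "qexp x = 1 \<longleftrightarrow> Im x = 0 \<and> (\<exists>n::int. Re x = of_int n)"
    unfolding qexp_def exp_eq_1 by (auto simp: mult.commute)
  thus ?thesis by (auto simp: complex_eq_iff)
qed

lemma qexp_of_int [simp]: "qexp (of_int n) = 1"
  by (auto simp: qexp_eq_1_iff)

lemma qexp_1 [simp]: "qexp 1 = 1"
  using qexp_of_int[of 1] by simp

lemma qexp_half [simp]: "qexp (1/2) = -1"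
  by (simp add: qexp_def exp_pi_i')

lemma norm_qexp: "norm (qexp z) = exp (- 2 * pi * Im z)"
  by (simp add: qexp_def)

lemma norm_qexp_less_1: "Im z > 0 \<Longrightarrow> norm (qexp z) < 1"
  by (simp add: norm_qexp)

lemma holomorphic_on_qexp [holomorphic_intros]:
  "f holomorphic_on A \<Longrightarrow> (\<lambda>z. qexp (f z)) holomorphic_on A"
  unfolding qexp_def by (intro holomorphic_intros)

section \<open>Periodic and quasi-periodic functions of a lattice\<close>

lemma periodic_int:
  fixes f :: "complex \<Rightarrow> 'a"
  assumes "\<And>z. f (z + p) = f z"
  shows "f (z + of_int m * p) = f z"
proof (induction m rule: int_induct[of _ 0])
  case (step1 i)
  thus ?case using assms[of "z + of_int i * p"] by (simp add: algebra_simps)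
next
  case (step2 i)
  thus ?case using assms[of "z + of_int (i - 1) * p"] by (simp add: algebra_simps)
qed simp

text \<open>The codomain is left free: the lemma is applied to functions and also to truth values
  such as \<open>A z = 0\<close>.\<close>

lemma doubly_periodic_int:
  fixes f :: "complex \<Rightarrow> 'a"
  assumes "\<And>z. f (z + 1) = f z" "\<And>z. f (z + \<omega>) = f z"
  shows "f (z + of_int m * \<omega> + of_int n) = f z"
  using periodic_int[of f \<omega> z m] periodic_int[of f 1 "z + of_int m * \<omega>" n] assms by simp

lemma fundamental_domain:
  assumes "Im \<tau> > 0"
  obtains s t :: real and m n :: int
    where "s \<in> {0..1}" "t \<in> {0..1}" "z = (of_real s * \<tau> + of_real t) + of_int m * \<tau> + of_int n"
proof -
  define y where "y = Im z / Im \<tau>"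
  define x where "x = Re z - y * Re \<tau>"
  have "z = of_real y * \<tau> + of_real x"
    using assms by (simp add: complex_eq_iff x_def y_def)
  also have "\<dots> = (of_real (frac y) * \<tau> + of_real (frac x)) + of_int \<lfloor>y\<rfloor> * \<tau> + of_int \<lfloor>x\<rfloor>"
    by (simp add: frac_def algebra_simps)
  finally show ?thesis
    using frac_lt_1[of x] frac_lt_1[of y] by (intro that[of "frac y" "frac x"]) auto
qed

text \<open>A / B is doubly periodic. Its singularity at 0 is removable because b \<noteq> 0 makes
  that zero of B simple, and periodicity carries this to all lattice points, where the zeros of B
  lie. So A / B is entire and bounded, and its constant value is the limit a / b at 0.\<close>

lemma quasi_periodic_unique:
  assumes \<tau>: "Im \<tau> > 0" and hol: "A holomorphic_on UNIV" "B holomorphic_on UNIV"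
    and zero: "A 0 = 0" "B 0 = 0"
    and deriv: "(A has_field_derivative a) (at 0)" "(B has_field_derivative b) (at 0)" "b \<noteq> 0"
    and A: "\<And>z. A (z + 1) = f z * A z" "\<And>z. A (z + \<tau>) = g z * A z"
    and B: "\<And>z. B (z + 1) = f z * B z" "\<And>z. B (z + \<tau>) = g z * B z"
    and nz: "\<And>z. f z \<noteq> 0" "\<And>z. g z \<noteq> 0"
    and lat: "\<And>z. B z = 0 \<Longrightarrow> \<exists>m n. z = of_int m * \<tau> + of_int n"
  shows "A z = a / b * B z"
proof -
  \<comment> \<open>The value at the zeros of B is the limit of A / B at 0, as l'Hopital's rule
    shows below.\<close>
  define h where "h = (\<lambda>z. if B z = 0 then a / b else A z / B z)"
  have h1: "h (z + 1) = h z" "h (z + \<tau>) = h z" for z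
    using nz[of z] by (auto simp: h_def A B)
  have iso: "eventually (\<lambda>z. B z \<noteq> 0) (at 0)"
  proof -
    have "((\<lambda>z. B z / z) \<longlongrightarrow> b) (at 0)"
      using deriv(2) zero(2) by (simp add: has_field_derivative_iff)
    hence "eventually (\<lambda>z. B z / z \<noteq> 0) (at 0)" using deriv(3) by (rule tendsto_imp_eventually_ne)
    thus ?thesis by (rule eventually_mono) auto
  qed
  have open_nz: "open {z. B z \<noteq> 0}"
    by (intro open_Collect_neq continuous_on_const holomorphic_on_imp_continuous_on hol)
  have hol_nz: "h holomorphic_on {z. B z \<noteq> 0}"
  proof -
    have "(\<lambda>z. A z / B z) holomorphic_on {z. B z \<noteq> 0}"
      using hol by (intro holomorphic_intros) (auto intro: holomorphic_on_subset)
    thus ?thesis by (rule holomorphic_transform) (simp add: h_def)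
  qed
  have h0: "h field_differentiable at 0"
  proof -
    obtain S where S: "open S" "0 \<in> S" "\<And>z. z \<in> S \<Longrightarrow> z \<noteq> 0 \<Longrightarrow> B z \<noteq> 0"
      using iso unfolding eventually_at_topological by blast
    have hS: "h holomorphic_on S - {0}"
      using S by (intro holomorphic_on_subset[OF hol_nz]) auto
    have "((\<lambda>z. A z / B z) \<longlongrightarrow> a / b) (at 0)"
      by (rule lhopital_complex_simple[OF deriv(1,2) zero deriv(3) refl])
    hence "(h \<longlongrightarrow> a / b) (at 0)"
      by (rule Lim_transform_eventually) (rule eventually_mono[OF iso], simp add: h_def)
    hence "isCont h 0" by (simp add: isCont_def h_def zero)
    moreover have "isCont h z" if "z \<in> S - {0}" for z
      using hS that S by (metis continuous_on_eq_continuous_at finite.emptyI finite_insert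
          holomorphic_on_imp_continuous_on open_delete)
    ultimately have "continuous_on S h"
      by (metis DiffI continuous_at_imp_continuous_on singletonD)
    hence "h holomorphic_on S"
      using no_isolated_singularity[OF _ hS S(1)] by simp
    thus ?thesis using S holomorphic_on_imp_differentiable_at by blast
  qed
  have "h field_differentiable at z" for z
  proof (cases "B z = 0")
    case False
    thus ?thesis using hol_nz open_nz holomorphic_on_imp_differentiable_at by blast
  next
    case True
    then obtain m n where z: "z = of_int m * \<tau> + of_int n" using lat by blast
    \<comment> \<open>Translation by a lattice point moves differentiability from 0 to z.\<close>
    have "h = (\<lambda>w. h (w - z))"
    proof
      fix w show "h w = h (w - z)"
        using doubly_periodic_int[of h \<tau> "w - z" m n] h1 by (simp add: z algebra_simps)
    qed
    moreover have "(\<lambda>w. h (w - z)) field_differentiable at z"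
    proof -
      have "(\<lambda>w. w - z) field_differentiable at z"
        by (intro field_differentiable_diff field_differentiable_ident field_differentiable_const)
      thus ?thesis using field_differentiable_compose[of "\<lambda>w. w - z" z h] h0 by (simp add: o_def)
    qed
    ultimately show ?thesis by simp
  qed
  hence hol_h: "h holomorphic_on UNIV"
    by (simp add: holomorphic_on_def)
  define C where "C = (\<lambda>(s, t). of_real s * \<tau> + of_real t) ` ({0..1::real} \<times> {0..1::real})"
  have "compact C"
    unfolding C_def by (intro compact_continuous_image compact_Times) (auto intro!: continuous_intros simp: case_prod_unfold)
  hence "compact (h ` C)"
    by (intro compact_continuous_image continuous_on_subset[OF holomorphic_on_imp_continuous_on[OF hol_h]]) auto
  moreover have "range h \<subseteq> h ` C"
  proof safe
    fix z
    obtain s t m n where st: "s \<in> {0..1}" "t \<in> {0..1}"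
      "z = (of_real s * \<tau> + of_real t) + of_int m * \<tau> + of_int n"
      using fundamental_domain[OF \<tau>] by blast
    have "h z = h (of_real s * \<tau> + of_real t)"
      unfolding st(3) using h1 by (rule doubly_periodic_int)
    moreover have "of_real s * \<tau> + of_real t \<in> C"
      unfolding C_def by (rule image_eqI[of _ _ "(s, t)"]) (use st(1,2) in auto)
    ultimately show "h z \<in> h ` C" by simp
  qed
  ultimately have "bounded (range h)"
    using bounded_subset compact_imp_bounded by blast
  then obtain c where "\<And>z. h z = c"
    using Liouville_theorem[OF hol_h] by (auto simp: constant_on_def)
  hence h: "h z = a / b" for z
    by (metis (full_types) h_def zero(2))
  show ?thesis
  proof (cases "B z = 0")
    case True
    then obtain m n where z: "z = 0 + of_int m * \<tau> + of_int n" using lat by fastforce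
    have "(A z = 0) = (A 0 = 0)"
      unfolding z using A nz by (intro doubly_periodic_int) auto
    thus ?thesis using True zero by simp
  next
    case False
    thus ?thesis using h[of z] by (simp add: h_def field_simps)
  qed
qed

text \<open>
  Up to a Gaussian factor and $2 \<pi> i$ this is the Weierstrass $\<sigma>$-function of the lattice
  $\<int> \<tau> + \<int>$.
\<close>

definition kfun :: "complex \<Rightarrow> complex \<Rightarrow> complex" where
  "kfun z \<tau> = (qexp (z / 2) - qexp (- z / 2)) * qpoch_inf (qexp (\<tau> + z)) (qexp \<tau>)
     * qpoch_inf (qexp (\<tau> - z)) (qexp \<tau>) / (qpoch_inf (qexp \<tau>) (qexp \<tau>))\<^sup>2"

lemma kfun_minus: "kfun (- z) \<tau> = - kfun z \<tau>"
  by (simp add: kfun_def divide_simps algebra_simps)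

lemma kfun_add_1: "kfun (z + 1) \<tau> = - kfun z \<tau>"
proof -
  have "qexp ((z + 1) / 2) = - qexp (z / 2)" "qexp (- (z + 1) / 2) = - qexp (- z / 2)"
    using qexp_add[of "z / 2" "1/2"] qexp_diff[of "- z / 2" "1/2"]
    by (simp_all add: add_divide_distrib diff_divide_distrib)
  moreover have "qexp (\<tau> + (z + 1)) = qexp (\<tau> + z)" "qexp (\<tau> - (z + 1)) = qexp (\<tau> - z)"
    using qexp_add[of "\<tau> + z" 1] qexp_diff[of "\<tau> - z" 1] by (simp_all add: algebra_simps)
  ultimately show ?thesis by (simp add: kfun_def divide_simps algebra_simps)
qed

lemma kfun_0 [simp]: "kfun 0 \<tau> = 0"
  by (simp add: kfun_def)

lemma kfun_shift_T: "kfun z (\<tau> + 1) = kfun z \<tau>"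
proof -
  have "qexp (\<tau> + 1) = qexp \<tau>" "qexp (\<tau> + 1 + z) = qexp (\<tau> + z)" "qexp (\<tau> + 1 - z) = qexp (\<tau> - z)"
    by (simp_all add: qexp_add qexp_diff)
  thus ?thesis by (simp add: kfun_def)
qed

context
  fixes \<tau> :: complex
  assumes \<tau>: "Im \<tau> > 0"
begin

text \<open>The shift removes the factor 1 - qexp (\<tau> + z) from one product and adds 1 - qexp (-
  z) to the other; together with the prefactor this leaves a monomial. X and Y in the proof are the
  square roots of qexp z and qexp \<tau> that occur in the prefactor.\<close>

lemma kfun_add_tau: "kfun (z + \<tau>) \<tau> = - qexp (- z - \<tau> / 2) * kfun z \<tau>"
proof -
  define X where "X = qexp (z / 2)"
  define Y where "Y = qexp (\<tau> / 2)"
  have nz: "X \<noteq> 0" "Y \<noteq> 0" by (simp_all add: X_def Y_def)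
  have e: "qexp ((z + \<tau>) / 2) = X * Y" "qexp (- (z + \<tau>) / 2) = 1 / (X * Y)"
    "qexp (- z / 2) = 1 / X" "qexp (- z - \<tau> / 2) = 1 / (X\<^sup>2 * Y)" "qexp (\<tau> + z) = X\<^sup>2 * Y\<^sup>2"
    "qexp (- z) = 1 / X\<^sup>2"
    unfolding X_def Y_def qexp_power qexp_add[symmetric]
    by (simp_all add: qexp_minus[symmetric] divide_inverse[symmetric] inverse_eq_divide[symmetric]
         add_divide_distrib diff_divide_distrib algebra_simps)
  define P where "P = qpoch_inf (qexp (\<tau> + z) * qexp \<tau>) (qexp \<tau>)"
  define Q where "Q = qpoch_inf (qexp (- z) * qexp \<tau>) (qexp \<tau>)"
  have P: "qpoch_inf (qexp (\<tau> + z)) (qexp \<tau>) = (1 - X\<^sup>2 * Y\<^sup>2) * P"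
    unfolding P_def e(5)[symmetric] by (rule qpoch_inf_unfold) (rule norm_qexp_less_1[OF \<tau>])
  have Q: "qpoch_inf (qexp (- z)) (qexp \<tau>) = (1 - 1 / X\<^sup>2) * Q"
    unfolding Q_def e(6)[symmetric] by (rule qpoch_inf_unfold) (rule norm_qexp_less_1[OF \<tau>])
  have 1: "qexp (\<tau> + (z + \<tau>)) = qexp (\<tau> + z) * qexp \<tau>" "qexp (\<tau> - (z + \<tau>)) = qexp (- z)"
    "qexp (\<tau> - z) = qexp (- z) * qexp \<tau>"
    by (simp_all add: qexp_add[symmetric] algebra_simps)
  define D where "D = (qpoch_inf (qexp \<tau>) (qexp \<tau>))\<^sup>2"
  have "kfun (z + \<tau>) \<tau> = (X * Y - 1 / (X * Y)) * P * ((1 - 1 / X\<^sup>2) * Q) / D"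
    unfolding kfun_def 1(1,2) P_def[symmetric] Q e(1,2) D_def ..
  moreover have "kfun z \<tau> = (X - 1 / X) * ((1 - X\<^sup>2 * Y\<^sup>2) * P) * Q / D"
    unfolding kfun_def P 1(3) Q_def[symmetric] D_def e(3) X_def[symmetric] ..
  moreover have "(X * Y - 1 / (X * Y)) * P * ((1 - 1 / X\<^sup>2) * Q)
      = - (1 / (X\<^sup>2 * Y)) * ((X - 1 / X) * ((1 - X\<^sup>2 * Y\<^sup>2) * P) * Q)"
    using nz by (simp add: field_simps power2_eq_square)
  ultimately show ?thesis unfolding e by simp
qed

lemma qpoch_inf_qexp_nonzero [simp]: "qpoch_inf (qexp \<tau>) (qexp \<tau>) \<noteq> 0"
  using norm_qexp_less_1[OF \<tau>] by (intro qpoch_inf_nonzero)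

lemma kfun_eq_0_imp:
  assumes "kfun z \<tau> = 0"
  shows "\<exists>m n. z = of_int m * \<tau> + of_int n"
proof -
  note q = norm_qexp_less_1[OF \<tau>]
  consider "qexp (z / 2) = qexp (- z / 2)" | "qpoch_inf (qexp (\<tau> + z)) (qexp \<tau>) = 0"
    | "qpoch_inf (qexp (\<tau> - z)) (qexp \<tau>) = 0"
    using assms by (auto simp: kfun_def)
  thus ?thesis
  proof cases
    case 1
    hence "qexp z = 1" using qexp_diff[of "z / 2" "- z / 2"] by simp
    then obtain n where "z = of_int n" by (auto simp: qexp_eq_1_iff)
    thus ?thesis by (intro exI[of _ 0] exI[of _ n]) simp
  next
    case 2
    then obtain k where "qexp (\<tau> + z) * qexp \<tau> ^ k = 1" by (auto simp: qpoch_inf_eq_0_iff[OF q])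
    hence "qexp (\<tau> + z + of_nat k * \<tau>) = 1" by (simp add: qexp_power qexp_add)
    then obtain n where "\<tau> + z + of_nat k * \<tau> = of_int n" by (auto simp: qexp_eq_1_iff)
    thus ?thesis by (intro exI[of _ "- int k - 1"] exI[of _ n]) (simp add: algebra_simps)
  next
    case 3
    then obtain k where "qexp (\<tau> - z) * qexp \<tau> ^ k = 1" by (auto simp: qpoch_inf_eq_0_iff[OF q])
    hence "qexp (\<tau> - z + of_nat k * \<tau>) = 1" by (simp add: qexp_power qexp_add[symmetric])
    then obtain n where "\<tau> - z + of_nat k * \<tau> = of_int n" by (auto simp: qexp_eq_1_iff)
    thus ?thesis by (intro exI[of _ "int k + 1"] exI[of _ "- n"]) (simp add: algebra_simps)
  qed
qed

lemma holomorphic_kfun: "(\<lambda>z. kfun z \<tau>) holomorphic_on UNIV"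
  unfolding kfun_def using norm_qexp_less_1[OF \<tau>]
  by (intro holomorphic_intros) auto

lemma kfun_deriv_0: "((\<lambda>z. kfun z \<tau>) has_field_derivative (2 * of_real pi * \<i>)) (at 0)"
proof -
  define G where "G = (\<lambda>z. qpoch_inf (qexp (\<tau> + z)) (qexp \<tau>) * qpoch_inf (qexp (\<tau> - z)) (qexp \<tau>)
     / (qpoch_inf (qexp \<tau>) (qexp \<tau>))\<^sup>2)"
  have "G holomorphic_on UNIV"
    unfolding G_def using norm_qexp_less_1[OF \<tau>] by (intro holomorphic_intros) auto
  then obtain d where d: "(G has_field_derivative d) (at 0)"
    unfolding holomorphic_on_def field_differentiable_def by auto
  have "((\<lambda>z. qexp (z / 2) - qexp (- z / 2)) has_field_derivative 2 * of_real pi * \<i>) (at 0)"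
    unfolding qexp_def by (auto intro!: derivative_eq_intros)
  from DERIV_mult[OF this d]
  have "((\<lambda>z. (qexp (z / 2) - qexp (- z / 2)) * G z) has_field_derivative 2 * of_real pi * \<i>) (at 0)"
    by (simp add: G_def power2_eq_square)
  thus ?thesis by (simp add: kfun_def G_def mult.assoc)
qed

end

theorem kfun_S:
  assumes \<tau>: "Im \<tau> > 0"
  shows "kfun (z / \<tau>) (- 1 / \<tau>) = qexp (z\<^sup>2 / (2 * \<tau>)) / \<tau> * kfun z \<tau>"
proof -
  have nz: "\<tau> \<noteq> 0" using \<tau> by auto
  have \<tau>': "Im (- 1 / \<tau>) > 0"
    using \<tau> nz by (simp add: Im_divide power2_eq_square field_simps sum_squares_gt_zero_iff complex_eq_iff)
  \<comment> \<open>The Gaussian is the correction that gives \<open>A\<close> exactly the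
    multipliers of \<open>kfun\<close> under z + 1 and z + \<tau>.\<close>
  define A where "A = (\<lambda>z. kfun (z / \<tau>) (- 1 / \<tau>) * qexp (- z\<^sup>2 / (2 * \<tau>)))"
  have holA: "A holomorphic_on UNIV"
  proof -
    have "((\<lambda>z. kfun z (- 1 / \<tau>)) \<circ> (\<lambda>z. z / \<tau>)) holomorphic_on UNIV"
      by (rule holomorphic_on_compose_gen[OF _ holomorphic_kfun[OF \<tau>']])
         (use nz in \<open>auto intro!: holomorphic_intros\<close>)
    thus ?thesis unfolding A_def o_def by (intro holomorphic_intros) (use nz in auto)
  qed
  have dA: "(A has_field_derivative 2 * of_real pi * \<i> / \<tau>) (at 0)"
  proof -
    have "((\<lambda>z. kfun (z / \<tau>) (- 1 / \<tau>)) has_field_derivative 2 * of_real pi * \<i> * (1 / \<tau>)) (at 0)"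
      by (rule DERIV_chain2[where g = "\<lambda>z. z / \<tau>" and f = "\<lambda>z. kfun z (- 1 / \<tau>)"])
         (use kfun_deriv_0[OF \<tau>'] nz in \<open>auto intro!: derivative_eq_intros\<close>)
    moreover have "(\<lambda>z. qexp (- z\<^sup>2 / (2 * \<tau>))) holomorphic_on UNIV"
      by (intro holomorphic_intros) (use nz in auto)
    then obtain d where "((\<lambda>z. qexp (- z\<^sup>2 / (2 * \<tau>))) has_field_derivative d) (at 0)"
      unfolding holomorphic_on_def field_differentiable_def by auto
    ultimately have "((\<lambda>z. kfun (z / \<tau>) (- 1 / \<tau>) * qexp (- z\<^sup>2 / (2 * \<tau>)))
        has_field_derivative 2 * of_real pi * \<i> * (1 / \<tau>) * qexp (- 0\<^sup>2 / (2 * \<tau>)) + d * kfun (0 / \<tau>) (- 1 / \<tau>)) (at 0)"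
      by (rule DERIV_mult)
    thus ?thesis by (simp add: A_def)
  qed
  have "A z = 2 * of_real pi * \<i> / \<tau> / (2 * of_real pi * \<i>) * kfun z \<tau>"
  proof (rule quasi_periodic_unique[OF \<tau> holA holomorphic_kfun[OF \<tau>] _ _ dA kfun_deriv_0[OF \<tau>]])
    fix z
    show "A (z + 1) = - 1 * A z"
    proof -
      \<comment> \<open>Adding 1 to z moves z / \<tau> by minus the period - 1 / \<tau>, so
        \<open>kfun_add_tau\<close> is used backwards, from the point (z + 1) / \<tau>.\<close>
      have K1: "kfun (z / \<tau>) (- 1 / \<tau>) = - qexp (- ((z + 1) / \<tau>) - (- 1 / \<tau>) / 2) * kfun ((z + 1) / \<tau>) (- 1 / \<tau>)"
        using kfun_add_tau[OF \<tau>', of "(z + 1) / \<tau>"] by (simp add: add_divide_distrib)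
      moreover have "- z\<^sup>2 / (2 * \<tau>) + (- ((z + 1) / \<tau>) - (- 1 / \<tau>) / 2) = - (z + 1)\<^sup>2 / (2 * \<tau>)"
        using nz by (simp add: field_simps power2_eq_square)
      ultimately have "A (z + 1) = kfun ((z + 1) / \<tau>) (- 1 / \<tau>)
          * (qexp (- z\<^sup>2 / (2 * \<tau>)) * qexp (- ((z + 1) / \<tau>) - (- 1 / \<tau>) / 2))"
        by (simp only: A_def qexp_add[symmetric])
      also have "\<dots> = - 1 * A z"
        unfolding A_def K1 by (simp only: mult_minus_left mult_minus_right minus_minus mult_1_left mult_ac)
      finally show ?thesis .
    qed
    show "A (z + \<tau>) = - qexp (- z - \<tau> / 2) * A z"
    proof -
      have "(z + \<tau>) / \<tau> = z / \<tau> + 1" using nz by (simp add: field_simps)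
      moreover have "- (z + \<tau>)\<^sup>2 / (2 * \<tau>) = (- z - \<tau> / 2) + (- z\<^sup>2 / (2 * \<tau>))"
        using nz by (simp add: field_simps power2_eq_square)
      ultimately show ?thesis unfolding A_def
        by (simp only: kfun_add_1 qexp_add) simp
    qed
  qed (auto simp: A_def kfun_add_1 kfun_add_tau[OF \<tau>] intro: kfun_eq_0_imp[OF \<tau>])
  hence "kfun (z / \<tau>) (- 1 / \<tau>) * qexp (- z\<^sup>2 / (2 * \<tau>)) = kfun z \<tau> / \<tau>"
    by (simp add: A_def)
  thus ?thesis by (simp add: qexp_minus field_simps)
qed

section \<open>Klein forms and Weber functions\<close>

text \<open>The exponential absorbs the Gaussian of \<open>kfun_S\<close>. As a result the modular
  group acts on the index (u, v) alone, apart from an automorphy factor of weight -1.\<close>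

definition klein :: "complex \<Rightarrow> complex \<Rightarrow> complex \<Rightarrow> complex" where
  "klein u v \<tau> = qexp (u * (u * \<tau> + v) / 2) * kfun (u * \<tau> + v) \<tau>"

lemma klein_minus: "klein (- u) (- v) \<tau> = - klein u v \<tau>"
  using kfun_minus[of "u * \<tau> + v" \<tau>] by (simp add: klein_def algebra_simps)

lemma klein_T: "klein u v (\<tau> + 1) = klein u (u + v) \<tau>"
  using kfun_shift_T[of "u * \<tau> + (u + v)" \<tau>] by (simp add: klein_def algebra_simps)

lemma klein_T_minus: "klein u v (\<tau> - 1) = klein u (v - u) \<tau>"
  using klein_T[of u "v - u" "\<tau> - 1"] by simp

lemma Im_S_pos:
  assumes "Im \<tau> > 0"
  shows "Im (- 1 / \<tau>) > 0"
  using assms by (simp add: Im_divide power2_eq_square field_simps sum_squares_gt_zero_iff complex_eq_iff)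

lemma klein_S:
  assumes \<tau>: "Im \<tau> > 0"
  shows "klein u v (- 1 / \<tau>) = klein v (- u) \<tau> / \<tau>"
proof -
  have nz: "\<tau> \<noteq> 0" using \<tau> by auto
  define z where "z = v * \<tau> - u"
  have 1: "u * (- 1 / \<tau>) + v = z / \<tau>" using nz by (simp add: z_def field_simps)
  have 2: "v * z / 2 = u * (z / \<tau>) / 2 + z\<^sup>2 / (2 * \<tau>)"
    using nz by (simp add: z_def field_simps power2_eq_square)
  have "klein u v (- 1 / \<tau>) = qexp (u * (z / \<tau>) / 2) * (qexp (z\<^sup>2 / (2 * \<tau>)) / \<tau> * kfun z \<tau>)"
    unfolding klein_def 1 kfun_S[OF \<tau>] ..
  also have "\<dots> = qexp (v * z / 2) * kfun z \<tau> / \<tau>"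
    unfolding 2 qexp_add by simp
  finally show ?thesis by (simp add: klein_def z_def)
qed

text \<open>The generator (1, 0; 2, 1) as inversion, translation by -2, inversion.\<close>

lemma U_eq:
  fixes \<tau> :: complex
  assumes \<tau>: "Im \<tau> > 0"
  shows "\<tau> / (2 * \<tau> + 1) = - 1 / (- 1 / \<tau> - 2)" "2 * \<tau> + 1 \<noteq> 0" "Im (\<tau> / (2 * \<tau> + 1)) > 0"
proof -
  have nz: "\<tau> \<noteq> 0" using \<tau> by auto
  show nz2: "2 * \<tau> + 1 \<noteq> 0" using \<tau> by (auto simp: complex_eq_iff)
  have "- 1 / \<tau> - 2 = - ((2 * \<tau> + 1) / \<tau>)" using nz by (simp add: field_simps)
  thus eq: "\<tau> / (2 * \<tau> + 1) = - 1 / (- 1 / \<tau> - 2)"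
    by (simp only: minus_divide_divide divide_divide_eq_right mult_1_left)
  show "Im (\<tau> / (2 * \<tau> + 1)) > 0"
    unfolding eq by (rule Im_S_pos) (use Im_S_pos[OF \<tau>] in simp)
qed

lemma klein_U:
  assumes \<tau>: "Im \<tau> > 0"
  shows "klein u v (\<tau> / (2 * \<tau> + 1)) = klein (u + 2 * v) v \<tau> / (2 * \<tau> + 1)"
proof -
  have nz: "\<tau> \<noteq> 0" using \<tau> by auto
  define \<sigma> where "\<sigma> = - 1 / \<tau>"
  have \<sigma>: "Im \<sigma> > 0" unfolding \<sigma>_def by (rule Im_S_pos[OF \<tau>])
  have "klein u v (- 1 / (\<sigma> - 2)) = klein v (- u) (\<sigma> - 2) / (\<sigma> - 2)"
    by (rule klein_S) (use \<sigma> in simp)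
  also have "klein v (- u) (\<sigma> - 2) = klein v (- (u + 2 * v)) \<sigma>"
    using klein_T_minus[of v "- u" "\<sigma> - 1"] klein_T_minus[of v "- u - v" \<sigma>] by (simp add: algebra_simps)
  also have "klein v (- (u + 2 * v)) \<sigma> = klein (- (u + 2 * v)) (- v) \<tau> / \<tau>"
    unfolding \<sigma>_def by (rule klein_S[OF \<tau>])
  also have "\<dots> / (\<sigma> - 2) = klein (u + 2 * v) v \<tau> / (2 * \<tau> + 1)"
  proof -
    have "\<tau> * (\<sigma> - 2) = - (2 * \<tau> + 1)" using nz by (simp add: \<sigma>_def field_simps)
    thus ?thesis unfolding klein_minus by (simp only: divide_divide_eq_left minus_divide_divide)
  qed
  finally show ?thesis by (simp add: U_eq(1)[OF \<tau>] \<sigma>_def)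
qed

lemma klein_add_1_right: "klein u (v + 1) \<tau> = - qexp (u / 2) * klein u v \<tau>"
  using kfun_add_1[of "u * \<tau> + v" \<tau>]
  by (simp add: klein_def add.assoc[symmetric] distrib_left add_divide_distrib qexp_add)

lemma klein_add_1_left:
  assumes "Im \<tau> > 0"
  shows "klein (u + 1) v \<tau> = - qexp (- v / 2) * klein u v \<tau>"
proof -
  define z where "z = u * \<tau> + v"
  have 1: "(u + 1) * \<tau> + v = z + \<tau>" by (simp add: z_def algebra_simps)
  have 2: "(u + 1) * (z + \<tau>) / 2 + (- z - \<tau> / 2) = - v / 2 + u * z / 2"
    by (simp add: z_def field_simps)
  have "klein (u + 1) v \<tau> = - (qexp ((u + 1) * (z + \<tau>) / 2 + (- z - \<tau> / 2))) * kfun z \<tau>"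
    unfolding klein_def 1 kfun_add_tau[OF assms] qexp_add[of "(u + 1) * (z + \<tau>) / 2"] by simp
  thus ?thesis unfolding 2 qexp_add[of "- v / 2"] by (simp add: klein_def z_def)
qed

text \<open>Even shifts only: the two signs of \<open>klein_add_1_right\<close> cancel and a pure
  exponential remains.\<close>

lemma klein_add_even_right: "klein u (v + 2 * of_int m) \<tau> = qexp (of_int m * u) * klein u v \<tau>"
proof -
  \<comment> \<open>Divided by the exponential that the shift produces, the Klein form has period 2
    in w, so \<open>periodic_int\<close> handles all integers at once.\<close>
  define g where "g = (\<lambda>w. klein u w \<tau> * qexp (- (u * w / 2)))"
  have "g (w + 2) = g w" for w
  proof -
    have "klein u (w + 1 + 1) \<tau> = (qexp (u / 2) * qexp (u / 2)) * klein u w \<tau>"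
      by (simp only: klein_add_1_right mult_minus_left mult_minus_right minus_minus mult.assoc)
    also have "qexp (u / 2) * qexp (u / 2) = qexp u" by (simp add: qexp_add[symmetric])
    finally have "klein u (w + 2) \<tau> = qexp u * klein u w \<tau>" by (simp add: add.assoc)
    moreover have "- (u * (w + 2) / 2) = - (u * w / 2) - u" by (simp add: field_simps)
    ultimately show ?thesis unfolding g_def by (simp only: qexp_diff) simp
  qed
  hence "g (v + of_int m * 2) = g v" by (rule periodic_int)
  moreover have "- (u * (v + of_int m * 2) / 2) = - (u * v / 2) - of_int m * u" by (simp add: field_simps)
  ultimately have "klein u (v + of_int m * 2) \<tau> * (qexp (- (u * v / 2)) / qexp (of_int m * u)) = klein u v \<tau> * qexp (- (u * v / 2))"
    by (simp only: g_def qexp_diff)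
  thus ?thesis by (simp add: divide_eq_eq mult_ac)
qed

lemma klein_add_even_left:
  assumes "Im \<tau> > 0"
  shows "klein (u + 2 * of_int m) v \<tau> = qexp (- (of_int m * v)) * klein u v \<tau>"
proof -
  define g where "g = (\<lambda>w. klein w v \<tau> * qexp (v * w / 2))"
  have "g (w + 2) = g w" for w
  proof -
    have "klein (w + 1 + 1) v \<tau> = (qexp (- v / 2) * qexp (- v / 2)) * klein w v \<tau>"
      by (simp only: klein_add_1_left[OF assms] mult_minus_left mult_minus_right minus_minus mult.assoc)
    also have "qexp (- v / 2) * qexp (- v / 2) = qexp (- v)" by (simp add: qexp_add[symmetric])
    finally have "klein (w + 2) v \<tau> = qexp (- v) * klein w v \<tau>" by (simp add: add.assoc)
    moreover have "v * (w + 2) / 2 = v * w / 2 + v" by (simp add: field_simps)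
    ultimately show ?thesis unfolding g_def by (simp only: qexp_add) (simp add: qexp_minus)
  qed
  hence "g (u + of_int m * 2) = g u" by (rule periodic_int)
  moreover have "v * (u + of_int m * 2) / 2 = v * u / 2 + of_int m * v" by (simp add: field_simps)
  ultimately have "klein (u + of_int m * 2) v \<tau> * (qexp (v * u / 2) * qexp (of_int m * v)) = klein u v \<tau> * qexp (v * u / 2)"
    by (simp only: g_def qexp_add)
  thus ?thesis by (simp add: qexp_minus field_simps)
qed

lemma klein_product:
  fixes u v \<tau> :: complex
  assumes \<tau>: "Im \<tau> > 0"
  defines "z \<equiv> u * \<tau> + v"
  shows "klein u v \<tau> = - qexp (u * z / 2 - z / 2) * qpoch_inf (qexp z) (qexp \<tau>)
    * qpoch_inf (qexp (\<tau> - z)) (qexp \<tau>) / (qpoch_inf (qexp \<tau>) (qexp \<tau>))\<^sup>2"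
proof -
  have 1: "qexp (u * z / 2) * (qexp (z / 2) - qexp (- z / 2)) = - qexp (u * z / 2 - z / 2) * (1 - qexp z)"
    by (simp add: right_diff_distrib qexp_add[symmetric] algebra_simps)
  have 2: "(1 - qexp z) * qpoch_inf (qexp (\<tau> + z)) (qexp \<tau>) = qpoch_inf (qexp z) (qexp \<tau>)"
    using qpoch_inf_unfold[OF norm_qexp_less_1[OF \<tau>], of "qexp z"] by (simp add: qexp_add mult.commute)
  have "klein u v \<tau> = (qexp (u * z / 2) * (qexp (z / 2) - qexp (- z / 2))) * qpoch_inf (qexp (\<tau> + z)) (qexp \<tau>)
     * qpoch_inf (qexp (\<tau> - z)) (qexp \<tau>) / (qpoch_inf (qexp \<tau>) (qexp \<tau>))\<^sup>2"
    by (simp add: klein_def kfun_def z_def)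
  also have "\<dots> = - qexp (u * z / 2 - z / 2) * ((1 - qexp z) * qpoch_inf (qexp (\<tau> + z)) (qexp \<tau>))
     * qpoch_inf (qexp (\<tau> - z)) (qexp \<tau>) / (qpoch_inf (qexp \<tau>) (qexp \<tau>))\<^sup>2"
    unfolding 1 by (simp only: mult.assoc)
  finally show ?thesis unfolding 2 .
qed

lemma klein_half:
  assumes \<tau>: "Im \<tau> > 0"
  shows "klein (1/2) v \<tau> = - qexp (- \<tau> / 8 - v / 4) * qpoch_inf (qexp (\<tau> / 2 + v)) (qexp \<tau>)
    * qpoch_inf (qexp (\<tau> / 2 - v)) (qexp \<tau>) / (qpoch_inf (qexp \<tau>) (qexp \<tau>))\<^sup>2"
proof -
  have "1/2 * \<tau> + v = \<tau> / 2 + v" "\<tau> - (\<tau> / 2 + v) = \<tau> / 2 - v"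
    "1/2 * (\<tau> / 2 + v) / 2 - (\<tau> / 2 + v) / 2 = - \<tau> / 8 - v / 4"
    by (simp_all add: field_simps)
  thus ?thesis using klein_product[OF \<tau>, of "1/2" v] by (simp only:)
qed

text \<open>In the classical notation these are $f_2 / \surd 2$ and $f_1$.\<close>

definition weber2 :: "complex \<Rightarrow> complex" where
  "weber2 \<tau> = qexp (\<tau> / 24) * qpoch_inf (- qexp \<tau>) (qexp \<tau>)"

definition weber1 :: "complex \<Rightarrow> complex" where
  "weber1 \<tau> = qexp (- \<tau> / 48) * qpoch_inf (qexp (\<tau> / 2)) (qexp \<tau>)"

lemma weber2_T: "weber2 (\<tau> + 1) = qexp (1/24) * weber2 \<tau>"
  by (simp add: weber2_def qexp_add add_divide_distrib mult_ac)

lemma weber1_T2: "weber1 (\<tau> - 2) = qexp (1/24) * weber1 \<tau>"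
proof -
  have "- (\<tau> - 2) / 48 = 1/24 + - \<tau> / 48" by (simp add: field_simps)
  moreover have "qexp ((\<tau> - 2) / 2) = qexp (\<tau> / 2)" by (simp add: diff_divide_distrib qexp_diff)
  moreover have "qexp (\<tau> - 2) = qexp \<tau>" using qexp_of_int[of 2] by (simp add: qexp_diff)
  ultimately show ?thesis unfolding weber1_def by (simp only: qexp_add mult.assoc)
qed

text \<open>Euler's theorem on odd and distinct parts in product form: (q; q)_\<infinity> is split
  by the parity of the index, and its even part is rewritten by
  \<open>qpoch_inf_mult_uminus\<close>.\<close>

lemma euler_odd_distinct:
  assumes q: "norm q < 1"
  shows "qpoch_inf q (q\<^sup>2) * qpoch_inf (- q) q = 1"
proof -
  have "qpoch_inf q q = qpoch_inf q (q\<^sup>2) * qpoch_inf (q\<^sup>2) (q\<^sup>2)"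
    using qpoch_inf_dissect[OF q, of 2 q] by (simp add: numeral_2_eq_2)
  also have "qpoch_inf (q\<^sup>2) (q\<^sup>2) = qpoch_inf q q * qpoch_inf (- q) q"
    using qpoch_inf_mult_uminus[OF q, of q] by simp
  finally show ?thesis using qpoch_inf_nonzero[OF q q] by simp
qed

context
  fixes \<tau> :: complex
  assumes \<tau>: "Im \<tau> > 0"
begin

lemma weber1_nonzero: "weber1 \<tau> \<noteq> 0"
  using \<tau> by (simp add: weber1_def qpoch_inf_nonzero norm_qexp_less_1)

text \<open>The Klein forms at the three half periods are monomials times a2^2, a1^2, a3^2 over the
  same denominator, and a1 a2 a3 = 1. Hence for instance a2^4 / (a1^2 a3^2) = a2^6.\<close>

lemma weber_pow6:
  defines "c \<equiv> qexp (1/4) - qexp (- 1/4)"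
  shows "(klein 0 (1/2) \<tau>)\<^sup>2 / (klein (1/2) 0 \<tau> * klein (1/2) (1/2) \<tau>) = c\<^sup>2 * qexp (1/8) * weber2 \<tau> ^ 6"
    and "(klein (1/2) 0 \<tau>)\<^sup>2 / (klein 0 (1/2) \<tau> * klein (1/2) (1/2) \<tau>) = - (qexp (1/8) / c) * weber1 \<tau> ^ 6"
    and "c \<noteq> 0"
proof -
  define q where "q = qexp \<tau>"
  have q: "norm q < 1" unfolding q_def by (rule norm_qexp_less_1[OF \<tau>])
  define p where "p = qexp (\<tau> / 2)"
  have pq: "p\<^sup>2 = q" by (simp add: p_def q_def qexp_power)
  define D where "D = (qpoch_inf q q)\<^sup>2"
  define a1 where "a1 = qpoch_inf p q"
  define a2 where "a2 = qpoch_inf (- q) q"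
  define a3 where "a3 = qpoch_inf (- p) q"
  have half: "qexp (x + 1/2) = - qexp x" "qexp (x - 1/2) = - qexp x" for x
    by (simp_all add: qexp_add qexp_diff)
  have "a1 * a3 = qpoch_inf q (q\<^sup>2)"
    unfolding a1_def a3_def using qpoch_inf_mult_uminus[OF q, of p] by (simp add: pq)
  hence prod: "a1 * a3 * a2 = 1"
    using euler_odd_distinct[OF q] by (simp add: a2_def)
  hence nz: "a1 \<noteq> 0" "a2 \<noteq> 0" "a3 \<noteq> 0" "D \<noteq> 0"
    using qpoch_inf_nonzero[OF q q] by (auto simp: D_def)
  have k2: "klein 0 (1/2) \<tau> = c * a2\<^sup>2 / D"
    by (simp add: klein_def kfun_def half c_def a2_def D_def q_def power2_eq_square)
  have k1: "klein (1/2) 0 \<tau> = - qexp (- \<tau> / 8) * a1\<^sup>2 / D"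
    by (simp add: klein_half[OF \<tau>] a1_def D_def q_def p_def power2_eq_square)
  have k3: "klein (1/2) (1/2) \<tau> = - qexp (- \<tau> / 8 - 1/8) * a3\<^sup>2 / D"
    by (simp add: klein_half[OF \<tau>] half a3_def D_def q_def p_def power2_eq_square)
  show c: "c \<noteq> 0"
  proof
    assume "c = 0"
    moreover have "qexp (1/4) * qexp (1/4) = qexp (1/2)" "qexp (1/4) * qexp (- 1/4) = qexp 0"
      by (simp_all only: qexp_add[symmetric]) simp_all
    ultimately show False by (simp add: c_def)
  qed
  define X where "X = qexp (- \<tau> / 8)"
  define W where "W = qexp (1/8)"
  have XW: "X \<noteq> 0" "W \<noteq> 0" by (simp_all add: X_def W_def)
  have e: "qexp (- \<tau> / 8 - 1/8) = X / W" by (simp only: qexp_diff X_def W_def)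
  have "qexp (\<tau> / 24) ^ 6 * X\<^sup>2 = 1" "qexp (- \<tau> / 48) ^ 6 = X"
    unfolding X_def qexp_power qexp_add[symmetric] by simp_all
  hence w: "weber2 \<tau> ^ 6 = a2 ^ 6 / X\<^sup>2" "weber1 \<tau> ^ 6 = X * a1 ^ 6"
    using XW by (simp_all add: weber1_def weber2_def power_mult_distrib a1_def a2_def p_def q_def field_simps)
  have a3: "a3 = 1 / (a1 * a2)" using prod nz by (simp add: field_simps)
  show "(klein 0 (1/2) \<tau>)\<^sup>2 / (klein (1/2) 0 \<tau> * klein (1/2) (1/2) \<tau>) = c\<^sup>2 * qexp (1/8) * weber2 \<tau> ^ 6"
    unfolding k1 k2 k3 e w X_def[symmetric] W_def[symmetric] a3
    using nz XW by (simp add: field_simps power2_eq_square eval_nat_numeral)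
  show "(klein (1/2) 0 \<tau>)\<^sup>2 / (klein 0 (1/2) \<tau> * klein (1/2) (1/2) \<tau>) = - (qexp (1/8) / c) * weber1 \<tau> ^ 6"
    unfolding k1 k2 k3 e w X_def[symmetric] W_def[symmetric] a3
    using nz XW c by (simp add: field_simps power2_eq_square eval_nat_numeral)
qed

end

lemma convex_upper_half_plane: "convex upper_half_plane"
  using convex_halfspace_Im_gt[of 0] by (simp add: upper_half_plane_def)

lemma open_upper_half_plane: "open upper_half_plane"
  using open_halfspace_Im_gt[of 0] by (simp add: upper_half_plane_def)

text \<open>Taking sixth powers leaves a sixth root of \<open>C\<close> undetermined. The quotient
  of the two functions is continuous on a connected set and takes its values among the finitely many
  roots, so it is constant.\<close>

lemma weber_S:
  obtains c where "\<And>\<tau>. Im \<tau> > 0 \<Longrightarrow> weber2 (- 1 / \<tau>) = c * weber1 \<tau>"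
proof -
  define c where "c = qexp (1/4) - qexp (- 1/4)"
  define C where "C = - qexp (1/4) / c / c\<^sup>2"
  have pow: "weber2 (- 1 / \<tau>) ^ 6 = C * weber1 \<tau> ^ 6" if \<tau>: "Im \<tau> > 0" for \<tau>
  proof -
    have nz: "\<tau> \<noteq> 0" using \<tau> by auto
    have S1: "klein 0 (1/2) (- 1 / \<tau>) = klein (1/2) 0 \<tau> / \<tau>"
      using klein_S[OF \<tau>, of 0 "1/2"] by simp
    have S2: "klein (1/2) 0 (- 1 / \<tau>) = - klein 0 (1/2) \<tau> / \<tau>"
      using klein_S[OF \<tau>, of "1/2" 0] klein_minus[of 0 "1/2" \<tau>] by simp
    have S3: "klein (1/2) (1/2) (- 1 / \<tau>) = - (1 / qexp (1/4)) * klein (1/2) (1/2) \<tau> / \<tau>"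
      using klein_S[OF \<tau>, of "1/2" "1/2"] klein_add_1_right[of "1/2" "- 1/2" \<tau>] by (simp add: field_simps)
    have "c\<^sup>2 * qexp (1/8) * weber2 (- 1 / \<tau>) ^ 6 =
        qexp (1/4) * ((klein (1/2) 0 \<tau>)\<^sup>2 / (klein 0 (1/2) \<tau> * klein (1/2) (1/2) \<tau>))"
      unfolding weber_pow6(1)[OF Im_S_pos[OF \<tau>], folded c_def, symmetric] S1 S2 S3
      using nz by (simp add: field_simps power2_eq_square)
    also have "\<dots> = qexp (1/4) * (- (qexp (1/8) / c) * weber1 \<tau> ^ 6)"
      unfolding weber_pow6(2)[OF \<tau>, folded c_def] ..
    finally have "qexp (1/8) * (c\<^sup>2 * weber2 (- 1 / \<tau>) ^ 6) = qexp (1/8) * (- (qexp (1/4) / c) * weber1 \<tau> ^ 6)"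
      by (simp only: mult_ac) (simp add: mult_ac)
    hence "c\<^sup>2 * weber2 (- 1 / \<tau>) ^ 6 = - (qexp (1/4) / c) * weber1 \<tau> ^ 6"
      by (simp only: mult_cancel_left qexp_nonzero simp_thms)
    thus ?thesis
      using weber_pow6(3)[OF \<tau>, folded c_def] by (simp add: C_def field_simps)
  qed
  define f where "f = (\<lambda>\<tau>. weber2 (- 1 / \<tau>) / weber1 \<tau>)"
  have "f constant_on upper_half_plane"
  proof (rule continuous_finite_range_constant)
    show "connected upper_half_plane" by (rule convex_connected[OF convex_upper_half_plane])
    have "f holomorphic_on upper_half_plane"
      unfolding f_def weber1_def weber2_def
      by (intro holomorphic_intros open_upper_half_plane)
         (use norm_qexp_less_1 Im_S_pos in \<open>auto simp: upper_half_plane_def qpoch_inf_nonzero norm_qexp_less_1\<close>)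
    thus "continuous_on upper_half_plane f" by (rule holomorphic_on_imp_continuous_on)
    have "f ` upper_half_plane \<subseteq> {z. z ^ 6 = C}"
      using pow weber1_nonzero by (auto simp: f_def upper_half_plane_def power_divide)
    thus "finite (f ` upper_half_plane)"
      by (rule finite_subset) (rule finite_nth_roots, simp)
  qed
  then obtain c where "\<And>\<tau>. Im \<tau> > 0 \<Longrightarrow> f \<tau> = c"
    by (auto simp: constant_on_def upper_half_plane_def)
  hence "weber2 (- 1 / \<tau>) = c * weber1 \<tau>" if "Im \<tau> > 0" for \<tau>
    using that weber1_nonzero[OF that] by (force simp: f_def)
  thus ?thesis by (rule that)
qed

text \<open>The inversion enters twice, so the constant of \<open>weber_S\<close> cancels and only
  the translation of \<open>weber1\<close> by -2 contributes.\<close>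

lemma weber2_U:
  assumes \<tau>: "Im \<tau> > 0"
  shows "weber2 (\<tau> / (2 * \<tau> + 1)) = qexp (1/24) * weber2 \<tau>"
proof -
  have nz: "\<tau> \<noteq> 0" using \<tau> by auto
  obtain c where c: "\<And>\<tau>. Im \<tau> > 0 \<Longrightarrow> weber2 (- 1 / \<tau>) = c * weber1 \<tau>" using weber_S by blast
  define \<sigma> where "\<sigma> = - 1 / \<tau>"
  have \<sigma>: "Im \<sigma> > 0" unfolding \<sigma>_def by (rule Im_S_pos[OF \<tau>])
  have "weber2 (- 1 / (\<sigma> - 2)) = c * (qexp (1/24) * weber1 \<sigma>)"
    unfolding weber1_T2[symmetric] using c[of "\<sigma> - 2"] \<sigma> by simp
  also have "c * weber1 \<sigma> = weber2 \<tau>"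
    using c[OF \<sigma>] nz by (simp add: \<sigma>_def)
  hence "c * (qexp (1/24) * weber1 \<sigma>) = qexp (1/24) * weber2 \<tau>" by simp
  finally show ?thesis by (simp add: U_eq(1)[OF \<tau>] \<sigma>_def)
qed

section \<open>Action of the group $\<Gamma>_0(2)$\<close>

text \<open>Euclid's algorithm on the bottom row, by right multiplication with the generators. As c
  is even and d is odd, |c| and |d| differ, and changing d by c or c by 2d with the right sign
  lowers |c| + |d|; at c = 0 the matrix is a translation up to sign.\<close>

lemma Gamma0_2_induct [consumes 2, case_names base T T_inv U U_inv]:
  fixes P :: "int \<Rightarrow> int \<Rightarrow> int \<Rightarrow> int \<Rightarrow> bool"
  assumes "a * d - b * c = 1" "even c"
    and base: "\<And>a b. a = 1 \<or> a = -1 \<Longrightarrow> P a b 0 a"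
    and T: "\<And>a b c d. a * d - b * c = 1 \<Longrightarrow> even c \<Longrightarrow> P a b c d \<Longrightarrow> P a (b + a) c (d + c)"
    and T_inv: "\<And>a b c d. a * d - b * c = 1 \<Longrightarrow> even c \<Longrightarrow> P a b c d \<Longrightarrow> P a (b - a) c (d - c)"
    and U: "\<And>a b c d. a * d - b * c = 1 \<Longrightarrow> even c \<Longrightarrow> P a b c d \<Longrightarrow> P (a + 2 * b) b (c + 2 * d) d"
    and U_inv: "\<And>a b c d. a * d - b * c = 1 \<Longrightarrow> even c \<Longrightarrow> P a b c d \<Longrightarrow> P (a - 2 * b) b (c - 2 * d) d"
  shows "P a b c d"
  using assms(1,2)
proof (induction "nat (\<bar>c\<bar> + \<bar>d\<bar>)" arbitrary: a b c d rule: less_induct)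
  case less
  have odd: "odd d" using less.prems
    by (metis dvd_diff dvd_mult odd_one)
  show ?case
  proof (cases "c = 0")
    case True
    hence "a * d = 1" using less.prems by simp
    hence "(a = 1 \<or> a = - 1) \<and> d = a" by (auto simp: zmult_eq_1_iff)
    thus ?thesis using base True by metis
  next
    case c: False
    have "\<bar>c\<bar> \<noteq> \<bar>d\<bar>" using odd less.prems(2) by (metis dvd_abs_iff)
    then consider "\<bar>d\<bar> > \<bar>c\<bar>" "\<bar>d - c\<bar> < \<bar>d\<bar>" | "\<bar>d\<bar> > \<bar>c\<bar>" "\<bar>d + c\<bar> < \<bar>d\<bar>"
      | "\<bar>d\<bar> < \<bar>c\<bar>" "\<bar>c - 2 * d\<bar> < \<bar>c\<bar>" | "\<bar>d\<bar> < \<bar>c\<bar>" "\<bar>c + 2 * d\<bar> < \<bar>c\<bar>"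
    proof -
      have "d \<noteq> 0" using odd by auto
      hence "\<bar>d\<bar> > \<bar>c\<bar> \<and> (\<bar>d - c\<bar> < \<bar>d\<bar> \<or> \<bar>d + c\<bar> < \<bar>d\<bar>) \<or>
          \<bar>d\<bar> < \<bar>c\<bar> \<and> (\<bar>c - 2 * d\<bar> < \<bar>c\<bar> \<or> \<bar>c + 2 * d\<bar> < \<bar>c\<bar>)"
        using c \<open>\<bar>c\<bar> \<noteq> \<bar>d\<bar>\<close> by arith
      thus ?thesis using that by blast
    qed
    thus ?thesis
    proof cases
      case 1
      have det: "a * (d - c) - (b - a) * c = 1" using less.prems by (simp add: algebra_simps)
      have "P a (b - a) c (d - c)" using 1 det less.prems(2) by (intro less.hyps) auto
      from T[OF det less.prems(2) this] show ?thesis by simp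
    next
      case 2
      have det: "a * (d + c) - (b + a) * c = 1" using less.prems by (simp add: algebra_simps)
      have "P a (b + a) c (d + c)" using 2 det less.prems(2) by (intro less.hyps) auto
      from T_inv[OF det less.prems(2) this] show ?thesis by simp
    next
      case 3
      have det: "(a - 2 * b) * d - b * (c - 2 * d) = 1" using less.prems by (simp add: algebra_simps)
      have ev: "even (c - 2 * d)" using less.prems by simp
      have "P (a - 2 * b) b (c - 2 * d) d" using 3 det ev by (intro less.hyps) auto
      from U[OF det ev this] show ?thesis by simp
    next
      case 4
      have det: "(a + 2 * b) * d - b * (c + 2 * d) = 1" using less.prems by (simp add: algebra_simps)
      have ev: "even (c + 2 * d)" using less.prems by simp
      have "P (a + 2 * b) b (c + 2 * d) d" using 4 det ev by (intro less.hyps) auto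
      from U_inv[OF det ev this] show ?thesis by simp
    qed
  qed
qed

text \<open>\<open>moebius_act\<close> with the matrix entries as separate integers, the form in
  which \<open>Gamma0_2_induct\<close> handles them.\<close>

definition moeb :: "int \<Rightarrow> int \<Rightarrow> int \<Rightarrow> int \<Rightarrow> complex \<Rightarrow> complex" where
  "moeb a b c d \<tau> = (of_int a * \<tau> + of_int b) / (of_int c * \<tau> + of_int d)"

lemma moeb_denom_nonzero:
  assumes "Im \<tau> > 0" "a * d - b * c = 1"
  shows "of_int c * \<tau> + of_int d \<noteq> 0"
proof
  assume 0: "of_int c * \<tau> + of_int d = 0"
  hence "Im (of_int c * \<tau> + of_int d) = 0" by simp
  hence "c = 0" using assms(1) by simp
  with 0 assms show False by simp
qed

lemma moeb_T: "moeb a (b + a) c (d + c) \<tau> = moeb a b c d (\<tau> + 1)"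
  "moeb a (b - a) c (d - c) \<tau> = moeb a b c d (\<tau> - 1)"
  by (simp_all add: moeb_def algebra_simps)

lemma moeb_U:
  assumes "2 * \<tau> + 1 \<noteq> 0"
  shows "moeb (a + 2 * b) b (c + 2 * d) d \<tau> = moeb a b c d (\<tau> / (2 * \<tau> + 1))"
proof -
  have "of_int x * (\<tau> / (2 * \<tau> + 1)) + of_int y = ((of_int x + 2 * of_int y) * \<tau> + of_int y) / (2 * \<tau> + 1)" for x y
    using assms by (simp add: field_simps)
  thus ?thesis using assms by (simp add: moeb_def)
qed

lemma U_inv_eq:
  fixes \<tau> :: complex
  assumes "Im \<tau> > 0"
  defines "\<tau>' \<equiv> \<tau> / (1 - 2 * \<tau>)"
  shows "Im \<tau>' > 0" "\<tau>' / (2 * \<tau>' + 1) = \<tau>" "1 - 2 * \<tau> \<noteq> 0" "2 * \<tau>' + 1 = 1 / (1 - 2 * \<tau>)"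
proof -
  show nz: "1 - 2 * \<tau> \<noteq> 0" using assms by (auto simp: complex_eq_iff)
  show 1: "2 * \<tau>' + 1 = 1 / (1 - 2 * \<tau>)" using nz by (simp add: \<tau>'_def field_simps)
  thus "\<tau>' / (2 * \<tau>' + 1) = \<tau>" using nz by (simp add: \<tau>'_def)
  have "Im \<tau>' = Im \<tau> / ((1 - 2 * Re \<tau>)\<^sup>2 + (2 * Im \<tau>)\<^sup>2)"
    by (simp add: \<tau>'_def Im_divide algebra_simps)
  moreover have "(1 - 2 * Re \<tau>)\<^sup>2 + (2 * Im \<tau>)\<^sup>2 > 0"
    using assms by (intro add_nonneg_pos) auto
  ultimately show "Im \<tau>' > 0" using assms by simp
qed

lemma moeb_U_inv:
  assumes "1 - 2 * \<tau> \<noteq> 0"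
  shows "moeb (a - 2 * b) b (c - 2 * d) d \<tau> = moeb a b c d (\<tau> / (1 - 2 * \<tau>))"
proof -
  have "of_int x * (\<tau> / (1 - 2 * \<tau>)) + of_int y = ((of_int x - 2 * of_int y) * \<tau> + of_int y) / (1 - 2 * \<tau>)" for x y
    using assms by (simp add: field_simps)
  thus ?thesis using assms by (simp add: moeb_def)
qed

lemma moeb_base:
  assumes "a = 1 \<or> a = -1"
  shows "moeb a b 0 a \<tau> = \<tau> + of_int (a * b)"
  using assms by (auto simp: moeb_def)

lemma klein_T_int: "klein u v (\<tau> + of_int n) = klein u (v + of_int n * u) \<tau>"
proof (induction n arbitrary: v rule: int_induct[of _ 0])
  case (step1 i)
  thus ?case using klein_T[of u v "\<tau> + of_int i"] by (simp add: algebra_simps)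
next
  case (step2 i)
  thus ?case using klein_T_minus[of u v "\<tau> + of_int i"] by (simp add: algebra_simps)
qed simp

text \<open>The row vector (u, v) is multiplied by the matrix from the right. A generator on the
  right acts on \<tau> first, so the induction hypothesis is used at the moved point, and
  \<open>klein_T\<close> or \<open>klein_U\<close> then rewrites the index.\<close>

theorem klein_moeb:
  assumes "a * d - b * c = 1" "even c" "Im \<tau> > 0"
  shows "klein u v (moeb a b c d \<tau>) = klein (u * of_int a + v * of_int c) (u * of_int b + v * of_int d) \<tau>
    / (of_int c * \<tau> + of_int d)"
  using assms
proof (induction a b c d arbitrary: \<tau> u v rule: Gamma0_2_induct)
  case (base a b)
  show ?case unfolding moeb_base[OF base(1)] klein_T_int
    using base klein_minus[of u "v - of_int b * u" \<tau>] by (auto simp: algebra_simps)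
next
  case (T a b c d)
  have p: "Im (\<tau> + 1) > 0" using T.prems by simp
  show ?case unfolding moeb_T T.IH[OF p] klein_T by (simp add: algebra_simps)
next
  case (T_inv a b c d)
  have p: "Im (\<tau> - 1) > 0" using T_inv.prems by simp
  show ?case unfolding moeb_T T_inv.IH[OF p] klein_T_minus by (simp add: algebra_simps)
next
  case (U a b c d)
  note u = U_eq[OF U.prems]
  have den: "of_int c * (\<tau> / (2 * \<tau> + 1)) + of_int d = (of_int (c + 2 * d) * \<tau> + of_int d) / (2 * \<tau> + 1)"
    using u(2) by (simp add: field_simps)
  have arg: "u * of_int (a + 2 * b) + v * of_int (c + 2 * d)
      = (u * of_int a + v * of_int c) + 2 * (u * of_int b + v * of_int d)"
    by (simp add: algebra_simps)
  have "K / (2 * \<tau> + 1) / (N / (2 * \<tau> + 1)) = K / N" for K N using u(2) by simp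
  thus ?case unfolding moeb_U[OF u(2)] U.IH[OF u(3)] klein_U[OF U.prems] den arg .
next
  case (U_inv a b c d)
  note u = U_inv_eq[OF U_inv.prems]
  have den: "of_int c * (\<tau> / (1 - 2 * \<tau>)) + of_int d = (of_int (c - 2 * d) * \<tau> + of_int d) / (1 - 2 * \<tau>)"
    using u(3) by (simp add: field_simps)
  have arg: "u * of_int (a - 2 * b) + v * of_int (c - 2 * d)
      = (u * of_int a + v * of_int c) - 2 * (u * of_int b + v * of_int d)"
    by (simp add: algebra_simps)
  have kl: "klein x y (\<tau> / (1 - 2 * \<tau>)) = klein (x - 2 * y) y \<tau> / (1 - 2 * \<tau>)" for x y
    using klein_U[OF u(1), of "x - 2 * y" y] u(3) unfolding u(2,4) by simp
  have "K / (1 - 2 * \<tau>) / (N / (1 - 2 * \<tau>)) = K / N" for K N using u(3) by simp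
  thus ?case unfolding moeb_U_inv[OF u(3)] U_inv.IH[OF u(1)] kl den arg .
qed

section \<open>The multiplier of \<open>weber2\<close>\<close>

lemma dvd_24I: "3 dvd x \<Longrightarrow> 8 dvd x \<Longrightarrow> 24 dvd (x::int)"
  by presburger

lemma int_cases_mod_3:
  obtains f :: int where "e = 3 * f" | f where "e = 3 * f + 1" | f where "e = 3 * f + 2"
proof -
  have "e mod 3 = 0 \<or> e mod 3 = 1 \<or> e mod 3 = 2" by arith
  thus ?thesis using that mult_div_mod_eq[of 3 e] by (metis add_0_right)
qed

text \<open>
  Read off from the multipliers of $\<eta>(2\<tau>)$ and $\<eta>(\<tau>)$; the first summand encodes the
  Jacobi symbol $(2/d)$.
\<close>

definition weber_exp :: "int \<Rightarrow> int \<Rightarrow> int \<Rightarrow> int \<Rightarrow> int" where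
  "weber_exp a b c d = 3 * ((d * d - 1) div 2) + b * d * (1 + 2 * (c div 2) * (c div 2))
     + 2 * (c div 2) * d - a * (c div 2)"

text \<open>Put e = c / 2. Modulo 3 the difference is checked on the residues of e. Modulo 8 the
  parametrisation a = 2y + 1, d = 2x + 1 and the determinant in the form 2xy + x + y = be reduce it
  to a question of parity.\<close>

lemma weber_exp_T:
  assumes "a * d - b * c = 1" "even c"
  shows "[weber_exp a (b + a) c (d + c) = weber_exp a b c d + 1] (mod 24)"
proof -
  obtain e where c: "c = 2 * e" using assms(2) by (elim evenE)
  have "odd (a * d)" using assms by (metis add_diff_cancel dvd_diff dvd_mult odd_one)
  then obtain x y where d: "d = 2 * x + 1" and a: "a = 2 * y + 1" by (auto elim!: oddE)
  define X where "X = weber_exp a (b + a) c (d + c) - (weber_exp a b c d + 1)"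
  have s: "(d * d - 1) div 2 = 2 * x * x + 2 * x" "((d + c) * (d + c) - 1) div 2 = 2 * (x + e) * (x + e) + 2 * (x + e)"
    "c div 2 = e"
    by (simp_all add: c d algebra_simps)
  have be: "2 * x * y + x + y = b * e" using assms by (simp add: a c d algebra_simps)
  have X: "X = 6 * e * d + 6 * e * e + (a * d + 2 * a * e + 2 * b * e) * (1 + 2 * e * e) + 4 * e * e - 1"
    unfolding X_def weber_exp_def s by (simp add: c d algebra_simps)
  have ad: "a * d = 1 + 2 * b * e" using assms by (simp add: c algebra_simps)
  have "3 dvd X"
  proof -
    have X3: "X = 6 * e * d + 6 * e * e + (1 + 4 * b * e + 2 * a * e) * (1 + 2 * e * e) + 4 * e * e - 1"
      unfolding X ad by (simp add: algebra_simps)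
    consider f where "e = 3 * f" | f where "e = 3 * f + 1" | f where "e = 3 * f + 2"
      by (rule int_cases_mod_3)
    thus ?thesis
    proof cases
      case 1
      define A B where "A = 4 * b * f + 2 * a * f" and "B = 6 * f * f"
      have "X = 3 * (2 * e * d + 2 * e * e + A + B + 3 * A * B + 12 * f * f)"
        unfolding X3 A_def B_def 1 by (simp add: algebra_simps)
      thus ?thesis by simp
    next
      case 2
      have "X = 3 * (2 * e * d + 2 * e * e + (1 + 4 * b * e + 2 * a * e) * (6 * f * f + 4 * f + 1)
          + (12 * f * f + 8 * f + 1))"
        unfolding X3 2 by (simp add: algebra_simps)
      thus ?thesis by simp
    next
      case 3
      have "X = 3 * (2 * e * d + 2 * e * e + (1 + 4 * b * e + 2 * a * e) * (6 * f * f + 8 * f + 3)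
          + (12 * f * f + 16 * f + 5))"
        unfolding X3 3 by (simp add: algebra_simps)
      thus ?thesis by simp
    qed
  qed
  moreover have "8 dvd X"
  proof -
    \<comment> \<open>The factor (e + 1)(x + y + e^2) is even in both cases: through e + 1 if e is
      odd, through the determinant if e is even.\<close>
    have "even (x + y)" if "even e"
    proof -
      have "x + y = b * e - 2 * x * y" using be by simp
      thus ?thesis using that by simp
    qed
    hence "even ((e + 1) * (x + y + e * e))" by auto
    then obtain w where w: "(e + 1) * (x + y + e * e) = 2 * w" by (elim evenE)
    have "X = 6 * e * d + 12 * e * e + 4 * (b * e) + 2 * a * e + 8 * (b * e) * (e * e) + 4 * a * e * e * e"
      unfolding X ad by (simp add: algebra_simps)
    also have "\<dots> = 4 * ((e + 1) * (x + y + e * e)) + 8 * (e * x + e * e + e + x * y + (b * e) * (e * e) + y * e * e * e)"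
      unfolding be[symmetric] by (simp add: a d algebra_simps)
    also have "\<dots> = 8 * (w + (e * x + e * e + e + x * y + (b * e) * (e * e) + y * e * e * e))"
      unfolding w by simp
    finally show ?thesis by simp
  qed
  ultimately have "24 dvd X"
    by (rule dvd_24I)
  thus ?thesis by (simp add: X_def cong_iff_dvd_diff)
qed

text \<open>The determinant reduces the difference to 2 d (d^2 - 1)(a + b), and 24 divides 2 d (d^2
  - 1) for odd d.\<close>

lemma weber_exp_U:
  assumes "a * d - b * c = 1" "even c"
  shows "[weber_exp (a + 2 * b) b (c + 2 * d) d = weber_exp a b c d + 1] (mod 24)"
proof -
  obtain e where c: "c = 2 * e" using assms(2) by (elim evenE)
  have "odd d" using assms by (metis dvd_diff dvd_mult odd_one)
  then obtain x where d: "d = 2 * x + 1" by (elim oddE)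
  have s: "c div 2 = e" "(c + 2 * d) div 2 = e + d" by (simp_all add: c)
  have ad: "b * e * 2 = a * d - 1" using assms by (simp add: c)
  have "weber_exp (a + 2 * b) b (c + 2 * d) d - (weber_exp a b c d + 1)
      = (b * e * 2) * (2 * d * d - 1) + 2 * b * d * d * d + 2 * d * d - a * d - 2 * b * d - 1"
    unfolding weber_exp_def s by (simp add: algebra_simps)
  also have "\<dots> = 2 * (d * (d * d - 1)) * (a + b)"
    unfolding ad by (simp add: algebra_simps)
  finally have eq: "weber_exp (a + 2 * b) b (c + 2 * d) d - (weber_exp a b c d + 1)
      = 2 * (d * (d * d - 1)) * (a + b)" .
  have "3 dvd d * (d * d - 1)"
  proof -
    consider f where "d = 3 * f" | f where "d = 3 * f + 1" | f where "d = 3 * f + 2"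
      by (rule int_cases_mod_3)
    thus ?thesis
    proof cases
      case 2
      have "d * d - 1 = 3 * (3 * f * f + 2 * f)" unfolding 2 by (simp add: algebra_simps)
      thus ?thesis by simp
    next
      case 3
      have "d * d - 1 = 3 * (3 * f * f + 4 * f + 1)" unfolding 3 by (simp add: algebra_simps)
      thus ?thesis by simp
    qed simp
  qed
  moreover have "8 dvd 2 * (d * (d * d - 1))"
  proof -
    have "2 * (d * (d * d - 1)) = 8 * (d * (x * x + x))" unfolding d by (simp add: algebra_simps)
    thus ?thesis by (simp only: dvd_triv_left)
  qed
  ultimately have "24 dvd 2 * (d * (d * d - 1))"
    by (intro dvd_24I) (simp_all only: dvd_mult)
  thus ?thesis by (simp add: cong_iff_dvd_diff eq)
qed

lemma qexp_cong_24:
  assumes "[m = n] (mod 24)"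
  shows "qexp (of_int m / 24) = qexp (of_int n / 24)"
proof -
  from assms obtain k where "n = m + 24 * k" unfolding cong_iff_lin by blast
  hence "of_int n / 24 = of_int m / 24 + (of_int k :: complex)" by simp
  thus ?thesis by (simp only: qexp_add qexp_of_int mult_1_right)
qed

lemma weber2_T_int: "weber2 (\<tau> + of_int n) = qexp (of_int n / 24) * weber2 \<tau>"
  by (simp add: weber2_def qexp_add add_divide_distrib)

text \<open>A formula that has the right value at c = 0 and grows by 1 modulo 24 under both
  generators must be the exponent of the multiplier. For the inverse generators the congruence is
  read from the new matrix back to the old one.\<close>

theorem weber2_moeb:
  assumes "a * d - b * c = 1" "even c" "Im \<tau> > 0"
  shows "weber2 (moeb a b c d \<tau>) = qexp (of_int (weber_exp a b c d) / 24) * weber2 \<tau>"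
  using assms
proof (induction a b c d arbitrary: \<tau> rule: Gamma0_2_induct)
  case (base a b)
  have "weber_exp a b 0 a = a * b" using base by (auto simp: weber_exp_def)
  thus ?case unfolding moeb_base[OF base(1)] weber2_T_int by simp
next
  case (T a b c d)
  have "qexp (of_int (weber_exp a (b + a) c (d + c)) / 24) = qexp (of_int (weber_exp a b c d + 1) / 24)"
    by (rule qexp_cong_24[OF weber_exp_T[OF T.hyps]])
  also have "\<dots> = qexp (of_int (weber_exp a b c d) / 24) * qexp (1/24)"
    by (simp add: qexp_add add_divide_distrib)
  finally show ?case unfolding moeb_T
    using T.IH[of "\<tau> + 1"] T.prems by (simp add: weber2_T)
next
  case (T_inv a b c d)
  have det: "a * (d - c) - (b - a) * c = 1" using T_inv.hyps by (simp add: algebra_simps)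
  have "qexp (of_int (weber_exp a b c d) / 24) = qexp (of_int (weber_exp a (b - a) c (d - c) + 1) / 24)"
    using weber_exp_T[OF det T_inv.hyps(2)] by (intro qexp_cong_24) simp
  also have "\<dots> = qexp (of_int (weber_exp a (b - a) c (d - c)) / 24) * qexp (1/24)"
    by (simp add: qexp_add add_divide_distrib)
  finally show ?case unfolding moeb_T
    using T_inv.IH[of "\<tau> - 1"] T_inv.prems weber2_T[of "\<tau> - 1"] by simp
next
  case (U a b c d)
  note u = U_eq[OF U.prems]
  have "qexp (of_int (weber_exp (a + 2 * b) b (c + 2 * d) d) / 24) = qexp (of_int (weber_exp a b c d + 1) / 24)"
    by (rule qexp_cong_24[OF weber_exp_U[OF U.hyps]])
  also have "\<dots> = qexp (of_int (weber_exp a b c d) / 24) * qexp (1/24)"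
    by (simp add: qexp_add add_divide_distrib)
  finally show ?case unfolding moeb_U[OF u(2)] U.IH[OF u(3)] weber2_U[OF U.prems] by simp
next
  case (U_inv a b c d)
  note u = U_inv_eq[OF U_inv.prems]
  have det: "(a - 2 * b) * d - b * (c - 2 * d) = 1" "even (c - 2 * d)" using U_inv.hyps by (simp_all add: algebra_simps)
  have "qexp (of_int (weber_exp a b c d) / 24) = qexp (of_int (weber_exp (a - 2 * b) b (c - 2 * d) d + 1) / 24)"
    using weber_exp_U[OF det] by (intro qexp_cong_24) simp
  also have "\<dots> = qexp (of_int (weber_exp (a - 2 * b) b (c - 2 * d) d) / 24) * qexp (1/24)"
    by (simp add: qexp_add add_divide_distrib)
  finally show ?case unfolding moeb_U_inv[OF u(3)] U_inv.IH[OF u(1)]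
    using weber2_U[OF u(1), unfolded u(2)] by simp
qed

section \<open>Invariance of the Nahm sums\<close>

text \<open>The middle factors \<open>(weber2 (5 * \<tau>))\<^sup>2\<close> and
  \<open>klein (1/2) 0 (10 * \<tau>)\<close> serve to cancel the square of (q^10; q^10)_\<infinity>
  in the denominator of the last Klein form, and they balance its weight.\<close>

definition nahm_fun :: "int \<Rightarrow> complex \<Rightarrow> complex" where
  "nahm_fun s \<tau> = weber2 \<tau> * (weber2 (5 * \<tau>))\<^sup>2 * klein (1/2) 0 (10 * \<tau>) / klein (of_int s / 5) 0 (10 * \<tau>)"

lemma moeb_scale:
  assumes "n \<noteq> 0"
  shows "of_int n * moeb a b (n * c) d \<tau> = moeb a (n * b) c d (of_int n * \<tau>)"
  by (simp add: moeb_def algebra_simps)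

text \<open>Under these congruences every summand of \<open>weber_exp\<close> is a multiple of 24;
  the 48 in c is for the summand a * (c div 2).\<close>

lemma weber2_invariant:
  assumes "a * d - b * c = 1" "Im \<tau> > 0"
    and b: "b = 24 * b'" and c: "c = 48 * c'" and d: "d = 1 + 48 * d'"
  shows "weber2 (moeb a b c d \<tau>) = weber2 \<tau>"
proof -
  have s: "(d * d - 1) div 2 = 48 * d' + 1152 * d' * d'" "c div 2 = 24 * c'"
    by (simp_all add: c d algebra_simps)
  have "weber_exp a b c d = 24 * (3 * (2 * d' + 48 * d' * d') + b' * d * (1 + 2 * (c div 2) * (c div 2)) + 2 * c' * d - a * c')"
    unfolding weber_exp_def s b by (simp add: algebra_simps)
  hence "[weber_exp a b c d = 0] (mod 24)" by (simp add: cong_0_iff)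
  from qexp_cong_24[OF this] show ?thesis
    using weber2_moeb[OF assms(1) _ assms(2)] c by simp
qed

lemma nahm_fun_invariant:
  assumes det: "a * d - b * c = 1" and \<tau>: "Im \<tau> > 0"
    and a: "a = 1 + 28800 * l" and c: "c = 28800 * k" and d: "d = 1 + 28800 * m"
  shows "nahm_fun s (120 * moeb a b c d \<tau>) = nahm_fun s (120 * \<tau>)"
proof -
  have sc: "of_int n * moeb a b c d \<tau> = moeb a (n * b) c' d (of_int n * \<tau>)"
    "a * d - (n * b) * c' = 1" if "n * c' = c" "n \<noteq> 0" for n c'
    using moeb_scale[OF that(2), of a b c' d \<tau>] det that by (simp_all add: algebra_simps)
  \<comment> \<open>120, 5 * 120 and 10 * 120 are the scalings of \<tau> in
    \<open>nahm_fun s (120 * \<tau>)\<close>. Scaling by n divides the lower left entry by n, which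
    leaves 240 k, 48 k and 24 k.\<close>
  have e: "120 * (240 * k) = c" "600 * (48 * k) = c" "1200 * (24 * k) = c" by (simp_all add: c)
  have n: "(120::int) \<noteq> 0" "(600::int) \<noteq> 0" "(1200::int) \<noteq> 0" by simp_all
  have p: "Im (of_int 120 * \<tau>) > 0" "Im (of_int 600 * \<tau>) > 0" "Im (of_int 1200 * \<tau>) > 0" using \<tau> by simp_all
  have "weber2 (of_int 120 * moeb a b c d \<tau>) = weber2 (of_int 120 * \<tau>)"
    unfolding sc(1)[OF e(1) n(1)]
    by (rule weber2_invariant[OF sc(2)[OF e(1) n(1)] p(1), of "5 * b" "5 * k" "600 * m"]) (simp_all add: d)
  hence w1: "weber2 (120 * moeb a b c d \<tau>) = weber2 (120 * \<tau>)" by simp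
  have "weber2 (of_int 600 * moeb a b c d \<tau>) = weber2 (of_int 600 * \<tau>)"
    unfolding sc(1)[OF e(2) n(2)]
    by (rule weber2_invariant[OF sc(2)[OF e(2) n(2)] p(2), of "25 * b" k "600 * m"]) (simp_all add: d)
  hence w2: "weber2 (600 * moeb a b c d \<tau>) = weber2 (600 * \<tau>)" by simp
  define D where "D = of_int (24 * k) * (1200 * \<tau>) + (of_int d :: complex)"
  have \<tau>': "Im (1200 * \<tau>) > 0" using \<tau> by simp
  have D: "D \<noteq> 0"
    unfolding D_def by (rule moeb_denom_nonzero[OF \<tau>' sc(2)[OF e(3) n(3)]])
  have kl: "klein u 0 (1200 * moeb a b c d \<tau>) = klein (u * of_int a) (u * of_int (1200 * b)) (1200 * \<tau>) / D" for u
  proof -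
    have "klein u 0 (of_int 1200 * moeb a b c d \<tau>) = klein (u * of_int a + 0 * of_int (24 * k))
        (u * of_int (1200 * b) + 0 * of_int d) (of_int 1200 * \<tau>) / (of_int (24 * k) * (of_int 1200 * \<tau>) + of_int d)"
      unfolding sc(1)[OF e(3) n(3)]
      by (rule klein_moeb[OF sc(2)[OF e(3) n(3)] _ p(3)]) simp
    thus ?thesis by (simp add: D_def)
  qed
  have k1: "klein (1/2) 0 (1200 * moeb a b c d \<tau>) = klein (1/2) 0 (1200 * \<tau>) / D"
  proof -
    \<comment> \<open>Both components of the index (1/2, 0) move by even integers, and the
      exponential factors that this produces have integral arguments.\<close>
    have "1/2 * of_int a = 1/2 + 2 * (of_int (7200 * l) :: complex)"
      "1/2 * of_int (1200 * b) = 0 + 2 * (of_int (300 * b) :: complex)"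
      by (simp_all add: a)
    moreover have "qexp (of_int (300 * b) * (1/2 + 2 * of_int (7200 * l))) = qexp (of_int (150 * b + 300 * b * (2 * (7200 * l))))"
      by (rule arg_cong[of _ _ qexp]) (simp add: algebra_simps)
    ultimately show ?thesis
      unfolding kl by (simp only: klein_add_even_left[OF \<tau>'] klein_add_even_right qexp_of_int
          mult_zero_right minus_zero qexp_0 mult_1_left)
  qed
  have k2: "klein (of_int s / 5) 0 (1200 * moeb a b c d \<tau>) = klein (of_int s / 5) 0 (1200 * \<tau>) / D"
  proof -
    have "of_int s / 5 * of_int a = of_int s / 5 + 2 * (of_int (2880 * s * l) :: complex)"
      "of_int s / 5 * of_int (1200 * b) = 0 + 2 * (of_int (120 * s * b) :: complex)"
      by (simp_all add: a field_simps)
    moreover have "qexp (of_int (120 * s * b) * (of_int s / 5 + 2 * of_int (2880 * s * l))) = qexp (of_int (24 * s * s * b + 120 * s * b * (2 * (2880 * s * l))))"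
      by (rule arg_cong[of _ _ qexp]) (simp add: algebra_simps)
    ultimately show ?thesis
      unfolding kl by (simp only: klein_add_even_left[OF \<tau>'] klein_add_even_right qexp_of_int
          mult_zero_right minus_zero qexp_0 mult_1_left)
  qed
  show ?thesis
    using D by (simp add: nahm_fun_def w1 w2 k1 k2)
qed

lemma nahm_fun_product:
  assumes \<tau>: "Im \<tau> > 0"
  defines "q \<equiv> qexp \<tau>"
  shows "nahm_fun 1 \<tau> = qexp (\<tau> / 120) * (qpochs_inf [q^4, q^6, q^10] (q^10) / qpoch_inf q q)"
    and "nahm_fun 2 \<tau> = qexp (49 * \<tau> / 120) * (qpochs_inf [q^2, q^8, q^10] (q^10) / qpoch_inf q q)"
proof -
  have q: "norm q < 1" unfolding q_def by (rule norm_qexp_less_1[OF \<tau>])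
  have pw: "norm (q ^ n) < 1" if "n > 0" for n
    using q that by (simp add: norm_power power_less_one_iff)
  have nz: "qpoch_inf (q ^ n) (q ^ m) \<noteq> 0" if "n > 0" "m > 0" for n m
    using pw that by (intro qpoch_inf_nonzero)
  have \<tau>': "Im (10 * \<tau>) > 0" "Im (5 * \<tau>) > 0" using \<tau> by simp_all
  define D where "D = (qpoch_inf (q ^ 10) (q ^ 10))\<^sup>2"
  define E where "E = qpoch_inf (- q) q"
  define P where "P = (\<lambda>n. qpoch_inf (q ^ n) (q ^ 10))"
  have e: "qexp (of_nat n * \<tau>) = q ^ n" for n by (simp add: q_def qexp_power)
  \<comment> \<open>Here u = n / 10 and x = n (n - 10) / 20; n = 5, 2, 4 give the exponents -5/4,
    -4/5, -6/5 used below.\<close>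
  have kl: "klein u 0 (10 * \<tau>) = - qexp (x * \<tau>) * P n * P (10 - n) / D"
    if "u * 10 = of_nat n" "n \<le> 10" "x = u * of_nat n / 2 - of_nat n / 2" for u x n
  proof -
    have z: "u * (10 * \<tau>) + 0 = of_nat n * \<tau>" using that(1) by (simp add: mult.assoc[symmetric])
    have "10 * \<tau> - of_nat n * \<tau> = of_nat (10 - n) * \<tau>"
      using that(2) by (simp add: of_nat_diff algebra_simps)
    moreover have "u * (of_nat n * \<tau>) / 2 - of_nat n * \<tau> / 2 = x * \<tau>"
      unfolding that(3) by (simp add: algebra_simps)
    moreover have "qexp (10 * \<tau>) = q ^ 10" using e[of 10] by simp
    ultimately show ?thesis
      using klein_product[OF \<tau>'(1), of u 0] unfolding z by (simp add: e D_def P_def)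
  qed
  have kh: "klein (1/2) 0 (10 * \<tau>) = - qexp (- 5/4 * \<tau>) * P 5 * P 5 / D"
    using kl[of "1/2" 5 "- 5/4"] by simp
  have k1: "klein (1/5) 0 (10 * \<tau>) = - qexp (- 4/5 * \<tau>) * P 2 * P 8 / D"
    using kl[of "1/5" 2 "- 4/5"] by simp
  have k2: "klein (2/5) 0 (10 * \<tau>) = - qexp (- 6/5 * \<tau>) * P 4 * P 6 / D"
    using kl[of "2/5" 4 "- 6/5"] by simp
  have "norm (q ^ 5) < 1" by (rule pw) simp
  from euler_odd_distinct[OF this]
  have w5: "weber2 (5 * \<tau>) = qexp (5/24 * \<tau>) / P 5"
    using nz[of 5 10] e[of 5]
    by (simp add: weber2_def P_def power_mult[symmetric] field_simps)
  have w1: "weber2 \<tau> = qexp (1/24 * \<tau>) * E" by (simp add: weber2_def E_def q_def)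
  have "qpoch_inf (q\<^sup>2) (q\<^sup>2) = P 2 * P 4 * P 6 * P 8 * P 10"
    using qpoch_inf_dissect[of "q\<^sup>2" 5 "q\<^sup>2"] pw[of 2]
    by (simp add: eval_nat_numeral P_def mult_ac)
  hence qq: "qpoch_inf q q * E = P 2 * P 4 * P 6 * P 8 * P 10"
    using qpoch_inf_mult_uminus[OF q, of q] by (simp add: E_def)
  have E: "E \<noteq> 0" using q by (simp add: E_def qpoch_inf_nonzero)
  have Pnz: "P n \<noteq> 0" if "n > 0" for n unfolding P_def using that by (intro nz) auto
  have D: "D \<noteq> 0" using nz[of 10 10] by (simp add: D_def)
  \<comment> \<open>The total exponent of the numerator is 1/24 + 2 * 5/24 - 5/4 = -19/24. The
    exponent y of the Klein form in the denominator is taken off, and the remaining x is C: 1/120 -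
    4/5 and 49/120 - 6/5 both equal -19/24.\<close>
  have ex: "qexp (1/24 * \<tau>) * (qexp (5/24 * \<tau>))\<^sup>2 * qexp (- 5/4 * \<tau>) = qexp (x * \<tau>) * qexp (y * \<tau>)"
    if "x + y = - 19/24" for x y
  proof -
    have "qexp (1/24 * \<tau>) * (qexp (5/24 * \<tau>))\<^sup>2 * qexp (- 5/4 * \<tau>) = qexp ((- 19/24) * \<tau>)"
      unfolding qexp_power qexp_add[symmetric] by (rule arg_cong[of _ _ qexp]) (simp add: algebra_simps)
    thus ?thesis unfolding that[symmetric] by (simp add: qexp_add distrib_right)
  qed
  have "qpoch_inf q q \<noteq> 0" by (rule qpoch_inf_nonzero[OF q q])
  \<comment> \<open>All even residues modulo 10 appear in the numerator, so dividing by one pair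
    \<open>P n * P (10 - n)\<close> leaves the complementary pair and \<open>P 10\<close>.\<close>
  hence inv: "E = P 2 * P 4 * P 6 * P 8 * P 10 / qpoch_inf q q"
    unfolding qq[symmetric] by simp
  have num: "weber2 \<tau> * (weber2 (5 * \<tau>))\<^sup>2 * klein (1/2) 0 (10 * \<tau>)
      = - (qexp (1/24 * \<tau>) * (qexp (5/24 * \<tau>))\<^sup>2 * qexp (- 5/4 * \<tau>)) * E / D"
    unfolding w1 w5 kh using Pnz[of 5] by (simp add: power2_eq_square)
  have "nahm_fun 1 \<tau> = qexp (1/120 * \<tau>) * E / (P 2 * P 8)"
    unfolding nahm_fun_def num using ex[of "1/120" "- 4/5"] k1 D by simp
  thus "nahm_fun 1 \<tau> = qexp (\<tau> / 120) * (qpochs_inf [q^4, q^6, q^10] (q^10) / qpoch_inf q q)"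
    unfolding inv using Pnz[of 2] Pnz[of 8] by (simp add: qpochs_inf_def P_def)
  have "nahm_fun 2 \<tau> = qexp (49/120 * \<tau>) * E / (P 4 * P 6)"
    unfolding nahm_fun_def num using ex[of "49/120" "- 6/5"] k2 D by simp
  thus "nahm_fun 2 \<tau> = qexp (49 * \<tau> / 120) * (qpochs_inf [q^2, q^8, q^10] (q^10) / qpoch_inf q q)"
    unfolding inv using Pnz[of 4] Pnz[of 6] by (simp add: qpochs_inf_def P_def)
qed

section \<open>Growth and meromorphy at the cusps\<close>

text \<open>
  Estimating factor by factor only yields $\exp (r/(1-r)^2)$, too weak at the cusps.  The gain comes
  from iterating $(q;q)_\infty (-q;q)_\infty = (q^2;q^2)_\infty$.
\<close>

lemma norm_inverse_qpoch_inf_le: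
  assumes "norm q < 1"
  shows "norm (inverse (qpoch_inf q q)) \<le> exp (2 * (norm q / (1 - norm q)))"
proof -
  define L where "L = (\<lambda>x. norm (inverse (qpoch_inf x x)))"
  have step: "L x \<le> exp (norm x / (1 - norm x)) * L (x\<^sup>2)" if x: "norm x < 1" for x
  proof -
    have "qpoch_inf x x \<noteq> 0" "qpoch_inf (- x) x \<noteq> 0" using x by (simp_all add: qpoch_inf_nonzero)
    hence "inverse (qpoch_inf x x) = qpoch_inf (- x) x * inverse (qpoch_inf (x\<^sup>2) (x\<^sup>2))"
      using qpoch_inf_mult_uminus[OF x, of x, symmetric] by (simp add: field_simps)
    thus ?thesis
      unfolding L_def using norm_qpoch_inf_le[OF x, of "- x"] by (simp add: norm_mult mult_right_mono)
  qed
  have bound: "L x \<le> exp (2 * (norm x / (1 - norm x))) * L (x ^ (2 ^ n))" if "norm x < 1" for x n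
    using that
  proof (induction n arbitrary: x)
    case 0
    hence "1 * L x \<le> exp (2 * (norm x / (1 - norm x))) * L x"
      by (intro mult_right_mono) (auto simp: L_def)
    thus ?case by simp
  next
    case (Suc n)
    define r where "r = norm x"
    have r: "0 \<le> r" "r < 1" using Suc.prems by (simp_all add: r_def)
    have r2: "norm (x\<^sup>2) < 1" using Suc.prems by (simp add: norm_power power_less_one_iff)
    \<comment> \<open>Writing h(r) = r / (1 - r), this is 2 h(r^2) \<le> h(r). It keeps the constant
      2 stable in the induction: h(r) + 2 h(r^2) \<le> 2 h(r).\<close>
    have "2 * (r\<^sup>2 / (1 - r\<^sup>2)) \<le> r / (1 - r)"
    proof -
      have "r\<^sup>2 / (1 - r\<^sup>2) = r / (1 - r) * (r / (1 + r))"
      proof -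
        have "1 - r\<^sup>2 = (1 - r) * (1 + r)" by (simp add: power2_eq_square algebra_simps)
        thus ?thesis by (simp add: power2_eq_square)
      qed
      also have "\<dots> \<le> r / (1 - r) * (1 / 2)"
        using r by (intro mult_left_mono) (auto simp: field_simps)
      finally have "r\<^sup>2 / (1 - r\<^sup>2) \<le> r / (1 - r) * (1 / 2)" .
      hence "2 * A \<le> B" if "A = r\<^sup>2 / (1 - r\<^sup>2)" "B = r / (1 - r)" for A B
        unfolding that[symmetric] by simp
      thus ?thesis by blast
    qed
    hence "L x \<le> exp (r / (1 - r)) * (exp (r / (1 - r)) * L ((x\<^sup>2) ^ (2 ^ n)))"
      using step[OF Suc.prems] Suc.IH[OF r2]
      unfolding r_def[symmetric] norm_power
      by (smt (verit) L_def exp_ge_zero exp_le_cancel_iff mult_left_mono mult_right_mono norm_ge_zero)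
    thus ?case by (simp add: r_def exp_add[symmetric] mult.assoc[symmetric] power_mult[symmetric])
  qed
  have "(\<lambda>n. q ^ (2 ^ n)) \<longlonglongrightarrow> 0"
    using assms LIMSEQ_power_zero[of q] by (intro filterlim_compose[OF LIMSEQ_power_zero]) (auto intro: filterlim_at_top_mono[OF filterlim_ident] simp: less_imp_le)
  moreover have "isCont (\<lambda>x. inverse (qpoch_inf x x)) 0"
  proof -
    have "(\<lambda>x. inverse (qpoch_inf x x)) holomorphic_on ball 0 1"
      by (intro holomorphic_intros open_ball) (auto simp: qpoch_inf_nonzero)
    thus ?thesis
      by (meson centre_in_ball continuous_on_eq_continuous_at holomorphic_on_imp_continuous_on open_ball zero_less_one)
  qed
  ultimately have "(\<lambda>n. L (q ^ (2 ^ n))) \<longlonglongrightarrow> L 0"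
    unfolding L_def by (intro tendsto_norm) (rule isCont_tendsto_compose)
  hence "(\<lambda>n. exp (2 * (norm q / (1 - norm q))) * L (q ^ (2 ^ n))) \<longlonglongrightarrow> exp (2 * (norm q / (1 - norm q))) * 1"
    by (intro tendsto_mult tendsto_const) (simp add: L_def)
  from LIMSEQ_le_const[OF this] show ?thesis
    using bound[OF assms] by (auto simp: L_def)
qed

text \<open>Periodicity makes f a function g of the local parameter w on the punctured disc, and the
  growth bound becomes a bound by a power of 1 / |w|. The bound is asked for on a vertical strip,
  which is where the principal logarithm of w lands; a growth constant may therefore depend on the
  width of the strip.\<close>

lemma meromorphic_at_ii_inf_growth:
  assumes hol: "f holomorphic_on upper_half_plane" and N: "N > 0"
    and period: "\<And>\<tau>. Im \<tau> > 0 \<Longrightarrow> f (\<tau> + of_nat N) = f \<tau>"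
    and growth: "\<And>\<tau>. Im \<tau> \<ge> 1 \<Longrightarrow> \<bar>Re \<tau>\<bar> \<le> real N \<Longrightarrow> norm (f \<tau>) \<le> exp (M * Im \<tau>)" and M: "M \<ge> 0"
  shows "meromorphic_at_ii_inf f"
proof -
  define k where "k = 2 * of_real pi * \<i> / of_nat N"
  have k: "k \<noteq> 0" using N by (simp add: k_def)
  define g where "g = (\<lambda>w. f (Ln w / k))"
  have Im_k: "Im (x / k) = - real N * Re x / (2 * pi)" "Re (x / k) = real N * Im x / (2 * pi)" for x
  proof -
    have "x / k = of_real (real N / (2 * pi)) * (- \<i> * x)"
      using N by (simp add: k_def field_simps)
    thus "Im (x / k) = - real N * Re x / (2 * pi)" "Re (x / k) = real N * Im x / (2 * pi)" by simp_all
  qed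
  have period': "f (\<tau> + of_int n * of_nat N) = f \<tau>" if "Im \<tau> > 0" for \<tau> n
  proof -
    \<comment> \<open>The period is known in the upper half-plane only; extension by 0 gives a
      function on the whole plane to which \<open>periodic_int\<close> applies.\<close>
    have "(if Im (\<tau> + of_int n * of_nat N) > 0 then f (\<tau> + of_int n * of_nat N) else 0) = (if Im \<tau> > 0 then f \<tau> else 0)"
      by (rule periodic_int[of "\<lambda>\<tau>. if Im \<tau> > 0 then f \<tau> else 0"]) (use period in auto)
    thus ?thesis using that by simp
  qed
  have g_exp: "g (exp l) = f (l / k)" if l: "Re l < 0" for l
  proof -
    have "exp (Ln (exp l)) = exp l" by simp
    then obtain n :: int where "Ln (exp l) = l + of_int (2 * n) * of_real pi * \<i>"
      unfolding exp_eq by auto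
    hence "Ln (exp l) / k = l / k + of_int n * of_nat N"
      using N by (simp add: k_def field_simps)
    moreover have "Im (l / k) > 0" using l N by (simp add: Im_k mult_less_0_iff field_simps)
    ultimately show ?thesis using period' by (simp add: g_def)
  qed
  have g_hol: "g holomorphic_on ball 0 1 - {0}"
  proof (rule analytic_imp_holomorphic, unfold analytic_on_def, intro ballI)
    fix w :: complex assume w: "w \<in> ball 0 1 - {0}"
    \<comment> \<open>On this half-plane around w the branch Ln (z / w) + Ln w is holomorphic, also
      when w lies on the cut of \<open>Ln\<close>; by \<open>g_exp\<close> it computes the same
      g.\<close>
    define S where "S = {z. Re (z / w) > 0} \<inter> ball 0 1"
    have "open S" unfolding S_def
      using w by (intro open_Int open_ball open_Collect_less continuous_intros) auto
    moreover have "w \<in> S" using w by (simp add: S_def)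
    ultimately obtain e where e: "e > 0" "ball w e \<subseteq> S" by (meson openE)
    have S: "exp (Ln (z / w) + Ln w) = z" "Re (Ln (z / w) + Ln w) < 0" if "z \<in> S" for z
    proof -
      have z: "z \<noteq> 0" "norm z < 1" using that by (auto simp: S_def)
      show 1: "exp (Ln (z / w) + Ln w) = z" using z w by (simp add: exp_add)
      have "exp (Re (Ln (z / w) + Ln w)) < 1" using z(2) 1 by (metis norm_exp_eq_Re)
      thus "Re (Ln (z / w) + Ln w) < 0" by simp
    qed
    have "(f \<circ> (\<lambda>z. (Ln (z / w) + Ln w) / k)) holomorphic_on S"
    proof (rule holomorphic_on_compose_gen[OF _ hol])
      show "(\<lambda>z. (Ln (z / w) + Ln w) / k) holomorphic_on S"
        using w k by (intro holomorphic_intros) (auto simp: S_def complex_nonpos_Reals_iff)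
      show "(\<lambda>z. (Ln (z / w) + Ln w) / k) ` S \<subseteq> upper_half_plane"
        using S(2) N by (auto simp: upper_half_plane_def Im_k mult_less_0_iff field_simps simp del: plus_complex.simps)
    qed
    hence "g holomorphic_on S"
      by (rule holomorphic_transform) (use S g_exp in \<open>metis comp_apply\<close>)
    thus "\<exists>e>0. g holomorphic_on ball w e" using e holomorphic_on_subset by blast
  qed
  \<comment> \<open>With |w| = exp (- 2 \<pi> Im \<tau> / N) the bound exp (M Im \<tau>) is |w| to
    the power - M N / (2 \<pi>), and \<open>m\<close> majorises that order. Likewise |w| <
    \<open>\<delta>\<close> yields Im \<tau> \<ge> 1.\<close>
  obtain m :: nat where m: "M * real N / (2 * pi) \<le> real m" using real_arch_simple by blast
  define \<delta> where "\<delta> = exp (- 2 * pi / real N)"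
  have bnd: "norm (g w * w ^ m) \<le> 1" if w: "w \<noteq> 0" "norm w < \<delta>" for w
  proof -
    define \<tau> where "\<tau> = Ln w / k"
    have lnw: "ln (norm w) < - 2 * pi / real N"
      using w unfolding \<delta>_def by (metis exp_less_cancel_iff exp_ln zero_less_norm_iff)
    have Im: "Im \<tau> = - real N * ln (norm w) / (2 * pi)" using w by (simp add: \<tau>_def Im_k)
    have "Im \<tau> \<ge> 1" unfolding Im using lnw N by (simp add: field_simps)
    moreover have "\<bar>Re \<tau>\<bar> \<le> real N"
    proof -
      have "\<bar>Im (Ln w)\<bar> \<le> pi" using w mpi_less_Im_Ln[of w] Im_Ln_le_pi[of w] by auto
      hence "real N * \<bar>Im (Ln w)\<bar> \<le> real N * (2 * pi)" by (intro mult_left_mono) auto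
      thus ?thesis by (simp add: \<tau>_def Im_k abs_mult field_simps)
    qed
    ultimately have "norm (f \<tau>) \<le> exp (M * Im \<tau>)" by (rule growth)
    also have "M * Im \<tau> = (M * real N / (2 * pi)) * (- ln (norm w))" unfolding Im by simp
    also have "\<dots> \<le> real m * (- ln (norm w))"
    proof (intro mult_right_mono m)
      have "- 2 * pi / real N < 0" using N by (simp add: divide_neg_pos)
      with lnw have "ln (norm w) < 0" by linarith
      thus "- ln (norm w) \<ge> 0" by simp
    qed
    also have "exp (real m * (- ln (norm w))) = inverse (norm w ^ m)"
      using w by (simp add: exp_minus exp_of_nat_mult)
    finally have "norm (g w) \<le> inverse (norm w ^ m)" by (simp add: g_def \<tau>_def)
    thus ?thesis using w by (simp add: norm_mult norm_power field_simps)
  qed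
  have "eventually (\<lambda>w. norm (g w * w ^ m) \<le> 1) (at 0)"
    unfolding eventually_at by (rule exI[of _ \<delta>]) (use bnd in \<open>auto simp: \<delta>_def\<close>)
  moreover have "(\<lambda>w. g w * w ^ m) holomorphic_on ball 0 1 - {0}"
    by (intro holomorphic_intros g_hol)
  ultimately obtain F where F: "F holomorphic_on ball 0 1" "\<And>w. w \<in> ball 0 1 - {0} \<Longrightarrow> F w = g w * w ^ m"
    using holomorphic_on_extend_bounded[of "\<lambda>w. g w * w ^ m" "ball 0 1" 0] by (auto simp: interior_open)
  have "(\<lambda>w. F w / w ^ m) meromorphic_on {0}"
  proof (intro meromorphic_intros)
    have "F analytic_on {0}"
      using F(1) by (intro holomorphic_on_imp_analytic_at[of F "ball 0 1"]) auto
    thus "F meromorphic_on {0}" by (rule analytic_on_imp_meromorphic_on)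
  qed
  moreover have "eventually (\<lambda>w. F w / w ^ m = g w) (at 0)"
    unfolding eventually_at by (rule exI[of _ 1]) (use F(2) in auto)
  ultimately have "g meromorphic_on {0}"
    by (subst meromorphic_on_cong[of _ g "\<lambda>w. F w / w ^ m"]) (auto simp: eq_commute)
  moreover have "f \<tau> = g (exp (2 * of_real pi * \<i> * \<tau> / of_nat N))" if "Im \<tau> > 0" for \<tau>
    using g_exp[of "k * \<tau>"] that k N by (simp add: k_def divide_less_0_iff)
  ultimately show ?thesis
    unfolding meromorphic_at_ii_inf_def using N by blast
qed

section \<open>Modularity\<close>

lemma Im_moeb:
  assumes "Im \<tau> > 0" "a * d - b * c = 1"
  shows "Im (moeb a b c d \<tau>) = Im \<tau> / (norm (of_int c * \<tau> + of_int d))\<^sup>2"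
proof -
  have "Im (moeb a b c d \<tau>) = Im ((of_int a * \<tau> + of_int b) * cnj (of_int c * \<tau> + of_int d))
      / (norm (of_int c * \<tau> + of_int d))\<^sup>2"
    unfolding moeb_def by (subst complex_div_cnj) (simp flip: of_real_power)
  also have "Im ((of_int a * \<tau> + of_int b) * cnj (of_int c * \<tau> + of_int d)) = of_int (a * d - b * c) * Im \<tau>"
    by (simp add: algebra_simps)
  finally show ?thesis by (simp add: assms(2))
qed

text \<open>The matrix on the right is the conjugate of translation by n under (a, b; c, d). For n =
  28800 it lies in the group, so f composed with any element of SL2(Z) has period 28800.\<close>

lemma moeb_conj_T:
  assumes "Im \<tau> > 0" "a * d - b * c = 1"
  shows "moeb a b c d (\<tau> + of_int n)
    = moeb (1 - n * a * c) (n * a * a) (- (n * c * c)) (1 + n * a * c) (moeb a b c d \<tau>)"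
proof -
  define w where "w = of_int c * \<tau> + (of_int d :: complex)"
  define u where "u = of_int a * \<tau> + (of_int b :: complex)"
  have w: "w \<noteq> 0" unfolding w_def by (rule moeb_denom_nonzero[OF assms])
  have det: "of_int a * w - of_int c * u = 1"
  proof -
    have "of_int a * w - of_int c * u = of_int (a * d - b * c)" by (simp add: u_def w_def algebra_simps)
    thus ?thesis by (simp add: assms(2))
  qed
  have "of_int (1 - n * a * c) * (u / w) + of_int (n * a * a) = (u + of_int n * of_int a * (of_int a * w - of_int c * u)) / w"
    "of_int (- (n * c * c)) * (u / w) + of_int (1 + n * a * c) = (w + of_int n * of_int c * (of_int a * w - of_int c * u)) / w"
    using w by (simp_all add: field_simps)
  hence "moeb (1 - n * a * c) (n * a * a) (- (n * c * c)) (1 + n * a * c) (u / w)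
      = (u + of_int n * of_int a) / (w + of_int n * of_int c)"
    unfolding det moeb_def using w by simp
  thus ?thesis by (simp add: moeb_def u_def w_def algebra_simps)
qed

definition qprod :: "complex \<Rightarrow> nat \<Rightarrow> nat \<Rightarrow> complex \<Rightarrow> complex" where
  "qprod x m n \<tau> = qexp (x * \<tau>) *
     (qpochs_inf [qexp \<tau> ^ m, qexp \<tau> ^ n, qexp \<tau> ^ 10] (qexp \<tau> ^ 10) / qpoch_inf (qexp \<tau>) (qexp \<tau>))"

lemma holomorphic_qprod: "qprod x m n holomorphic_on upper_half_plane"
proof -
  have "(\<lambda>\<tau>. qexp (x * \<tau>) *
     (qpoch_inf (qexp \<tau> ^ m) (qexp \<tau> ^ 10) * (qpoch_inf (qexp \<tau> ^ n) (qexp \<tau> ^ 10) * qpoch_inf (qexp \<tau> ^ 10) (qexp \<tau> ^ 10))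
     / qpoch_inf (qexp \<tau>) (qexp \<tau>))) holomorphic_on upper_half_plane"
    by (intro holomorphic_intros open_upper_half_plane)
       (auto simp: upper_half_plane_def norm_qexp_less_1 norm_power power_less_one_iff)
  thus ?thesis by (simp add: qprod_def[abs_def] qpochs_inf_def)
qed

text \<open>With \<phi> = r / (1 - r) and r = |q|, each of the three products in the numerator costs
  exp \<phi> and the inverse of (q; q)_\<infinity> costs exp (2 \<phi>), together exp (5
  \<phi>).\<close>

lemma norm_qprod_le:
  assumes \<tau>: "Im \<tau> > 0" and "m > 0" "n > 0" "x \<ge> 0"
  shows "norm (qprod (of_real x) m n \<tau>) \<le> exp (1 / Im \<tau>)"
proof -
  define q where "q = qexp \<tau>"
  define r where "r = norm q"
  have q: "norm q < 1" unfolding q_def by (rule norm_qexp_less_1[OF \<tau>])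
  have r: "0 < r" "r < 1" using q by (simp_all add: r_def q_def)
  define \<phi> where "\<phi> = r / (1 - r)"
  have P: "norm (qpoch_inf (q ^ k) (q ^ 10)) \<le> exp \<phi>" if "k > 0" for k
  proof -
    have "norm (q ^ 10) < 1" using q by (simp add: norm_power power_less_one_iff)
    hence "norm (qpoch_inf (q ^ k) (q ^ 10)) \<le> exp (r ^ k / (1 - r ^ 10))"
      using norm_qpoch_inf_le[of "q ^ 10" "q ^ k"] by (simp add: norm_power r_def)
    also have "r ^ k / (1 - r ^ 10) \<le> r / (1 - r)"
      using r that power_decreasing[of 1 k r] power_decreasing[of 1 10 r] by (intro frac_le) auto
    finally show ?thesis by (simp add: \<phi>_def)
  qed
  have "norm (qexp (of_real x * \<tau>)) \<le> 1" using assms by (simp add: norm_qexp)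
  hence "norm (qprod (of_real x) m n \<tau>) \<le> 1 * ((exp \<phi> * (exp \<phi> * (exp \<phi> * 1))) * exp (2 * \<phi>))"
    unfolding qprod_def q_def[symmetric] qpochs_inf_def divide_inverse norm_mult list.map prod_list.Cons prod_list.Nil norm_one
    using P[of m] P[of n] P[of 10] norm_inverse_qpoch_inf_le[OF q] assms
    by (intro mult_mono) (auto simp: \<phi>_def r_def)
  also have "\<dots> = exp (5 * \<phi>)" by (simp add: exp_add[symmetric])
  \<comment> \<open>\<phi> = 1 / (exp (2 \<pi> Im \<tau>) - 1) is at most 1 / (2 \<pi> Im \<tau>),
    and 5 < 2 \<pi>.\<close>
  also have "5 * \<phi> \<le> 1 / Im \<tau>"
  proof -
    have "r * exp (2 * pi * Im \<tau>) = 1" by (simp add: r_def q_def norm_qexp exp_minus)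
    moreover have "1 + 2 * pi * Im \<tau> \<le> exp (2 * pi * Im \<tau>)" by (rule exp_ge_add_one_self)
    ultimately have "r * (1 + 2 * pi * Im \<tau>) \<le> 1" using r by (metis mult_left_mono less_imp_le)
    moreover have "r * 5 * Im \<tau> \<le> r * (2 * pi) * Im \<tau>"
      using pi_gt3 r \<tau> by (intro mult_right_mono mult_left_mono) auto
    ultimately have "5 * r * Im \<tau> \<le> 1 - r" by (simp add: algebra_simps)
    thus ?thesis using r \<tau> by (simp add: \<phi>_def field_simps)
  qed
  finally show ?thesis by simp
qed

lemma moebius_act_eq: "moebius_act \<gamma> = moeb (\<gamma> $ 1 $ 1) (\<gamma> $ 1 $ 2) (\<gamma> $ 2 $ 1) (\<gamma> $ 2 $ 2)"
  by (simp add: moebius_act_def moeb_def fun_eq_iff)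

theorem modular_function_qprod:
  assumes prod: "\<And>\<tau>. Im \<tau> > 0 \<Longrightarrow> nahm_fun s \<tau> = qprod (of_real x) m n \<tau>"
    and f: "\<And>\<tau>. Im \<tau> > 0 \<Longrightarrow> f \<tau> = nahm_fun s (120 * \<tau>)"
    and mnx: "m > 0" "n > 0" "x \<ge> 0"
  shows "modular_function (Gamma1 28800) f"
proof -
  have f_qprod: "f \<tau> = qprod (of_real x) m n (120 * \<tau>)" if "Im \<tau> > 0" for \<tau>
    using f[OF that] prod[of "120 * \<tau>"] that by simp
  have hol: "f holomorphic_on upper_half_plane"
  proof -
    have "(qprod (of_real x) m n \<circ> (\<lambda>\<tau>. 120 * \<tau>)) holomorphic_on upper_half_plane"
      by (rule holomorphic_on_compose_gen[OF _ holomorphic_qprod])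
         (auto intro!: holomorphic_intros simp: upper_half_plane_def)
    thus ?thesis
      by (rule holomorphic_transform) (simp add: upper_half_plane_def f_qprod)
  qed
  have inv: "f (moeb a b c d \<tau>) = f \<tau>"
    if "a * d - b * c = 1" "a = 1 + 28800 * l" "c = 28800 * k" "d = 1 + 28800 * m'" "Im \<tau> > 0" for a b c d l k m' \<tau>
  proof -
    have "Im (moeb a b c d \<tau>) > 0"
      unfolding Im_moeb[OF that(5,1)] using moeb_denom_nonzero[OF that(5,1)] that(5) by simp
    thus ?thesis using nahm_fun_invariant[OF that(1,5,2,3,4), of s] that(5) by (simp add: f)
  qed
  have cusp: "meromorphic_at_ii_inf (\<lambda>\<tau>. f (moeb a b c d \<tau>))" if det: "a * d - b * c = 1" for a b c d
  proof -
    have pos: "Im (moeb a b c d \<tau>) > 0" if "Im \<tau> > 0" for \<tau>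
      unfolding Im_moeb[OF that det] using moeb_denom_nonzero[OF that det] that by simp
    \<comment> \<open>On the strip |Re \<tau>| \<le> 28800 with Im \<tau> \<ge> 1 one has |\<tau>|
      \<le> 28801 Im \<tau>, hence |c \<tau> + d| \<le> K Im \<tau>. Then 1 / Im of the moved point
      is at most K^2 Im \<tau>.\<close>
    define K where "K = \<bar>of_int c\<bar> * 28801 + \<bar>real_of_int d\<bar>"
    show ?thesis
    proof (rule meromorphic_at_ii_inf_growth[of _ 28800 "K\<^sup>2"])
      have "(f \<circ> moeb a b c d) holomorphic_on upper_half_plane"
      proof (rule holomorphic_on_compose_gen[OF _ hol])
        show "moeb a b c d holomorphic_on upper_half_plane"
          unfolding moeb_def[abs_def]
          by (intro holomorphic_intros) (use moeb_denom_nonzero det in \<open>auto simp: upper_half_plane_def\<close>)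
      qed (use pos in \<open>auto simp: upper_half_plane_def\<close>)
      thus "(\<lambda>\<tau>. f (moeb a b c d \<tau>)) holomorphic_on upper_half_plane" by (simp add: o_def)
    next
      fix \<tau> :: complex assume \<tau>: "Im \<tau> > 0"
      have "(1 - 28800 * a * c) * (1 + 28800 * a * c) - (28800 * a * a) * (- (28800 * c * c)) = 1"
        by (simp add: algebra_simps)
      from inv[OF this, of "- (a * c)" "- (c * c)" "a * c" "moeb a b c d \<tau>"] pos[OF \<tau>]
      show "f (moeb a b c d (\<tau> + of_nat 28800)) = f (moeb a b c d \<tau>)"
        using moeb_conj_T[OF \<tau> det, of 28800] by (simp add: mult.assoc)
    next
      fix \<tau> :: complex assume \<tau>: "Im \<tau> \<ge> 1" "\<bar>Re \<tau>\<bar> \<le> real 28800"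
      hence \<tau>0: "Im \<tau> > 0" by simp
      have "norm (of_int c * \<tau> + of_int d) \<le> \<bar>of_int c\<bar> * norm \<tau> + \<bar>real_of_int d\<bar>"
        using norm_triangle_ineq[of "of_int c * \<tau>" "of_int d"] by (simp add: norm_mult)
      also have "norm \<tau> \<le> 28801 * Im \<tau>" using cmod_le[of \<tau>] \<tau> by simp
      also have "\<bar>of_int c\<bar> * (28801 * Im \<tau>) + \<bar>real_of_int d\<bar> \<le> K * Im \<tau>"
        using \<tau>(1) mult_left_mono[OF \<tau>(1), of "\<bar>real_of_int d\<bar>"] by (simp add: K_def algebra_simps)
      finally have le: "norm (of_int c * \<tau> + of_int d) \<le> K * Im \<tau>" by (simp add: mult_left_mono)
      have "norm (f (moeb a b c d \<tau>)) \<le> exp (1 / Im (120 * moeb a b c d \<tau>))"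
        unfolding f_qprod[OF pos[OF \<tau>0]] using pos[OF \<tau>0] mnx by (intro norm_qprod_le) auto
      also have "1 / Im (120 * moeb a b c d \<tau>) \<le> 1 / Im (moeb a b c d \<tau>)"
        using pos[OF \<tau>0] by (intro divide_left_mono) auto
      also have "1 / Im (moeb a b c d \<tau>) = (norm (of_int c * \<tau> + of_int d))\<^sup>2 / Im \<tau>"
        by (simp add: Im_moeb[OF \<tau>0 det])
      also have "\<dots> \<le> (K * Im \<tau>)\<^sup>2 / Im \<tau>"
        using le \<tau>0 by (intro divide_right_mono power_mono) auto
      also have "\<dots> = K\<^sup>2 * Im \<tau>" using \<tau>0 by (simp add: power2_eq_square)
      finally show "norm (f (moeb a b c d \<tau>)) \<le> exp (K\<^sup>2 * Im \<tau>)" by simp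
    qed auto
  qed
  show ?thesis
    unfolding modular_function_def
  proof (intro conjI ballI)
    have "f analytic_on upper_half_plane"
      using hol open_upper_half_plane by (simp add: analytic_on_open)
    thus "f nicely_meromorphic_on upper_half_plane" by (rule analytic_on_imp_nicely_meromorphic_on)
  next
    fix \<gamma> :: "int^2^2" and \<tau> assume \<gamma>: "\<gamma> \<in> Gamma1 28800" and \<tau>: "\<tau> \<in> upper_half_plane"
    have det: "\<gamma> $ 1 $ 1 * \<gamma> $ 2 $ 2 - \<gamma> $ 1 $ 2 * \<gamma> $ 2 $ 1 = 1"
      using \<gamma> by (simp add: Gamma1_def SL2Z_def det_2)
    have "28800 dvd \<gamma> $ 1 $ 1 - 1" "28800 dvd \<gamma> $ 2 $ 1" "28800 dvd \<gamma> $ 2 $ 2 - 1"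
      using \<gamma> by (simp_all add: Gamma1_def cong_iff_dvd_diff)
    then obtain l k m' where "\<gamma> $ 1 $ 1 - 1 = 28800 * l" "\<gamma> $ 2 $ 1 = 28800 * k" "\<gamma> $ 2 $ 2 - 1 = 28800 * m'"
      by (elim dvdE)
    hence "\<gamma> $ 1 $ 1 = 1 + 28800 * l" "\<gamma> $ 2 $ 1 = 28800 * k" "\<gamma> $ 2 $ 2 = 1 + 28800 * m'" by simp_all
    from inv[OF det this] \<tau> show "f (moebius_act \<gamma> \<tau>) = f \<tau>"
      by (simp add: moebius_act_eq upper_half_plane_def)
  next
    fix \<gamma> :: "int^2^2" assume "\<gamma> \<in> SL2Z"
    hence "\<gamma> $ 1 $ 1 * \<gamma> $ 2 $ 2 - \<gamma> $ 1 $ 2 * \<gamma> $ 2 $ 1 = 1" by (simp add: SL2Z_def det_2)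
    from cusp[OF this] show "meromorphic_at_ii_inf (\<lambda>\<tau>. f (moebius_act \<gamma> \<tau>))"
      by (simp add: moebius_act_eq)
  qed
qed

lemma qpow_eq_qexp: "qpow \<tau> x = qexp (of_rat x * \<tau>)"
  by (simp add: qpow_def qexp_def mult.assoc)

text \<open>For this A and B = (l, 1/2) the exponent is a natural number plus C, since j^2 + j is
  even. So the only fractional power is qexp (C \<tau>), which factors out of the sum.\<close>

lemma nahm_sum_eq:
  assumes S: "((\<lambda>(i, j). qexp \<tau> ^ (2 * i^2 + i * j + (j^2 + j) div 2 + l * i)
      / (qpoch (qexp \<tau>) (qexp \<tau>) i * qpoch (qexp \<tau>) (qexp \<tau>) j)) has_sum S) (UNIV :: (nat \<times> nat) set)"
  shows "nahm_sum (vector [vector [4, 1], vector [1, 1]]) (vector [of_nat l, 1/2]) C \<tau> = qexp (of_rat C * \<tau>) * S"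
proof -
  have ex: "nahm_exponent (vector [vector [4, 1], vector [1, 1]]) (vector [of_nat l, 1/2]) C (vector [of_nat i, of_nat j])
      = of_nat (2 * i^2 + i * j + (j^2 + j) div 2 + l * i) + C" for i j
  proof -
    have "even (j^2 + j)" by simp
    hence "2 * ((j^2 + j) div 2) = j^2 + j" by simp
    hence "2 * (of_nat ((j^2 + j) div 2) :: rat) = of_nat (j^2 + j)"
      by (metis of_nat_mult of_nat_numeral)
    thus ?thesis
      by (simp add: nahm_exponent_def matrix_vector_mult_def sum_2 field_simps power2_eq_square)
  qed
  have "((\<lambda>(n1, n2). qpow \<tau> (nahm_exponent (vector [vector [4, 1], vector [1, 1]]) (vector [of_nat l, 1/2]) C (vector [of_nat n1, of_nat n2]))
          / (qpoch (qpow \<tau> 1) (qpow \<tau> 1) n1 * qpoch (qpow \<tau> 1) (qpow \<tau> 1) n2)) has_sum (qexp (of_rat C * \<tau>) * S)) (UNIV :: (nat \<times> nat) set)"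
  proof (rule has_sum_cong[THEN iffD1, OF _ has_sum_cmult_right[OF S]])
    have pow: "qpow \<tau> (of_nat N + C) = qexp (of_rat C * \<tau>) * qexp \<tau> ^ N" for N
      by (simp add: qpow_eq_qexp of_rat_add distrib_right qexp_add qexp_power)
    fix x :: "nat \<times> nat"
    show "qexp (of_rat C * \<tau>) * (case x of (i, j) \<Rightarrow> qexp \<tau> ^ (2 * i^2 + i * j + (j^2 + j) div 2 + l * i)
        / (qpoch (qexp \<tau>) (qexp \<tau>) i * qpoch (qexp \<tau>) (qexp \<tau>) j)) =
      (case x of (n1, n2) \<Rightarrow> qpow \<tau> (nahm_exponent (vector [vector [4, 1], vector [1, 1]]) (vector [of_nat l, 1/2]) C (vector [of_nat n1, of_nat n2]))
          / (qpoch (qpow \<tau> 1) (qpow \<tau> 1) n1 * qpoch (qpow \<tau> 1) (qpow \<tau> 1) n2))"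
      by (cases x) (simp only: prod.case ex pow, simp add: qpow_eq_qexp)
  qed
  thus ?thesis unfolding nahm_sum_def by (rule infsumI)
qed

theorem theorem3p4:
  shows "(\<forall>q::complex. norm q < 1 \<longrightarrow>
            ((\<lambda>(i, j). q ^ (2 * i^2 + i * j + (j^2 + j) div 2) / (qpoch q q i * qpoch q q j))
               has_sum (qpochs_inf [q^4, q^6, q^10] (q^10) / qpoch_inf q q))
              (UNIV :: (nat \<times> nat) set) \<and>
            ((\<lambda>(i, j). q ^ (2 * i^2 + i * j + (j^2 + j) div 2 + 2 * i) / (qpoch q q i * qpoch q q j))
               has_sum (qpochs_inf [q^2, q^8, q^10] (q^10) / qpoch_inf q q))
              (UNIV :: (nat \<times> nat) set)) \<and>
         (\<forall>(B, C) \<in> {(vector [0, 1/2] :: rat^2, 1/120 :: rat), (vector [2, 1/2], 49/120)}.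
            modular_function (Gamma1 28800)
              (\<lambda>\<tau>. nahm_sum (vector [vector [4, 1], vector [1, 1]]) B C (120 * \<tau>)))"
proof (intro conjI allI impI ballI)
  fix q :: complex assume "norm q < 1"
  thus "((\<lambda>(i, j). q ^ (2 * i^2 + i * j + (j^2 + j) div 2) / (qpoch q q i * qpoch q q j))
      has_sum (qpochs_inf [q^4, q^6, q^10] (q^10) / qpoch_inf q q)) (UNIV :: (nat \<times> nat) set)"
    and "((\<lambda>(i, j). q ^ (2 * i^2 + i * j + (j^2 + j) div 2 + 2 * i) / (qpoch q q i * qpoch q q j))
      has_sum (qpochs_inf [q^2, q^8, q^10] (q^10) / qpoch_inf q q)) (UNIV :: (nat \<times> nat) set)"
    by (rule nahm_rogers_ramanujan)+
next
  fix BC :: "(rat^2) \<times> rat"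
  assume BC: "BC \<in> {(vector [0, 1/2], 1/120), (vector [2, 1/2], 49/120)}"
  have 1: "modular_function (Gamma1 28800)
      (\<lambda>\<tau>. nahm_sum (vector [vector [4, 1], vector [1, 1]]) (vector [0, 1/2]) (1/120) (120 * \<tau>))"
  proof (rule modular_function_qprod)
    show "nahm_fun 1 \<tau> = qprod (of_real (1/120)) 4 6 \<tau>" if "Im \<tau> > 0" for \<tau>
      using nahm_fun_product(1)[OF that] by (simp add: qprod_def)
    fix \<tau> assume "Im \<tau> > 0"
    hence \<tau>: "Im (120 * \<tau>) > 0" by simp
    from nahm_sum_eq[of "120 * \<tau>" 0, simplified, OF nahm_rogers_ramanujan(1)[OF norm_qexp_less_1[OF \<tau>]], of "1/120"]
    show "nahm_sum (vector [vector [4, 1], vector [1, 1]]) (vector [0, 1/2]) (1/120) (120 * \<tau>) = nahm_fun 1 (120 * \<tau>)"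
      using nahm_fun_product(1)[OF \<tau>] by (simp add: of_rat_divide)
  qed auto
  have 2: "modular_function (Gamma1 28800)
      (\<lambda>\<tau>. nahm_sum (vector [vector [4, 1], vector [1, 1]]) (vector [2, 1/2]) (49/120) (120 * \<tau>))"
  proof (rule modular_function_qprod)
    show "nahm_fun 2 \<tau> = qprod (of_real (49/120)) 2 8 \<tau>" if "Im \<tau> > 0" for \<tau>
      using nahm_fun_product(2)[OF that] by (simp add: qprod_def)
    fix \<tau> assume "Im \<tau> > 0"
    hence \<tau>: "Im (120 * \<tau>) > 0" by simp
    from nahm_sum_eq[OF nahm_rogers_ramanujan(2)[OF norm_qexp_less_1[OF \<tau>]], of "49/120"]
    show "nahm_sum (vector [vector [4, 1], vector [1, 1]]) (vector [2, 1/2]) (49/120) (120 * \<tau>) = nahm_fun 2 (120 * \<tau>)"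
      using nahm_fun_product(2)[OF \<tau>] by (simp add: of_rat_divide)
  qed auto
  from BC 1 2 show "case BC of (B, C) \<Rightarrow> modular_function (Gamma1 28800)
      (\<lambda>\<tau>. nahm_sum (vector [vector [4, 1], vector [1, 1]]) B C (120 * \<tau>))"
    by auto
qed

end
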